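(* Let $n,k,p\ge1$ be integers and let $\varpi_{n,k,p}$ be the unique vexillary permutation of shape $\lambda_{n,p}=(np,(n-1)p,\dots,2p,p)$ and flag $\phi_{n,k}=(k+1,k+2,\dots,k+n)$. Then $$\mathfrak{G}^{(\beta-1)}_{\varpi_{n,1,p}}(x_i=1\ \forall i)=\sum_{j=1}^{n+1}\frac1{n+1}\binom{n+1}{j}\binom{(n+1)p}{j-1}\beta^{j-1}.$$ If $k\ge2$, then $G_{n,k,p}(\beta):=\mathfrak{G}^{(\beta-1)}_{\varpi_{n,k,p}}(x_i=1\ \forall i)$ is a polynomial of degree $nk$ in $\beta$, and the coefficient of $\beta^{nk}$ in $G_{n,k,p}(\beta)$ is $$\det\left(\binom{(n-i+1)(p-1)+j+k-1}{k+i-1}\right)_{1\le i,j\le n+1}.$$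
   Context: $\varpi_{n,k,p}$ is explicitly the permutation $1^k\times w_\lambda$ whose code $c_i=\#\{j>i:\varpi(j)<\varpi(i)\}$ is $(0^k,np,(n-1)p,\dots,p,0,0,\dots)$. $\beta$-Grothendieck polynomials: let $\mathrm{IdC}_m(\beta)$ be the associative $\mathbb{Z}[\beta]$-algebra with generators $e_1,\dots,e_{m-1}$ and relations $e_ie_j=e_je_i$ if $|i-j|\ge2$, $e_ie_je_i=e_je_ie_j$ if $|i-j|=1$, $e_i^2=\beta e_i$. For $w\in\mathbb{S}_m$ put $e_w=e_{i_1}\cdots e_{i_\ell}$ for any reduced word $w=s_{i_1}\cdots s_{i_\ell}$ ($s_i=(i,i+1)$, permutations composed from right to left). With $h_i(x)=1+xe_i$, $A_i(x)=h_{m-1}(x)\cdots h_i(x)$, the polynomials $\mathfrak{G}_w^{(\beta)}$ are defined by $A_1(x_1)\cdots A_{m-1}(x_{m-1})=\sum_{w\in\mathbb{S}_m}\mathfrak{G}_w^{(\beta)}(x_1,\dots,x_{m-1})e_w$; $\mathfrak{G}_w^{(\beta-1)}$ means $\beta$ is replaced by $\beta-1$. Binomial coefficients $\binom ac$ with $0\le a<c$ are zero. *)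

theory Defs
  imports
    "HOL-Library.Poly_Mapping"
    "HOL-Combinatorics.Permutations"
    "HOL-Computational_Algebra.Polynomial"
    "HOL-Algebra.QuotRing"
    "Jordan_Normal_Form.Determinant"
begin

section \<open>Permutations, codes, reduced words\<close>

text \<open>
  The symmetric group on m letters is the set of all w with w permutes {1..m}. Such a w is a
  function on all natural numbers, so the embeddings of the symmetric groups into each other are
  inclusions. The junk point 0 is always fixed.
\<close>

definition lehmer_code :: "(nat \<Rightarrow> nat) \<Rightarrow> nat \<Rightarrow> nat" where
  "lehmer_code w i = card {j. i < j \<and> w j < w i}"

text \<open>
  The vexillary permutation of shape \<open>(np, (n-1)p, \<dots>, p)\<close> and flag \<open>(k+1, \<dots>, k+n)\<close>: the
  permutation of the positive integers, moving only finitely many of them, with code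
  \<open>(0^k, np, (n-1)p, \<dots>, p, 0, 0, \<dots>)\<close>.
\<close>

definition varpi :: "nat \<Rightarrow> nat \<Rightarrow> nat \<Rightarrow> nat \<Rightarrow> nat" where
  "varpi n k p = (THE w. (\<exists>m. w permutes {1..m}) \<and>
     (\<forall>i\<ge>1. lehmer_code w i = (if k < i \<and> i \<le> k + n then (n + 1 - (i - k)) * p else 0)))"

text \<open>Function composition is composition of permutations from right to left.\<close>

definition word_perm :: "nat list \<Rightarrow> nat \<Rightarrow> nat" where
  "word_perm is = foldr (\<lambda>i f. transpose i (i + 1) \<circ> f) is id"

definition reduced_word :: "nat \<Rightarrow> (nat \<Rightarrow> nat) \<Rightarrow> nat list \<Rightarrow> bool" where
  "reduced_word m w is \<longleftrightarrow> set is \<subseteq> {1..<m} \<and> word_perm is = w \<and>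
     (\<forall>js. set js \<subseteq> {1..<m} \<and> word_perm js = w \<longrightarrow> length is \<le> length js)"

section \<open>The id-Coxeter algebra\<close>

text \<open>
  Words under concatenation, in additive notation, so that \<open>word \<Rightarrow>\<^sub>0 'r\<close> with its convolution
  product is the free associative algebra over \<open>'r\<close> on letters indexed by natural numbers.
\<close>

datatype word = Word (letters: "nat list")

instantiation word :: monoid_add
begin

definition zero_word :: word where "0 = Word []"

definition plus_word :: "word \<Rightarrow> word \<Rightarrow> word" where
  "u + v = Word (letters u @ letters v)"

instance
  by standard (simp_all add: zero_word_def plus_word_def)

end

definition scal :: "'r \<Rightarrow> word \<Rightarrow>\<^sub>0 'r::comm_ring_1" where
  "scal c = Poly_Mapping.single 0 c"

definition wmon :: "nat list \<Rightarrow> word \<Rightarrow>\<^sub>0 'r::comm_ring_1" where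
  "wmon is = Poly_Mapping.single (Word is) 1"

abbreviation gen :: "nat \<Rightarrow> word \<Rightarrow>\<^sub>0 'r::comm_ring_1" where
  "gen i \<equiv> wmon [i]"

definition FreeAlg :: "nat \<Rightarrow> (word \<Rightarrow>\<^sub>0 'r::comm_ring_1) ring" where
  "FreeAlg m = \<lparr>carrier = {f. \<forall>u \<in> Poly_Mapping.keys f. set (letters u) \<subseteq> {1..<m}},
     monoid.mult = (*), one = 1, zero = 0, add = (+)\<rparr>"

definition IdC_relators :: "nat \<Rightarrow> 'r \<Rightarrow> (word \<Rightarrow>\<^sub>0 'r::comm_ring_1) set" where
  "IdC_relators m b =
     {gen i * gen j - gen j * gen i | i j.
        i \<in> {1..<m} \<and> j \<in> {1..<m} \<and> \<bar>int i - int j\<bar> \<ge> 2} \<union>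
     {gen i * gen j * gen i - gen j * gen i * gen j | i j.
        i \<in> {1..<m} \<and> j \<in> {1..<m} \<and> \<bar>int i - int j\<bar> = 1} \<union>
     {gen i * gen i - scal b * gen i | i. i \<in> {1..<m}}"

text \<open>
  The ideal generated by the relators is automatically closed under scalars, which are elements
  of the free algebra. \<open>IdC_class m b f\<close> is the image of \<open>f\<close> in \<open>IdC m b\<close>.
\<close>

definition IdC_ideal :: "nat \<Rightarrow> 'r \<Rightarrow> (word \<Rightarrow>\<^sub>0 'r::comm_ring_1) set" where
  "IdC_ideal m b = Idl\<^bsub>FreeAlg m\<^esub> (IdC_relators m b)"

definition IdC :: "nat \<Rightarrow> 'r \<Rightarrow> (word \<Rightarrow>\<^sub>0 'r::comm_ring_1) set ring" where
  "IdC m b = FreeAlg m Quot IdC_ideal m b"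

definition IdC_class ::
    "nat \<Rightarrow> 'r \<Rightarrow> (word \<Rightarrow>\<^sub>0 'r::comm_ring_1) \<Rightarrow> (word \<Rightarrow>\<^sub>0 'r) set" where
  "IdC_class m b f = IdC_ideal m b +>\<^bsub>FreeAlg m\<^esub> f"

text \<open>
  Representatives of \<open>e\<^sub>w\<close> and of \<open>A\<^sub>i(x)\<close>, \<open>h\<^sub>i(x)\<close>. In \<open>IdC m b\<close> the class of \<open>e_perm m w\<close> does
  not depend on the reduced word.
\<close>

definition e_perm :: "nat \<Rightarrow> (nat \<Rightarrow> nat) \<Rightarrow> word \<Rightarrow>\<^sub>0 'r::comm_ring_1" where
  "e_perm m w = wmon (SOME is. reduced_word m w is)"

definition h_elem :: "nat \<Rightarrow> 'r \<Rightarrow> word \<Rightarrow>\<^sub>0 'r::comm_ring_1" where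
  "h_elem i x = 1 + scal x * gen i"

definition A_elem :: "nat \<Rightarrow> nat \<Rightarrow> 'r \<Rightarrow> word \<Rightarrow>\<^sub>0 'r::comm_ring_1" where
  "A_elem m i x = prod_list (map (\<lambda>j. h_elem j x) (rev [i..<m]))"

section \<open>Grothendieck polynomials\<close>

text \<open>
  Polynomials in \<open>x\<^sub>1, x\<^sub>2, \<dots>\<close> with coefficients in \<open>\<int>[\<beta>]\<close>; keys are exponent vectors and the
  variable of the type \<open>int poly\<close> is \<open>\<beta>\<close>.
\<close>

type_synonym xpoly = "(nat \<Rightarrow>\<^sub>0 nat) \<Rightarrow>\<^sub>0 int poly"

definition Xvar :: "nat \<Rightarrow> xpoly" where
  "Xvar i = Poly_Mapping.single (Poly_Mapping.single i 1) 1"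

definition Beta :: xpoly where
  "Beta = Poly_Mapping.single 0 [:0, 1:]"

text \<open>
  The defining expansion takes place in the id-Coxeter algebra with scalars extended from
  \<open>\<int>[\<beta>]\<close> to \<open>\<int>[\<beta>][x\<^sub>1, x\<^sub>2, \<dots>]\<close>, which has the same presentation. It determines the coefficients
  because the classes of the \<open>e_perm m w\<close> form a basis.
\<close>

definition Grothendieck :: "nat \<Rightarrow> (nat \<Rightarrow> nat) \<Rightarrow> xpoly" where
  "Grothendieck m = (THE \<GG>. (\<forall>w. \<not> w permutes {1..m} \<longrightarrow> \<GG> w = 0) \<and>
     IdC_class m Beta (prod_list (map (\<lambda>i. A_elem m i (Xvar i)) [1..<m])) =
     IdC_class m Beta (\<Sum>w | w permutes {1..m}. scal (\<GG> w) * e_perm m w))"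

definition shift_beta :: "xpoly \<Rightarrow> xpoly" where
  "shift_beta P = Poly_Mapping.map (\<lambda>c. pcompose c [:-1, 1:]) P"

definition eval_x :: "(nat \<Rightarrow> int poly) \<Rightarrow> xpoly \<Rightarrow> int poly" where
  "eval_x x P = (\<Sum>u \<in> Poly_Mapping.keys P. Poly_Mapping.lookup P u *
     (\<Prod>i \<in> Poly_Mapping.keys u. x i ^ Poly_Mapping.lookup u i))"

text \<open>The polynomial \<open>G\<^sub>n\<^sub>,\<^sub>k\<^sub>,\<^sub>p(\<beta>)\<close>, computed in the symmetric group on m letters.\<close>

definition G_poly :: "nat \<Rightarrow> nat \<Rightarrow> nat \<Rightarrow> nat \<Rightarrow> int poly" where
  "G_poly m n k p = eval_x (\<lambda>_. 1) (shift_beta (Grothendieck m (varpi n k p)))"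

text \<open>Rows and columns of \<open>mat\<close> are indexed from 0.\<close>

definition binom_matrix :: "nat \<Rightarrow> nat \<Rightarrow> nat \<Rightarrow> int mat" where
  "binom_matrix n k p = mat (n + 1) (n + 1) (\<lambda>(i0, j0).
     let i = i0 + 1; j = j0 + 1
     in int (((n + 1 - i) * (p - 1) + j + k - 1) choose (k + i - 1)))"

end

theory Submission
  imports Defs
begin

text \<open>
  Write \<open>\<lambda>\<^sub>r = (n + 1 - r) p\<close>. The id-Coxeter algebra acts from the right on functions of a permutation,
  and acting on the indicator function of the identity separates the elements \<open>e\<^sub>w\<close>. Hence the
  Grothendieck polynomials are the values of one function \<open>groth m b x\<close>, obtained by applying the
  operators \<open>A\<^sub>1(x\<^sub>1), A\<^sub>2(x\<^sub>2), \<dots>\<close> in turn (\<open>Grothendieck_eq_groth\<close>); that the defining expansion exists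
  at all follows from a normal form of words. The function \<open>groth\<close> commutes with ring homomorphisms, so
  the parameter and the variables may be specialized at any convenient moment.

  The product \<open>A\<^sub>i(x) A\<^sub>i\<^sub>+\<^sub>1(y) h\<^sub>i(y)\<close> is symmetric in \<open>x\<close> and \<open>y\<close>. This gives a divided difference
  recursion (\<open>groth_divided_difference\<close>), and on Lehmer codes one step of it replaces adjacent entries
  \<open>a > b\<close> by \<open>b, a - 1\<close>. For a weakly decreasing code the value is a monomial (\<open>groth_dominant\<close>). From the
  weakly decreasing code \<open>(\<lambda>\<^sub>1 + k, \<dots>, \<lambda>\<^sub>n + k)\<close> the code of \<open>\<varpi>\<close> is reached in \<open>n k\<close> steps, by moving row
  \<open>n\<close>, then row \<open>n - 1\<close>, and so on, \<open>k\<close> places to the right.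

  For \<open>k = 1\<close> there is one step per row. Setting the variables to the right of the current row to 1
  leaves a polynomial in one variable, and a step sends \<open>z\<^bsup>c\<^esup>\<close> to \<open>z\<^bsup>c\<^esup> + \<beta> (z\<^bsup>c+1\<^esup> + \<dots>)\<close>, up to the degree
  that the row allows. So the value counts the lattice paths \<open>0 \<le> c\<^sub>1 \<le> \<dots> \<le> c\<^sub>n\<close> with \<open>c\<^sub>i \<le> i p\<close> by their number
  of strict increases. Read from the end, these paths satisfy a recursion with an explicit solution
  (\<open>coeff_tail_sum\<close>), whose boundary value is the number in the theorem.

  For general \<open>k\<close> each step raises the degree in \<open>\<beta>\<close> by at most one, and on the coefficients of the top
  power it acts as \<open>x\<^sub>i x\<^sub>i\<^sub>+\<^sub>1 \<partial>\<^sub>i x\<^sub>i\<^bsup>-1\<^esup>\<close> with the ordinary divided difference \<open>\<partial>\<^sub>i\<close>. Up to a monomial these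
  steps thus compute a flagged Schur polynomial with row lengths \<open>(n + 1 - i) (p - 1)\<close> and flag \<open>k + i\<close>,
  given by a Jacobi-Trudi determinant because \<open>\<partial>\<close> acts on one row at a time
  (\<open>det_jt_mat_divided_difference\<close>, \<open>groth_shifted_stage\<close>). At ones its entries are the binomial
  coefficients of the theorem. Divisions by \<open>x\<^sub>i - x\<^sub>i\<^sub>+\<^sub>1\<close> are made possible by working with
  \<open>x\<^sub>i = 1 + i t\<close> and setting \<open>t = 0\<close> at the end. Finally the coefficient of \<open>\<beta>\<^bsup>n k\<^esup>\<close> is positive, since all
  operators have nonnegative coefficients at ones and one term is exhibited (\<open>coeff_G_poly_pos\<close>); so
  the degree is exactly \<open>n k\<close>.
\<close>

section \<open>The id-Coxeter algebra acts on functions of a permutation\<close>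

abbreviation adj :: "nat \<Rightarrow> nat \<Rightarrow> nat" where
  "adj i \<equiv> Transposition.transpose i (Suc i)"

text \<open>
  Think of a function \<open>\<phi>\<close> as the formal sum of the \<open>\<phi>(w) e\<^sub>w\<close>. This operator is right multiplication by
  \<open>e\<^sub>i\<close>: the coefficient of \<open>e\<^sub>w\<close> in the product comes from \<open>e\<^sub>w e\<^sub>i = b e\<^sub>w\<close> and from
  \<open>e\<^sub>w\<^sub>s e\<^sub>i = e\<^sub>w\<close>, both for a descent of \<open>w\<close> at \<open>i\<close>. A tie \<open>w i = w (i + 1)\<close> counts as
  no descent.
\<close>

definition idc_op :: "'r::comm_ring_1 \<Rightarrow> nat \<Rightarrow> ((nat \<Rightarrow> nat) \<Rightarrow> 'r) \<Rightarrow> (nat \<Rightarrow> nat) \<Rightarrow> 'r" where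
  "idc_op b i \<phi> w =
     (if w (Suc i) < w i then b * \<phi> w + \<phi> (w \<circ> adj i) else 0)"

definition h_op :: "'r::comm_ring_1 \<Rightarrow> nat \<Rightarrow> 'r \<Rightarrow> ((nat \<Rightarrow> nat) \<Rightarrow> 'r) \<Rightarrow> (nat \<Rightarrow> nat) \<Rightarrow> 'r" where
  "h_op b i x \<phi> w = \<phi> w + x * idc_op b i \<phi> w"

lemma idc_op_add: "idc_op b i (\<lambda>w. \<phi> w + \<psi> w) = (\<lambda>w. idc_op b i \<phi> w + idc_op b i \<psi> w)"
  by (auto simp: idc_op_def fun_eq_iff algebra_simps)

lemma idc_op_scale: "idc_op b i (\<lambda>w. r * \<phi> w) = (\<lambda>w. r * idc_op b i \<phi> w)"
  by (auto simp: idc_op_def fun_eq_iff algebra_simps)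

lemma idc_op_zero: "idc_op b i (\<lambda>w. 0) = (\<lambda>w. 0)"
  by (auto simp: idc_op_def fun_eq_iff)

lemma idc_op_square: "idc_op b i (idc_op b i \<phi>) = (\<lambda>w. b * idc_op b i \<phi> w)"
  by (auto simp: idc_op_def fun_eq_iff algebra_simps)

lemma transpose_far_commute:
  assumes "Suc i < j"
  shows "w \<circ> adj j \<circ> adj i = w \<circ> adj i \<circ> adj j"
  using assms by (auto simp: fun_eq_iff Transposition.transpose_def)

lemma idc_op_commute_aux:
  assumes "Suc i < j"
  shows "idc_op b i (idc_op b j \<phi>) = idc_op b j (idc_op b i \<phi>)"
proof
  fix w
  have t: "adj i j = j" "adj i (Suc j) = Suc j"
    "adj j i = i" "adj j (Suc i) = Suc i"
    using assms by (auto simp: Transposition.transpose_def)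
  show "idc_op b i (idc_op b j \<phi>) w = idc_op b j (idc_op b i \<phi>) w"
    unfolding idc_op_def comp_apply t transpose_far_commute[OF assms, of w]
    by (auto simp: algebra_simps)
qed

lemma idc_op_commute:
  assumes "\<bar>int i - int j\<bar> \<ge> 2"
  shows "idc_op b i (idc_op b j \<phi>) = idc_op b j (idc_op b i \<phi>)"
proof -
  have "Suc i < j \<or> Suc j < i" using assms by linarith
  then show ?thesis using idc_op_commute_aux[of i j b \<phi>] idc_op_commute_aux[of j i b \<phi>] by auto
qed

text \<open>
  The six orders of the three values at \<open>i\<close>, \<open>i + 1\<close>, \<open>i + 2\<close> are compared one by one.
\<close>

lemma idc_op_braid_Suc:
  "idc_op b i (idc_op b (Suc i) (idc_op b i \<phi>)) = idc_op b (Suc i) (idc_op b i (idc_op b (Suc i) \<phi>))"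
proof
  fix w :: "nat \<Rightarrow> nat"
  let ?s = "adj i" and ?t = "adj (Suc i)"
  have t: "?s i = Suc i" "?s (Suc i) = i" "?s (Suc (Suc i)) = Suc (Suc i)"
    "?t i = i" "?t (Suc i) = Suc (Suc i)" "?t (Suc (Suc i)) = Suc i"
    by (auto simp: Transposition.transpose_def)
  have inv: "w \<circ> ?s \<circ> ?s = w" "w \<circ> ?t \<circ> ?t = w" for w :: "nat \<Rightarrow> nat"
    by (auto simp: fun_eq_iff)
  have br: "w \<circ> ?s \<circ> ?t \<circ> ?s = w \<circ> ?t \<circ> ?s \<circ> ?t"
    by (auto simp: fun_eq_iff Transposition.transpose_def)
  show "idc_op b i (idc_op b (Suc i) (idc_op b i \<phi>)) w = idc_op b (Suc i) (idc_op b i (idc_op b (Suc i) \<phi>)) w"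
    unfolding idc_op_def comp_apply t inv br
    using less_trans[of "w (Suc (Suc i))" "w (Suc i)" "w i"] not_less_iff_gr_or_eq
    apply (cases "w (Suc i) < w i"; cases "w (Suc (Suc i)) < w (Suc i)"; cases "w (Suc (Suc i)) < w i")
    apply (simp_all only: if_True if_False less_irrefl not_less_iff_gr_or_eq simp_thms)
    apply (simp_all add: distrib_left mult.left_commute add_ac)
    done
qed

lemma idc_op_braid:
  assumes "\<bar>int i - int j\<bar> = 1"
  shows "idc_op b i (idc_op b j (idc_op b i \<phi>)) = idc_op b j (idc_op b i (idc_op b j \<phi>))"
proof -
  have "j = Suc i \<or> i = Suc j" using assms by linarith
  then show ?thesis using idc_op_braid_Suc[of b i \<phi>] idc_op_braid_Suc[of b j \<phi>] by auto
qed

lemma fold_idc_op_add: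
  "fold (idc_op b) is (\<lambda>w. \<phi> w + \<psi> w) = (\<lambda>w. fold (idc_op b) is \<phi> w + fold (idc_op b) is \<psi> w)"
  by (induction "is" arbitrary: \<phi> \<psi>) (auto simp: idc_op_add)

lemma fold_idc_op_scale:
  "fold (idc_op b) is (\<lambda>w. r * \<phi> w) = (\<lambda>w. r * fold (idc_op b) is \<phi> w)"
  by (induction "is" arbitrary: \<phi>) (auto simp: idc_op_scale)

lemma fold_idc_op_zero: "fold (idc_op b) is (\<lambda>w. 0) = (\<lambda>w. 0)"
  by (induction "is") (auto simp: idc_op_zero)

text \<open>
  The right action of the whole free algebra; the first letter of a word acts first, so products act
  in reverse order of composition.
\<close>

definition word_action :: "'r::comm_ring_1 \<Rightarrow> (word \<Rightarrow>\<^sub>0 'r) \<Rightarrow> ((nat \<Rightarrow> nat) \<Rightarrow> 'r) \<Rightarrow> (nat \<Rightarrow> nat) \<Rightarrow> 'r" where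
  "word_action b f \<phi> w =
     (\<Sum>u \<in> Poly_Mapping.keys f. Poly_Mapping.lookup f u * fold (idc_op b) (letters u) \<phi> w)"

text \<open>
  Additive induction over finitely supported functions, for statements that are linear in them.
\<close>

lemma poly_mapping_add_induct [case_names zero single add]:
  fixes f :: "'k \<Rightarrow>\<^sub>0 'r::comm_monoid_add"
  assumes "P 0" "\<And>k c. P (Poly_Mapping.single k c)" "\<And>f g. P f \<Longrightarrow> P g \<Longrightarrow> P (f + g)"
  shows "P f"
proof (induction f rule: update_induct)
  case const
  then show ?case using assms(1) by simp
next
  case (update f a b)
  have "Poly_Mapping.update a b f = f + Poly_Mapping.single a b"
    using update
    by (intro poly_mapping_eqI) (auto simp: lookup_update lookup_add lookup_single in_keys_iff)
  then show ?case using assms(2,3) update by simp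
qed

lemma word_action_add: "word_action b (f + g) \<phi> w = word_action b f \<phi> w + word_action b g \<phi> w"
  unfolding word_action_def
  by (rule setsum_keys_plus_distrib[where f = "\<lambda>u c. c * fold (idc_op b) (letters u) \<phi> w"])
     (auto simp: algebra_simps)

lemma word_action_single: "word_action b (Poly_Mapping.single u c) \<phi> w = c * fold (idc_op b) (letters u) \<phi> w"
  by (auto simp: word_action_def)

lemma word_action_zero: "word_action b 0 \<phi> w = 0"
  by (simp add: word_action_def)

lemma word_action_uminus: "word_action b (- f) \<phi> w = - word_action b f \<phi> w"
  using word_action_add[of b f "- f" \<phi> w] by (simp add: word_action_zero minus_unique)

lemma word_action_diff: "word_action b (f - g) \<phi> w = word_action b f \<phi> w - word_action b g \<phi> w"
  using word_action_add[of b f "- g" \<phi> w] by (simp add: word_action_uminus)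

lemma word_action_sum: "word_action b (\<Sum>a\<in>A. f a) \<phi> w = (\<Sum>a\<in>A. word_action b (f a) \<phi> w)"
  by (induction A rule: infinite_finite_induct) (auto simp: word_action_add word_action_zero)

lemma word_action_add_fun: "word_action b f (\<lambda>w. \<phi> w + \<psi> w) = (\<lambda>w. word_action b f \<phi> w + word_action b f \<psi> w)"
  by (auto simp: word_action_def fun_eq_iff fold_idc_op_add algebra_simps sum.distrib)

lemma word_action_scale_fun: "word_action b f (\<lambda>w. r * \<phi> w) = (\<lambda>w. r * word_action b f \<phi> w)"
  by (auto simp: word_action_def fun_eq_iff fold_idc_op_scale sum_distrib_left algebra_simps)

lemma word_action_zero_fun: "word_action b f (\<lambda>w. 0) = (\<lambda>w. 0)"
  by (auto simp: word_action_def fun_eq_iff fold_idc_op_zero)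

text \<open>
  By linearity in both factors it suffices to compare monomials, where it is concatenation of words.
\<close>

lemma word_action_mult: "word_action b (f * g) \<phi> = word_action b g (word_action b f \<phi>)"
proof (induction f rule: poly_mapping_add_induct)
  case zero
  then show ?case by (simp add: word_action_zero word_action_zero_fun fun_eq_iff)
next
  case (single k c)
  have 1: "word_action b (Poly_Mapping.single k c) \<phi> = (\<lambda>w. c * fold (idc_op b) (letters k) \<phi> w)" for k c \<phi>
    by (simp add: word_action_single fun_eq_iff)
  show ?case
  proof (induction g rule: poly_mapping_add_induct)
    case zero
    then show ?case by (simp add: word_action_zero word_action_zero_fun fun_eq_iff)
  next
    case (single l d)
    then show ?case
      by (simp add: mult_single 1 fold_idc_op_scale plus_word_def algebra_simps)
  next
    case (add f g)
    then show ?case by (simp add: distrib_left fun_eq_iff word_action_add)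
  qed
next
  case (add f g')
  have "word_action b (f + g') \<phi> = (\<lambda>w. word_action b f \<phi> w + word_action b g' \<phi> w)" by (simp add: word_action_add fun_eq_iff)
  then show ?case using add by (simp add: distrib_right fun_eq_iff word_action_add word_action_add_fun)
qed

lemma letters_zero [simp]: "letters 0 = []"
  by (simp add: zero_word_def)

lemma word_action_one: "word_action b 1 \<phi> = \<phi>"
  by (simp add: word_action_def fun_eq_iff)

lemma word_action_scal: "word_action b (scal c) \<phi> = (\<lambda>w. c * \<phi> w)"
  by (simp add: fun_eq_iff scal_def word_action_single zero_word_def)

lemma word_action_wmon: "word_action b (wmon is) \<phi> = fold (idc_op b) is \<phi>"
  by (simp add: fun_eq_iff wmon_def word_action_single)

lemma word_action_h_elem: "word_action b (h_elem i x) \<phi> = h_op b i x \<phi>"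
  by (simp add: fun_eq_iff h_elem_def word_action_add word_action_one word_action_mult word_action_scal word_action_wmon idc_op_scale h_op_def)

lemma word_action_prod_list: "word_action b (prod_list fs) \<phi> = fold (word_action b) fs \<phi>"
  by (induction fs arbitrary: \<phi>) (auto simp: word_action_one word_action_mult)

definition A_op :: "nat \<Rightarrow> 'r::comm_ring_1 \<Rightarrow> nat \<Rightarrow> 'r \<Rightarrow> ((nat \<Rightarrow> nat) \<Rightarrow> 'r) \<Rightarrow> (nat \<Rightarrow> nat) \<Rightarrow> 'r" where
  "A_op m b i x = fold (\<lambda>j. h_op b j x) (rev [i..<m])"

lemma word_action_A_elem: "word_action b (A_elem m i x) \<phi> = A_op m b i x \<phi>"
  unfolding A_elem_def A_op_def word_action_prod_list fold_map
  by (simp add: comp_def word_action_h_elem[abs_def])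

definition delta :: "(nat \<Rightarrow> nat) \<Rightarrow> (nat \<Rightarrow> nat) \<Rightarrow> 'r::comm_ring_1" where
  "delta v w = (if w = v then 1 else 0)"

text \<open>
  The coefficients of \<open>A\<^sub>1(x\<^sub>1) \<dots> A\<^sub>m\<^sub>-\<^sub>1(x\<^sub>m\<^sub>-\<^sub>1)\<close> with respect to the \<open>e\<^sub>w\<close>, obtained by acting on the
  indicator function of the identity.
\<close>

definition groth :: "nat \<Rightarrow> 'r::comm_ring_1 \<Rightarrow> (nat \<Rightarrow> 'r) \<Rightarrow> (nat \<Rightarrow> nat) \<Rightarrow> 'r" where
  "groth m b x = fold (\<lambda>i. A_op m b i (x i)) [1..<m] (delta id)"

lemma word_action_A_product:
  "word_action b (prod_list (map (\<lambda>i. A_elem m i (x i)) [1..<m])) (delta id) = groth m b x"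
  unfolding groth_def word_action_prod_list fold_map
  by (simp add: comp_def word_action_A_elem[abs_def])

section \<open>The free algebra and its ideal of relations\<close>

lemma FreeAlg_sel [simp]:
  "monoid.mult (FreeAlg m) = (*)" "one (FreeAlg m) = 1" "zero (FreeAlg m) = 0" "add (FreeAlg m) = (+)"
  by (simp_all add: FreeAlg_def)

lemma in_FreeAlg_iff:
  "f \<in> carrier (FreeAlg m) \<longleftrightarrow> (\<forall>u \<in> Poly_Mapping.keys f. set (letters u) \<subseteq> {1..<m})"
  by (simp add: FreeAlg_def)

lemma FreeAlg_add: "f \<in> carrier (FreeAlg m) \<Longrightarrow> g \<in> carrier (FreeAlg m) \<Longrightarrow> f + g \<in> carrier (FreeAlg m)"
  unfolding in_FreeAlg_iff using keys_add[of f g] by blast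

lemma FreeAlg_uminus: "f \<in> carrier (FreeAlg m) \<Longrightarrow> - f \<in> carrier (FreeAlg m)"
  unfolding in_FreeAlg_iff by (simp add: in_keys_iff)

lemma FreeAlg_mult:
  assumes "f \<in> carrier (FreeAlg m)" "g \<in> carrier (FreeAlg m)"
  shows "f * g \<in> carrier (FreeAlg m)"
  unfolding in_FreeAlg_iff
proof
  fix u assume "u \<in> Poly_Mapping.keys (f * g)"
  then obtain a c where "u = a + c" "a \<in> Poly_Mapping.keys f" "c \<in> Poly_Mapping.keys g"
    using keys_mult[of f g] by blast
  then show "set (letters u) \<subseteq> {1..<m}" using assms unfolding in_FreeAlg_iff by (auto simp: plus_word_def)
qed

lemma FreeAlg_zero: "0 \<in> carrier (FreeAlg m)" and FreeAlg_one: "1 \<in> carrier (FreeAlg m)"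
  by (simp_all add: in_FreeAlg_iff zero_word_def)

lemma ring_FreeAlg: "ring (FreeAlg m :: (word \<Rightarrow>\<^sub>0 'r::comm_ring_1) ring)"
proof (rule ringI)
  let ?R = "FreeAlg m :: (word \<Rightarrow>\<^sub>0 'r::comm_ring_1) ring"
  show "abelian_group ?R"
  proof (rule abelian_groupI)
    fix f assume f: "f \<in> carrier ?R"
    show "\<exists>g\<in>carrier ?R. g \<oplus>\<^bsub>?R\<^esub> f = \<zero>\<^bsub>?R\<^esub>"
      by (rule bexI[OF _ FreeAlg_uminus[OF f]]) simp
  qed (simp_all add: FreeAlg_add FreeAlg_zero add_ac)
  show "Group.monoid ?R"
    by (rule monoidI) (simp_all add: FreeAlg_mult FreeAlg_one mult.assoc)
qed (simp_all add: algebra_simps)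

lemma FreeAlg_diff: "f \<in> carrier (FreeAlg m) \<Longrightarrow> g \<in> carrier (FreeAlg m) \<Longrightarrow> f - g \<in> carrier (FreeAlg m)"
  using FreeAlg_add[of f m "- g"] FreeAlg_uminus[of g m] by simp

lemmas FreeAlg_closed = FreeAlg_add FreeAlg_mult FreeAlg_uminus FreeAlg_diff
lemmas FreeAlg_zero_one = FreeAlg_zero FreeAlg_one

lemma carrier_FreeAlg_single:
  "set (letters u) \<subseteq> {1..<m} \<Longrightarrow> Poly_Mapping.single u c \<in> carrier (FreeAlg m)"
  by (simp add: in_FreeAlg_iff)

lemma FreeAlg_scal: "scal c \<in> carrier (FreeAlg m)"
  unfolding scal_def by (rule carrier_FreeAlg_single) (simp add: zero_word_def)

lemma FreeAlg_wmon: "set is \<subseteq> {1..<m} \<Longrightarrow> wmon is \<in> carrier (FreeAlg m)"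
  unfolding wmon_def by (rule carrier_FreeAlg_single) simp

lemma FreeAlg_prod_list:
  "(\<And>f. f \<in> set fs \<Longrightarrow> f \<in> carrier (FreeAlg m)) \<Longrightarrow> prod_list fs \<in> carrier (FreeAlg m)"
  by (induction fs) (auto simp: FreeAlg_zero_one FreeAlg_closed)

lemma FreeAlg_A_elem: "1 \<le> i \<Longrightarrow> A_elem m i x \<in> carrier (FreeAlg m)"
  unfolding A_elem_def h_elem_def
  by (intro FreeAlg_prod_list) (auto intro!: FreeAlg_closed FreeAlg_zero_one FreeAlg_scal FreeAlg_wmon)

lemma IdC_relators_carrier: "IdC_relators m b \<subseteq> carrier (FreeAlg m)"
  unfolding IdC_relators_def by (auto intro!: FreeAlg_closed FreeAlg_scal FreeAlg_wmon)

lemma ideal_IdC_ideal: "ideal (IdC_ideal m b) (FreeAlg m)"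
  unfolding IdC_ideal_def by (rule ring.genideal_ideal[OF ring_FreeAlg IdC_relators_carrier])

lemma relator_in_IdC_ideal: "r \<in> IdC_relators m b \<Longrightarrow> r \<in> IdC_ideal m b"
  unfolding IdC_ideal_def using ring.genideal_self[OF ring_FreeAlg IdC_relators_carrier] by blast

lemma IdC_ideal_closed:
  fixes f g :: "word \<Rightarrow>\<^sub>0 'r::comm_ring_1"
  shows "0 \<in> IdC_ideal m b"
    and "f \<in> IdC_ideal m b \<Longrightarrow> g \<in> IdC_ideal m b \<Longrightarrow> f + g \<in> IdC_ideal m b"
    and "f \<in> IdC_ideal m b \<Longrightarrow> g \<in> carrier (FreeAlg m) \<Longrightarrow> g * f \<in> IdC_ideal m b"
    and "f \<in> IdC_ideal m b \<Longrightarrow> g \<in> carrier (FreeAlg m) \<Longrightarrow> f * g \<in> IdC_ideal m b"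
    and "f \<in> IdC_ideal m b \<Longrightarrow> - f \<in> IdC_ideal m b"
proof -
  interpret ideal "IdC_ideal m b" "FreeAlg m" by (rule ideal_IdC_ideal)
  show "0 \<in> IdC_ideal m b" using additive_subgroup.zero_closed[OF is_additive_subgroup] by simp
  show "f \<in> IdC_ideal m b \<Longrightarrow> g \<in> IdC_ideal m b \<Longrightarrow> f + g \<in> IdC_ideal m b"
    using additive_subgroup.a_closed[OF is_additive_subgroup, of f g] by simp
  show l: "f \<in> IdC_ideal m b \<Longrightarrow> g \<in> carrier (FreeAlg m) \<Longrightarrow> g * f \<in> IdC_ideal m b" for f g
    using I_l_closed[of f g] by simp
  show "f \<in> IdC_ideal m b \<Longrightarrow> g \<in> carrier (FreeAlg m) \<Longrightarrow> f * g \<in> IdC_ideal m b"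
    using I_r_closed[of f g] by simp
  show "f \<in> IdC_ideal m b \<Longrightarrow> - f \<in> IdC_ideal m b"
    using l[of f "- 1"] by (simp add: FreeAlg_closed FreeAlg_zero_one)
qed

text \<open>
  The elements that act as zero form a two-sided ideal, and it contains the relators.
\<close>

lemma word_action_IdC_ideal:
  fixes f :: "word \<Rightarrow>\<^sub>0 'r::comm_ring_1"
  assumes "f \<in> IdC_ideal m b"
  shows "word_action b f \<phi> = (\<lambda>w. 0)"
proof -
  let ?R = "FreeAlg m :: (word \<Rightarrow>\<^sub>0 'r) ring"
  let ?K = "{f \<in> carrier ?R. \<forall>\<phi>. word_action b f \<phi> = (\<lambda>w. 0)}"
  have "ideal ?K ?R"
  proof (rule idealI[OF ring_FreeAlg])
    show "subgroup ?K (add_monoid ?R)"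
    proof (rule subgroup.intro)
      show "inv\<^bsub>add_monoid ?R\<^esub> f \<in> ?K" if f: "f \<in> ?K" for f
      proof -
        have "inv\<^bsub>add_monoid ?R\<^esub> f = - f"
        proof (rule group.inv_equality)
          show "group (add_monoid ?R)"
            by (rule abelian_group.a_group[OF ring.is_abelian_group[OF ring_FreeAlg]])
        qed (use f FreeAlg_closed(3)[of f m] in auto)
        then show ?thesis using f FreeAlg_closed(3)[of f m] by (auto simp: word_action_uminus fun_eq_iff)
      qed
      show "?K \<subseteq> carrier (add_monoid ?R)" by auto
      show "\<one>\<^bsub>add_monoid ?R\<^esub> \<in> ?K" by (auto simp: FreeAlg_zero word_action_zero)
      fix f g assume "f \<in> ?K" "g \<in> ?K"
      then show "f \<otimes>\<^bsub>add_monoid ?R\<^esub> g \<in> ?K"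
        using FreeAlg_closed(1)[of f m g] by (auto simp: word_action_add fun_eq_iff)
    qed
    fix f g assume "f \<in> ?K" "g \<in> carrier ?R"
    then show "g \<otimes>\<^bsub>?R\<^esub> f \<in> ?K" "f \<otimes>\<^bsub>?R\<^esub> g \<in> ?K"
      using FreeAlg_closed(2)[of f m g] FreeAlg_closed(2)[of g m f]
      by (auto simp: word_action_mult word_action_zero_fun)
  qed
  moreover have "IdC_relators m b \<subseteq> ?K"
  proof
    fix r assume r: "r \<in> IdC_relators m b"
    then have "word_action b r \<phi> = (\<lambda>w. 0)" for \<phi>
      unfolding IdC_relators_def using idc_op_commute[of _ _ b \<phi>] idc_op_braid[of _ _ b \<phi>]
      by (auto simp: word_action_diff word_action_mult word_action_wmon word_action_scal fun_eq_iff idc_op_square idc_op_scale)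
    then show "r \<in> ?K" using r IdC_relators_carrier by blast
  qed
  ultimately have "IdC_ideal m b \<subseteq> ?K"
    unfolding IdC_ideal_def by (rule ring.genideal_minimal[OF ring_FreeAlg])
  then show ?thesis using assms by blast
qed

lemma IdC_class_eq_iff:
  "IdC_class m b f = IdC_class m b g \<longleftrightarrow> f - g \<in> IdC_ideal m b"
proof -
  have cl: "IdC_class m b f = {h + f | h. h \<in> IdC_ideal m b}" for f
    unfolding IdC_class_def a_r_coset_def r_coset_def by auto
  show ?thesis
  proof
    assume "IdC_class m b f = IdC_class m b g"
    moreover have "f \<in> IdC_class m b f" unfolding cl using IdC_ideal_closed(1)[of m b] by force
    ultimately show "f - g \<in> IdC_ideal m b" unfolding cl by force
  next
    assume *: "f - g \<in> IdC_ideal m b"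
    have sub: "IdC_class m b f \<subseteq> IdC_class m b g" if "f - g \<in> IdC_ideal m b" for f g
    proof
      fix u assume "u \<in> IdC_class m b f"
      then obtain h where "h \<in> IdC_ideal m b" "u = h + f" unfolding cl by blast
      then show "u \<in> IdC_class m b g" unfolding cl
        using IdC_ideal_closed(2)[OF _ that, of h] by (auto intro!: exI[of _ "h + (f - g)"])
    qed
    show "IdC_class m b f = IdC_class m b g"
      using sub[OF *] sub[of g f] IdC_ideal_closed(5)[OF *] by auto
  qed
qed

section \<open>Lehmer codes, inversions and reduced words\<close>

lemma finite_lehmer_set:
  assumes "inj w"
  shows "finite {j. t < j \<and> w j < (w t :: nat)}"
proof -
  have "finite (w -` {..<w t})" by (rule finite_vimageI[OF _ assms]) simp
  then show ?thesis by (rule rev_finite_subset) auto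
qed

lemma comp_adj_adj [simp]: "w \<circ> adj i \<circ> adj i = w"
  by (auto simp: fun_eq_iff)

text \<open>
  Exchanging the values at a descent exchanges the two entries of the code and lowers the larger one
  by one, since the exchanged pair itself is no longer an inversion. All later computations take
  place on codes by means of this rule.
\<close>

lemma lehmer_code_adj:
  fixes w :: "nat \<Rightarrow> nat"
  assumes inj: "inj w" and desc: "w (Suc i) < w i"
  shows "lehmer_code (w \<circ> adj i) i = lehmer_code w (Suc i)"
    and "lehmer_code w i = Suc (lehmer_code (w \<circ> adj i) (Suc i))"
    and "t \<noteq> i \<Longrightarrow> t \<noteq> Suc i \<Longrightarrow> lehmer_code (w \<circ> adj i) t = lehmer_code w t"
proof -
  define u where "u = w \<circ> adj i"
  have u: "u i = w (Suc i)" "u (Suc i) = w i" "\<And>j. j \<noteq> i \<Longrightarrow> j \<noteq> Suc i \<Longrightarrow> u j = w j"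
    by (simp_all add: u_def)
  have "inj u" unfolding u_def using inj by (intro inj_compose) auto
  have 0: "{j. i < j \<and> u j < u i} = {j. Suc i < j \<and> w j < w (Suc i)}"
  proof (intro Collect_cong)
    fix j
    show "i < j \<and> u j < u i \<longleftrightarrow> Suc i < j \<and> w j < w (Suc i)"
    proof (cases "j = i \<or> j = Suc i")
      case True
      then show ?thesis using desc by (auto simp: u)
    next
      case False
      then have "i < j \<longleftrightarrow> Suc i < j" by linarith
      then show ?thesis using False by (simp add: u)
    qed
  qed
  then show "lehmer_code (w \<circ> adj i) i = lehmer_code w (Suc i)" by (simp add: lehmer_code_def u_def)
  have 2: "{j. i < j \<and> w j < w i} = insert (Suc i) {j. Suc i < j \<and> u j < u (Suc i)}"
  proof (rule Set.set_eqI)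
    fix j
    show "j \<in> {j. i < j \<and> w j < w i} \<longleftrightarrow> j \<in> insert (Suc i) {j. Suc i < j \<and> u j < u (Suc i)}"
    proof (cases "j = i \<or> j = Suc i")
      case True
      then show ?thesis using desc by (auto simp: u)
    next
      case False
      then have "i < j \<longleftrightarrow> Suc i < j" by linarith
      then show ?thesis using False by (simp add: u)
    qed
  qed
  have "lehmer_code w i = Suc (lehmer_code u (Suc i))" unfolding lehmer_code_def 2
    using finite_lehmer_set[OF \<open>inj u\<close>, of "Suc i"] by simp
  then show "lehmer_code w i = Suc (lehmer_code (w \<circ> adj i) (Suc i))" by (simp add: u_def)
  assume t: "t \<noteq> i" "t \<noteq> Suc i"
  have gt: "t < adj i j \<longleftrightarrow> t < j" for j
  proof (cases "j = i \<or> j = Suc i")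
    case True
    then show ?thesis using t by auto
  qed simp
  have "{j. t < j \<and> u j < u t} = adj i -` {j. t < j \<and> w j < w t}"
    unfolding vimage_Collect_eq gt u(3)[OF t] by (simp add: u_def)
  moreover have "card (adj i -` {j. t < j \<and> w j < w t}) = card {j. t < j \<and> w j < w t}"
    by (rule card_vimage_inj[OF inj_transpose]) (simp add: bij_is_surj)
  ultimately show "lehmer_code (w \<circ> adj i) t = lehmer_code w t"
    unfolding lehmer_code_def u_def by simp
qed

lemma lehmer_code_less_iff_descent:
  fixes w :: "nat \<Rightarrow> nat"
  assumes inj: "inj w"
  shows "lehmer_code w (Suc i) < lehmer_code w i \<longleftrightarrow> w (Suc i) < w i"
proof
  assume d: "w (Suc i) < w i"
  have "{j. Suc i < j \<and> w j < w (Suc i)} \<subset> {j. i < j \<and> w j < w i}" using d by auto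
  then show "lehmer_code w (Suc i) < lehmer_code w i"
    unfolding lehmer_code_def by (intro psubset_card_mono finite_lehmer_set inj)
next
  assume l: "lehmer_code w (Suc i) < lehmer_code w i"
  show "w (Suc i) < w i"
  proof (rule ccontr)
    assume "\<not> w (Suc i) < w i"
    then have "{j. i < j \<and> w j < w i} \<subseteq> {j. Suc i < j \<and> w j < w (Suc i)}"
      by (auto intro!: Suc_lessI)
    then have "lehmer_code w i \<le> lehmer_code w (Suc i)"
      unfolding lehmer_code_def by (intro card_mono finite_lehmer_set inj)
    then show False using l by simp
  qed
qed

lemma permutes_adj: "w permutes {1..m} \<Longrightarrow> 1 \<le> i \<Longrightarrow> i < m \<Longrightarrow> w \<circ> adj i permutes {1..m}"
  by (intro permutes_compose permutes_swap_id) auto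

lemma permutes_inj_nat: "w permutes {1..m::nat} \<Longrightarrow> inj w"
  by (rule permutes_inj)

lemma descent_range:
  assumes "w permutes {1..m::nat}" "w (Suc i) < w i"
  shows "1 \<le> i" "i < m"
proof -
  have 0: "w j = j" if "j \<notin> {1..m}" for j using assms(1) that by (auto simp: permutes_def)
  show "1 \<le> i" using assms(2) 0[of 0] by (cases i) auto
  show "i < m"
  proof (rule ccontr)
    assume "\<not> i < m"
    then have "w (Suc i) = Suc i" by (intro 0) auto
    moreover have "w i \<le> i"
    proof (cases "i = m")
      case True
      then show ?thesis using permutes_in_image[OF assms(1), of i] \<open>1 \<le> i\<close> by auto
    next
      case False
      then show ?thesis using 0[of i] \<open>\<not> i < m\<close> by auto
    qed
    ultimately show False using assms(2) by simp
  qed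
qed

text \<open>
  An increasing bijection of the natural numbers maps initial segments to initial segments.
\<close>

lemma no_descent_imp_id:
  assumes p: "w permutes {1..m::nat}" and nd: "\<And>i. \<not> w (Suc i) < w i"
  shows "w = id"
proof -
  have "w i < w (Suc i)" for i using nd[of i] permutes_inj[OF p] by (metis injD n_not_Suc_n nat_neq_iff)
  then have sm: "strict_mono w" by (simp add: strict_mono_Suc_iff)
  have le: "j \<le> w j" for j by (rule strict_mono_imp_increasing[OF sm])
  have "w j = j" for j
  proof (rule ccontr)
    assume "w j \<noteq> j"
    then have lt: "j < w j" using le[of j] by simp
    obtain l where l: "w l = j" using permutes_surj[OF p] by (metis surjD)
    then have "l \<le> j" using le[of l] by simp
    then have "w l < w j" if "l \<noteq> j" using that sm by (simp add: strict_mono_less)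
    moreover have "{..<w j} = w ` {..<j}"
    proof (rule Set.set_eqI)
      fix v
      obtain l where l: "w l = v" using permutes_surj[OF p] by (metis surjD)
      show "v \<in> {..<w j} \<longleftrightarrow> v \<in> w ` {..<j}"
        using l sm by (auto simp: strict_mono_less image_iff strict_mono_eq)
    qed
    then have "card {..<w j} = card {..<j}"
      by (metis card_image inj_on_subset permutes_inj[OF p] subset_UNIV)
    then show False using lt by simp
  qed
  then show ?thesis by (auto simp: fun_eq_iff)
qed

definition inversions :: "nat \<Rightarrow> (nat \<Rightarrow> nat) \<Rightarrow> nat" where
  "inversions m w = (\<Sum>i = 1..m. lehmer_code w i)"

lemma inversions_adj:
  assumes p: "w permutes {1..m}" and d: "w (Suc i) < w i"
  shows "inversions m w = Suc (inversions m (w \<circ> adj i))"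
proof -
  note r = descent_range[OF p d]
  note c = lehmer_code_adj[OF permutes_inj_nat[OF p] d]
  have S: "{1..m} = insert i (insert (Suc i) ({1..m} - {i, Suc i}))" using r by auto
  have "inversions m v = lehmer_code v i + (lehmer_code v (Suc i) + (\<Sum>t\<in>{1..m} - {i, Suc i}. lehmer_code v t))" for v
    unfolding inversions_def by (subst S) simp
  then show ?thesis using c by simp
qed

lemma lehmer_code_id: "lehmer_code id i = 0"
  by (auto simp: lehmer_code_def)

lemma lehmer_code_le:
  assumes p: "w permutes {1..m}" and "1 \<le> i"
  shows "lehmer_code w i \<le> m - i"
proof -
  have "{j. i < j \<and> w j < w i} \<subseteq> {i<..m}"
  proof
    fix j assume j: "j \<in> {j. i < j \<and> w j < w i}"
    show "j \<in> {i<..m}"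
    proof (rule ccontr)
      assume "j \<notin> {i<..m}"
      then have j': "m < j" using j by auto
      then have wj: "w j = j" using p by (auto simp: permutes_def)
      show False
      proof (cases "i \<le> m")
        case True
        then have "w i \<le> m" using permutes_in_image[OF p, of i] \<open>1 \<le> i\<close> by auto
        then show False using j j' wj by auto
      next
        case False
        then have "w i = i" using p by (auto simp: permutes_def)
        then show False using j wj by auto
      qed
    qed
  qed
  then have "card {j. i < j \<and> w j < w i} \<le> card {i<..m}" by (rule card_mono[rotated]) simp
  then show ?thesis by (simp add: lehmer_code_def)
qed

lemma inversions_id: "inversions m id = 0"
  by (simp add: inversions_def lehmer_code_id)

lemma foldr_adj_comp: "foldr (\<lambda>i f. Transposition.transpose i (i + 1) \<circ> f) is g = word_perm is \<circ> g"
  by (induction "is") (simp_all add: word_perm_def comp_assoc)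

lemma word_perm_Nil [simp]: "word_perm [] = id"
  by (simp add: word_perm_def)

lemma word_perm_append: "word_perm (is @ js) = word_perm is \<circ> word_perm js"
  unfolding word_perm_def foldr_append using foldr_adj_comp by (simp add: word_perm_def)

lemma word_perm_single [simp]: "word_perm [i] = adj i"
  by (simp add: word_perm_def)

lemma word_perm_permutes: "set is \<subseteq> {1..<m} \<Longrightarrow> word_perm is permutes {1..m}"
proof (induction "is" rule: rev_induct)
  case Nil
  show ?case unfolding word_perm_Nil by (rule permutes_id)
next
  case (snoc i "is")
  then show ?case unfolding word_perm_append word_perm_single by (intro permutes_adj) auto
qed

lemma adj_descent_flip:
  assumes "inj w"
  shows "(w \<circ> adj i) (Suc i) < (w \<circ> adj i) i \<longleftrightarrow> \<not> w (Suc i) < (w i :: nat)"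
  using injD[OF assms, of i "Suc i"] by (auto simp: not_less le_less)

lemma inversions_word_perm_le:
  "set is \<subseteq> {1..<m} \<Longrightarrow> inversions m (word_perm is) \<le> length is"
proof (induction "is" rule: rev_induct)
  case Nil
  show ?case unfolding word_perm_Nil inversions_id by simp
next
  case (snoc i "is")
  let ?u = "word_perm is"
  have p: "?u permutes {1..m}" using snoc.prems by (intro word_perm_permutes) simp
  have p': "?u \<circ> adj i permutes {1..m}" using p snoc.prems by (intro permutes_adj) auto
  have le: "inversions m ?u \<le> length is" using snoc.IH snoc.prems by simp
  show ?case
  proof (cases "?u (Suc i) < ?u i")
    case True
    then have "inversions m (?u \<circ> adj i) \<le> length (is @ [i])"
      using inversions_adj[OF p True] le by simp
    then show ?thesis unfolding word_perm_append word_perm_single .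
  next
    case False
    then have "(?u \<circ> adj i) (Suc i) < (?u \<circ> adj i) i"
      using adj_descent_flip[OF permutes_inj_nat[OF p]] by blast
    from inversions_adj[OF p' this] have "inversions m (?u \<circ> adj i) \<le> length (is @ [i])"
      unfolding comp_adj_adj using le by (simp add: comp_def)
    then show ?thesis unfolding word_perm_append word_perm_single .
  qed
qed

text \<open>
  Bubble sort: removing a descent lowers the number of inversions by one.
\<close>

lemma exists_word_of_inversions_length:
  "w permutes {1..m} \<Longrightarrow> \<exists>is. set is \<subseteq> {1..<m} \<and> word_perm is = w \<and> length is = inversions m w"
proof (induction "inversions m w" arbitrary: w rule: less_induct)
  case less
  show ?case
  proof (cases "\<exists>i. w (Suc i) < w i")
    case False
    then show ?thesis using no_descent_imp_id[OF less.prems]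
      by (intro exI[of _ "[]"]) (auto simp: inversions_id)
  next
    case True
    then obtain i where i: "w (Suc i) < w i" by blast
    note r = descent_range[OF less.prems i]
    obtain "is" where "set is \<subseteq> {1..<m}" "word_perm is = w \<circ> adj i" "length is = inversions m (w \<circ> adj i)"
      using less.hyps[of "w \<circ> adj i"] inversions_adj[OF less.prems i] permutes_adj[OF less.prems r] by auto
    then show ?thesis using r inversions_adj[OF less.prems i]
      by (intro exI[of _ "is @ [i]"]) (auto simp: word_perm_append)
  qed
qed

lemma reduced_word_iff:
  assumes "w permutes {1..m}"
  shows "reduced_word m w is \<longleftrightarrow> set is \<subseteq> {1..<m} \<and> word_perm is = w \<and> length is = inversions m w"
proof
  assume r: "reduced_word m w is"
  obtain js where "set js \<subseteq> {1..<m}" "word_perm js = w" "length js = inversions m w"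
    using exists_word_of_inversions_length[OF assms] by blast
  then show "set is \<subseteq> {1..<m} \<and> word_perm is = w \<and> length is = inversions m w"
    using r inversions_word_perm_le[of "is" m] unfolding reduced_word_def by force
next
  assume "set is \<subseteq> {1..<m} \<and> word_perm is = w \<and> length is = inversions m w"
  then show "reduced_word m w is"
    unfolding reduced_word_def using inversions_word_perm_le[of _ m] by metis
qed

lemma exists_reduced_word: "w permutes {1..m} \<Longrightarrow> \<exists>is. reduced_word m w is"
  using exists_word_of_inversions_length reduced_word_iff by blast

lemma idc_op_delta_ascent:
  assumes "inj v" "\<not> v (Suc i) < v i"
  shows "idc_op b i (delta v) = delta (v \<circ> adj i)"
proof
  fix u
  have eq: "u \<circ> adj i = v \<longleftrightarrow> u = v \<circ> adj i" by (metis comp_adj_adj)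
  show "idc_op b i (delta v) u = delta (v \<circ> adj i) u"
    using assms(2) adj_descent_flip[OF assms(1), of i] unfolding idc_op_def delta_def eq
    by (cases "u = v"; cases "u = v \<circ> adj i") auto
qed

text \<open>
  In a word with as many letters as inversions every letter is applied at an ascent, where \<open>e\<^sub>i\<close> just
  moves the indicator function.
\<close>

lemma fold_idc_op_reduced:
  "set is \<subseteq> {1..<m} \<Longrightarrow> length is = inversions m (word_perm is) \<Longrightarrow>
    fold (idc_op b) is (delta id) = delta (word_perm is)"
proof (induction "is" rule: rev_induct)
  case Nil
  then show ?case by simp
next
  case (snoc i "is")
  let ?u = "word_perm is"
  have p: "?u permutes {1..m}" using snoc.prems by (intro word_perm_permutes) simp
  have p': "?u \<circ> adj i permutes {1..m}" using p snoc.prems by (intro permutes_adj) auto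
  have le: "inversions m ?u \<le> length is" using snoc by (intro inversions_word_perm_le) auto
  have len: "Suc (length is) = inversions m (?u \<circ> adj i)"
    using snoc.prems(2)[unfolded word_perm_append word_perm_single length_append]
    by (simp add: comp_def)
  have asc: "\<not> ?u (Suc i) < ?u i"
  proof
    assume "?u (Suc i) < ?u i"
    from inversions_adj[OF p this] len le show False by (simp add: comp_def)
  qed
  then have "(?u \<circ> adj i) (Suc i) < (?u \<circ> adj i) i"
    using adj_descent_flip[OF permutes_inj_nat[OF p]] by blast
  from inversions_adj[OF p' this] have "length is = inversions m ?u"
    using len unfolding comp_adj_adj by (simp add: comp_def)
  with snoc have "fold (idc_op b) is (delta id) = delta ?u" by (simp add: id_def)
  then have "fold (idc_op b) (is @ [i]) (delta id) = delta (?u \<circ> adj i)"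
    using idc_op_delta_ascent[OF permutes_inj_nat[OF p] asc, of b] by simp
  then show ?case unfolding word_perm_append word_perm_single .
qed

lemma e_perm_reduced_word:
  assumes "w permutes {1..m}"
  obtains "is" where "reduced_word m w is" "e_perm m w = (wmon is :: word \<Rightarrow>\<^sub>0 'r::comm_ring_1)"
  using someI_ex[OF exists_reduced_word[OF assms]] that unfolding e_perm_def by blast

lemma word_action_e_perm:
  assumes "w permutes {1..m}"
  shows "word_action b (e_perm m w) (delta id) = delta w"
proof -
  obtain "is" where "reduced_word m w is" "e_perm m w = (wmon is :: word \<Rightarrow>\<^sub>0 'a)"
    using e_perm_reduced_word[OF assms] .
  then show ?thesis using fold_idc_op_reduced[of "is" m b] reduced_word_iff[OF assms, of "is"]
    by (simp add: word_action_wmon)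
qed

text \<open>
  Linear independence of the \<open>e\<^sub>w\<close>: the action recovers the coefficients of a linear combination.
\<close>

lemma word_action_e_perm_sum:
  assumes "\<And>w. \<not> w permutes {1..m} \<Longrightarrow> a w = 0"
  shows "word_action b (\<Sum>w | w permutes {1..m}. scal (a w) * e_perm m w) (delta id) = a"
proof
  fix v
  have fin: "finite {w. w permutes {1..m}}" by (simp add: finite_permutations)
  have "word_action b (\<Sum>w | w permutes {1..m}. scal (a w) * e_perm m w) (delta id) v =
    (\<Sum>w | w permutes {1..m}. a w * delta w v)"
    unfolding word_action_sum
  proof (rule sum.cong[OF refl])
    fix w assume "w \<in> {w. w permutes {1..m}}"
    then show "word_action b (scal (a w) * e_perm m w) (delta id) v = a w * delta w v"
      by (simp add: word_action_mult word_action_scal word_action_scale_fun word_action_e_perm)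
  qed
  also have "\<dots> = (\<Sum>w | w permutes {1..m}. if w = v then a v else 0)"
    by (intro sum.cong) (auto simp: delta_def)
  also have "\<dots> = a v" using fin assms by auto
  finally show "word_action b (\<Sum>w | w permutes {1..m}. scal (a w) * e_perm m w) (delta id) v = a v" .
qed

section \<open>Normal forms, and the basis of the id-Coxeter algebra\<close>

lemma scal_mult: "scal c * scal d = scal (c * d)"
  by (simp add: scal_def mult_single)

lemma scal_one: "scal 1 = 1"
  by (simp add: scal_def)

lemma scal_add: "scal (c + d) = scal c + scal d"
  by (simp add: scal_def single_add)

lemma scal_wmon_commute: "wmon xs * scal c = scal c * wmon xs"
  by (simp add: scal_def wmon_def mult_single)

lemma wmon_append: "wmon (xs @ ys) = wmon xs * wmon ys"
  by (simp add: wmon_def mult_single plus_word_def)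

lemma single_eq_scal_wmon: "Poly_Mapping.single u c = scal c * wmon (letters u)"
  by (simp add: scal_def wmon_def mult_single)

text \<open>
  Equality in the id-Coxeter algebra up to a power of \<open>b\<close>, the only scalar that the relations can
  produce when a word is rewritten to a word.
\<close>

definition word_reduces :: "nat \<Rightarrow> 'r::comm_ring_1 \<Rightarrow> nat list \<Rightarrow> nat list \<Rightarrow> bool" where
  "word_reduces m b us vs \<longleftrightarrow> (\<exists>r. wmon us - scal (b ^ r) * wmon vs \<in> IdC_ideal m b)"

lemma word_reduces_refl: "word_reduces m b us us"
  unfolding word_reduces_def by (rule exI[of _ 0]) (simp add: scal_one IdC_ideal_closed(1))

lemma word_reduces_trans [trans]:
  assumes "word_reduces m b us vs" "word_reduces m b vs ws"
  shows "word_reduces m b us ws"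
proof -
  obtain r t where *: "wmon us - scal (b ^ r) * wmon vs \<in> IdC_ideal m b"
    "wmon vs - scal (b ^ t) * wmon ws \<in> IdC_ideal m b"
    using assms unfolding word_reduces_def by blast
  have "wmon us - scal (b ^ (r + t)) * wmon ws =
    (wmon us - scal (b ^ r) * wmon vs) + scal (b ^ r) * (wmon vs - scal (b ^ t) * wmon ws)"
    by (simp add: power_add flip: scal_mult add: algebra_simps)
  also have "\<dots> \<in> IdC_ideal m b"
    by (intro IdC_ideal_closed(2,3) * FreeAlg_scal)
  finally show ?thesis unfolding word_reduces_def by blast
qed

lemma word_reduces_context:
  assumes "word_reduces m b us vs" "set xs \<subseteq> {1..<m}" "set ys \<subseteq> {1..<m}"
  shows "word_reduces m b (xs @ us @ ys) (xs @ vs @ ys)"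
proof -
  obtain r where *: "wmon us - scal (b ^ r) * wmon vs \<in> IdC_ideal m b"
    using assms unfolding word_reduces_def by blast
  have "wmon xs * (scal (b ^ r) * wmon vs) * wmon ys = scal (b ^ r) * (wmon xs * wmon vs * wmon ys)"
    using scal_wmon_commute[of xs "b ^ r"] by (metis mult.assoc)
  then have "wmon (xs @ us @ ys) - scal (b ^ r) * wmon (xs @ vs @ ys) =
    wmon xs * (wmon us - scal (b ^ r) * wmon vs) * wmon ys"
    by (simp add: wmon_append algebra_simps)
  also have "\<dots> \<in> IdC_ideal m b"
    by (intro IdC_ideal_closed(3,4) * FreeAlg_wmon assms)
  finally show ?thesis unfolding word_reduces_def by blast
qed

lemma word_reduces_relators:
  assumes "i \<in> {1..<m}" "j \<in> {1..<m}"
  shows "\<bar>int i - int j\<bar> \<ge> 2 \<Longrightarrow> word_reduces m b [i, j] [j, i]"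
    and "\<bar>int i - int j\<bar> = 1 \<Longrightarrow> word_reduces m b [i, j, i] [j, i, j]"
    and "word_reduces m b [i, i] [i]"
proof -
  have w: "wmon [i, j] = gen i * gen j" "wmon [i, j, k] = gen i * gen j * gen k" for i j k
    by (metis append_Cons append_Nil mult.assoc wmon_append)+
  show "word_reduces m b [i, j] [j, i]" if "\<bar>int i - int j\<bar> \<ge> 2"
    unfolding word_reduces_def
    by (rule exI[of _ 0], rule relator_in_IdC_ideal)
       (use assms that in \<open>simp add: IdC_relators_def w scal_one; blast\<close>)
  show "word_reduces m b [i, j, i] [j, i, j]" if "\<bar>int i - int j\<bar> = 1"
    unfolding word_reduces_def
    by (rule exI[of _ 0], rule relator_in_IdC_ideal)
       (use assms that in \<open>simp add: IdC_relators_def w scal_one; blast\<close>)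
  show "word_reduces m b [i, i] [i]"
    unfolding word_reduces_def
    by (rule exI[of _ 1], rule relator_in_IdC_ideal)
       (use assms in \<open>simp add: IdC_relators_def w; blast\<close>)
qed

lemma word_reduces_commute_past:
  assumes "i \<in> {1..<m}" "\<And>u. u \<in> set us \<Longrightarrow> u \<in> {1..<m} \<and> \<bar>int u - int i\<bar> \<ge> 2"
  shows "word_reduces m b (us @ [i]) (i # us)"
  using assms(2)
proof (induction us)
  case Nil
  then show ?case by (simp add: word_reduces_refl)
next
  case (Cons u us)
  then have "word_reduces m b ([u] @ (us @ [i]) @ []) ([u] @ (i # us) @ [])"
    by (intro word_reduces_context) auto
  also have "word_reduces m b ([] @ [u, i] @ us) ([] @ [i, u] @ us)"
    using Cons assms(1) by (intro word_reduces_context word_reduces_relators) auto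
  then have "word_reduces m b ([u] @ (i # us) @ []) (i # u # us)" by simp
  finally show ?case by simp
qed

text \<open>
  The coset decomposition of the symmetric group on \<open>m + 1\<close> letters: a normal word for \<open>m\<close> letters
  followed by a descending run \<open>m, m - 1, \<dots>, j\<close>, which puts the value \<open>m + 1\<close> at position \<open>j\<close>. Having
  one normal word per permutation avoids comparing arbitrary reduced words by braid moves.
\<close>

fun normal_words :: "nat \<Rightarrow> nat list set" where
  "normal_words 0 = {[]}"
| "normal_words (Suc m) = {us @ rev [j..<Suc m] | us j. us \<in> normal_words m \<and> 1 \<le> j \<and> j \<le> Suc m}"

lemma normal_words_SucI:
  "us \<in> normal_words m \<Longrightarrow> 1 \<le> j \<Longrightarrow> j \<le> Suc m \<Longrightarrow> us @ rev [j..<Suc m] \<in> normal_words (Suc m)"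
  unfolding normal_words.simps by (intro CollectI exI[of _ us] exI[of _ j] conjI) simp_all

lemma normal_words_SucE:
  assumes "vs \<in> normal_words (Suc m)"
  obtains us j where "vs = us @ rev [j..<Suc m]" "us \<in> normal_words m" "1 \<le> j" "j \<le> Suc m"
  using assms unfolding normal_words.simps by (elim CollectE exE conjE)

declare normal_words.simps(2) [simp del]

lemma set_normal_words: "us \<in> normal_words m \<Longrightarrow> set us \<subseteq> {1..<m}"
proof (induction m arbitrary: us)
  case (Suc m)
  from normal_words_SucE[OF Suc.prems] obtain vs j where "us = vs @ rev [j..<Suc m]" "vs \<in> normal_words m" "1 \<le> j" .
  then show ?case using Suc.IH[of vs] by force
qed simp

text \<open>
  A letter \<open>i\<close> behind the run travels left to the pair \<open>i, i - 1\<close>; the braid relation turns it into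
  \<open>i - 1\<close>, which travels on to the front.
\<close>

lemma descending_run_absorbs:
  assumes "1 \<le> j" "j < i" "i < Suc m" "Suc m \<le> M"
  shows "word_reduces M b (rev [j..<Suc m] @ [i]) ((i - 1) # rev [j..<Suc m])"
proof -
  let ?A = "rev [Suc i..<Suc m]" and ?B = "rev [j..<i - 1]"
  have "[j..<Suc m] = [j..<i - 1] @ [i - 1..<Suc m]"
    using assms upt_add_eq_append[of j "i - 1" "Suc m - (i - 1)"] by simp
  also have "[i - 1..<Suc m] = (i - 1) # i # [Suc i..<Suc m]"
    using assms upt_conv_Cons[of "i - 1" "Suc m"] upt_conv_Cons[of i "Suc m"] by (simp del: upt_Suc)
  finally have split: "rev [j..<Suc m] = ?A @ [i, i - 1] @ ?B" by simp
  have "word_reduces M b ((?A @ [i, i - 1]) @ (?B @ [i]) @ []) ((?A @ [i, i - 1]) @ (i # ?B) @ [])"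
    using assms by (intro word_reduces_context word_reduces_commute_past) auto
  also have "word_reduces M b (?A @ [i, i - 1, i] @ ?B) (?A @ [i - 1, i, i - 1] @ ?B)"
    using assms by (intro word_reduces_context word_reduces_relators) auto
  then have "word_reduces M b ((?A @ [i, i - 1]) @ (i # ?B) @ []) ([] @ (?A @ [i - 1]) @ ([i, i - 1] @ ?B))"
    by simp
  also have "word_reduces M b \<dots> ([] @ ((i - 1) # ?A) @ ([i, i - 1] @ ?B))"
    using assms by (intro word_reduces_context word_reduces_commute_past) auto
  finally show ?thesis unfolding split by simp
qed

text \<open>
  Letters are appended one at a time to a normal word. A letter either changes the last run or passes
  through it into the word in front, which has smaller letters and is treated by induction.
\<close>

lemma word_reduces_to_normal:
  assumes "m \<le> M" "set us \<subseteq> {1..<m}"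
  shows "\<exists>vs \<in> normal_words m. word_reduces M b us vs"
  using assms
proof (induction m arbitrary: us)
  case 0
  then show ?case by (auto intro: word_reduces_refl)
next
  case (Suc m)
  have mM: "m \<le> M" "Suc m \<le> M" using Suc.prems by auto
  have run: "set (rev [j..<Suc m]) \<subseteq> {1..<M}" if "1 \<le> j" for j
    unfolding set_rev set_upt using that mM by fastforce
  from Suc.prems(2) show ?case
  proof (induction us rule: rev_induct)
    case Nil
    obtain vs where vs: "vs \<in> normal_words m" "word_reduces M b [] vs" using Suc.IH[of "[]"] mM by auto
    have "vs @ rev [Suc m..<Suc m] \<in> normal_words (Suc m)"
      by (rule normal_words_SucI[OF vs(1)]) simp_all
    moreover have "vs @ rev [Suc m..<Suc m] = vs" by simp
    ultimately show ?case using vs(2) by metis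
  next
    case (snoc i us)
    have i: "1 \<le> i" "i < Suc m" "set us \<subseteq> {1..<Suc m}" using snoc.prems by simp_all
    obtain vs where vs: "vs \<in> normal_words (Suc m)" "word_reduces M b us vs" using snoc.IH[OF i(3)] by blast
    from normal_words_SucE[OF vs(1)]
    obtain ws j where ws: "vs = ws @ rev [j..<Suc m]" "ws \<in> normal_words m" "1 \<le> j" "j \<le> Suc m" .
    have wset: "set ws \<subseteq> {1..<m}" by (rule set_normal_words[OF ws(2)])
    then have wset': "set ws \<subseteq> {1..<M}" using mM by fastforce
    have iM: "i \<in> {1..<M}" using i mM by simp
    have start: "word_reduces M b (us @ [i]) (ws @ rev [j..<Suc m] @ [i])"
      using word_reduces_context[OF vs(2), of "[]" "[i]"] iM unfolding ws(1) by simp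
    have normal: "\<exists>vs' \<in> normal_words (Suc m). word_reduces M b (us @ [i]) vs'"
      if t: "1 \<le> t" "t < m" and r: "word_reduces M b (rev [j..<Suc m] @ [i]) (t # rev [j..<Suc m])" for t
    proof -
      have "set (ws @ [t]) \<subseteq> {1..<m}" using wset t by simp
      then obtain ws' where ws': "ws' \<in> normal_words m" "word_reduces M b (ws @ [t]) ws'"
        using Suc.IH[of "ws @ [t]"] mM by blast
      note start
      also have "word_reduces M b (ws @ (rev [j..<Suc m] @ [i]) @ []) (ws @ (t # rev [j..<Suc m]) @ [])"
        by (rule word_reduces_context[OF r wset']) simp
      then have "word_reduces M b (ws @ rev [j..<Suc m] @ [i]) ([] @ (ws @ [t]) @ rev [j..<Suc m])"
        by (simp del: upt_Suc)
      also have "word_reduces M b \<dots> ([] @ ws' @ rev [j..<Suc m])"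
        by (rule word_reduces_context[OF ws'(2) _ run[OF ws(3)]]) simp
      finally have "word_reduces M b (us @ [i]) (ws' @ rev [j..<Suc m])" by (simp del: upt_Suc)
      moreover have "ws' @ rev [j..<Suc m] \<in> normal_words (Suc m)"
        by (rule normal_words_SucI[OF ws'(1) ws(3,4)])
      ultimately show ?thesis by blast
    qed
    \<comment> \<open>The new letter extends the run, repeats its last letter, commutes past the whole run, or is
      absorbed by it with index lowered by one. In the last two cases it joins the shorter word
      in front of the run.\<close>
    consider "i = j - 1" "1 < j" | "i = j" | "i < j - 1" | "j < i" using i ws by linarith
    then show ?case
    proof cases
      case 1
      then have "rev [j..<Suc m] @ [i] = rev [i..<Suc m]"
        using upt_conv_Cons[of i "Suc m"] i by (simp del: upt_Suc)
      then have "word_reduces M b (us @ [i]) (ws @ rev [i..<Suc m])" using start by (simp del: upt_Suc)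
      moreover have "ws @ rev [i..<Suc m] \<in> normal_words (Suc m)"
        by (rule normal_words_SucI[OF ws(2) i(1)]) (use i in simp)
      ultimately show ?thesis by blast
    next
      case 2
      then have r: "rev [j..<Suc m] = rev [Suc j..<Suc m] @ [j]" using i by (simp add: upt_conv_Cons[of j] del: upt_Suc)
      have "word_reduces M b ((ws @ rev [Suc j..<Suc m]) @ [j, j] @ []) ((ws @ rev [Suc j..<Suc m]) @ [j] @ [])"
        by (intro word_reduces_context word_reduces_relators) (use iM 2 wset' run[of "Suc j"] in auto)
      then have "word_reduces M b (ws @ rev [j..<Suc m] @ [i]) vs" unfolding ws(1) r 2 by (simp del: upt_Suc)
      then show ?thesis using start word_reduces_trans vs by blast
    next
      case 3
      show ?thesis
        by (intro normal[of i] word_reduces_commute_past) (use 3 i ws mM in auto)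
    next
      case 4
      show ?thesis
        by (intro normal[of "i - 1"] descending_run_absorbs) (use 4 i ws mM in auto)
    qed
  qed
qed

lemma word_perm_rev_upt:
  assumes "j \<le> k"
  shows "word_perm (rev [j..<k]) j = k"
  using assms
proof (induction k rule: dec_induct)
  case (step k)
  have "word_perm (rev [j..<Suc k]) = adj k \<circ> word_perm (rev [j..<k])"
    using step(1) word_perm_append[of "[k]" "rev [j..<k]"] by simp
  then show ?case using step.IH by simp
qed simp

lemma word_perm_fixes: "set us \<subseteq> {1..<m} \<Longrightarrow> m < t \<Longrightarrow> word_perm us t = t"
  using word_perm_permutes[of us m] by (simp add: permutes_def)

text \<open>
  The position of the largest value determines the last run, and the run can be cancelled.
\<close>

lemma word_perm_inj_on_normal: "inj_on word_perm (normal_words m)"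
proof (induction m)
  case (Suc m)
  show ?case
  proof (rule inj_onI)
    fix us vs assume un: "us \<in> normal_words (Suc m)" and vn: "vs \<in> normal_words (Suc m)"
      and eq: "word_perm us = word_perm vs"
    from normal_words_SucE[OF un]
    obtain us' i where us: "us = us' @ rev [i..<Suc m]" "us' \<in> normal_words m" "1 \<le> i" "i \<le> Suc m" .
    from normal_words_SucE[OF vn]
    obtain vs' j where vs: "vs = vs' @ rev [j..<Suc m]" "vs' \<in> normal_words m" "1 \<le> j" "j \<le> Suc m" .
    have eq': "word_perm us' \<circ> word_perm (rev [i..<Suc m]) = word_perm vs' \<circ> word_perm (rev [j..<Suc m])"
      using eq unfolding us vs word_perm_append .
    have fx: "word_perm us' (Suc m) = Suc m" "word_perm vs' (Suc m) = Suc m"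
      using word_perm_fixes[OF set_normal_words[OF us(2)]] word_perm_fixes[OF set_normal_words[OF vs(2)]]
      by simp_all
    have "word_perm us i = Suc m" "word_perm vs j = Suc m"
      unfolding us(1) vs(1) word_perm_append
      using word_perm_rev_upt us(4) vs(4) fx by (simp_all del: upt_Suc)
    then have "word_perm vs i = word_perm vs j" using eq by simp
    moreover have "inj (word_perm vs)"
    proof (rule permutes_inj_nat[OF word_perm_permutes])
      show "set vs \<subseteq> {1..<Suc m}" using vs set_normal_words[OF vs(2)] by force
    qed
    ultimately have "i = j" by (simp add: inj_eq)
    have "surj (word_perm (rev [j..<Suc m]))"
      by (rule permutes_surj[OF word_perm_permutes[of _ "Suc m"]]) (use vs in auto)
    then have "word_perm us' = word_perm vs'"
      using eq' unfolding \<open>i = j\<close> by (metis fun.map_comp surj_fun_eq surj_iff comp_id comp_assoc)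
    then show "us = vs" using Suc us vs \<open>i = j\<close> by (auto dest: inj_onD)
  qed
qed simp

text \<open>
  Extending a run by one letter moves the largest value one place to the left, past a smaller one.
\<close>

lemma length_normal_word:
  "us \<in> normal_words m \<Longrightarrow> m \<le> M \<Longrightarrow> length us = inversions M (word_perm us)"
proof (induction m arbitrary: us)
  case 0
  then have "us = []" by simp
  then show ?case by (simp add: inversions_id[unfolded id_def] id_def)
next
  case (Suc m)
  from normal_words_SucE[OF Suc.prems(1)]
  obtain vs j where us: "us = vs @ rev [j..<Suc m]" "vs \<in> normal_words m" "1 \<le> j" "j \<le> Suc m" .
  have vset: "set vs \<subseteq> {1..<m}" by (rule set_normal_words[OF us(2)])
  have "j \<le> Suc m \<Longrightarrow> 1 \<le> j \<Longrightarrow>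
      inversions M (word_perm (vs @ rev [j..<Suc m])) = length vs + (Suc m - j)" for j
  proof (induction j rule: inc_induct)
    case base
    then show ?case using Suc.IH[OF us(2)] Suc.prems by simp
  next
    case (step j)
    let ?w = "word_perm (vs @ rev [j..<Suc m])"
    have r: "rev [j..<Suc m] = rev [Suc j..<Suc m] @ [j]" using step by (simp add: upt_conv_Cons[of j] del: upt_Suc)
    have "set (vs @ rev [j..<Suc m]) \<subseteq> {1..<Suc m}" using vset step.prems by force
    then have p: "?w permutes {1..Suc m}" by (rule word_perm_permutes)
    then have p': "?w permutes {1..M}" by (rule permutes_subset) (use Suc.prems in auto)
    have wj: "?w j = Suc m"
      unfolding word_perm_append using word_perm_rev_upt[of j "Suc m"] step
        word_perm_fixes[OF vset, of "Suc m"] by (simp del: upt_Suc)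
    have "?w (Suc j) \<le> Suc m" using permutes_in_image[OF p, of "Suc j"] step by auto
    moreover have "?w (Suc j) \<noteq> ?w j" using permutes_inj_nat[OF p] by (simp add: inj_eq)
    ultimately have "?w (Suc j) < ?w j" using wj by simp
    from inversions_adj[OF p' this] have "inversions M ?w = Suc (inversions M (?w \<circ> adj j))" .
    also have "?w \<circ> adj j = word_perm (vs @ rev [Suc j..<Suc m])"
      unfolding r append_assoc[symmetric] word_perm_append[of _ "[j]"] word_perm_single comp_adj_adj ..
    finally show ?case using step by (simp del: upt_Suc)
  qed
  from this[of j] us show ?case by (simp del: upt_Suc)
qed

text \<open>
  The reduced word behind \<open>e_perm\<close> is an arbitrary choice. It reduces to some normal word, and the
  action shows that this is the normal word of the same permutation and that no factor \<open>b\<close> occurs.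
\<close>

lemma normal_word_is_e_perm:
  fixes b :: "'r::comm_ring_1"
  assumes us: "us \<in> normal_words m"
  shows "wmon us - e_perm m (word_perm us) \<in> IdC_ideal m b"
proof -
  let ?v = "word_perm us"
  have p: "?v permutes {1..m}" by (rule word_perm_permutes[OF set_normal_words[OF us]])
  obtain "is" where r: "reduced_word m ?v is" and e: "e_perm m ?v = (wmon is :: word \<Rightarrow>\<^sub>0 'r)"
    using e_perm_reduced_word[OF p] .
  have "set is \<subseteq> {1..<m}" using r by (simp add: reduced_word_def)
  then obtain vs where vs: "vs \<in> normal_words m" "word_reduces m b is vs"
    using word_reduces_to_normal[of m m "is" b] by auto
  then obtain t where t: "wmon is - scal (b ^ t) * wmon vs \<in> IdC_ideal m b"
    unfolding word_reduces_def by blast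
  \<comment> \<open>Both words act on the indicator of the identity, which identifies the permutation of \<open>vs\<close>
    and forces the scalar to be 1.\<close>
  have "word_action b (wmon is - scal (b ^ t) * wmon vs) (delta id) = (\<lambda>w. 0)" by (rule word_action_IdC_ideal[OF t])
  then have *: "word_action b (wmon is) (delta id) w = b ^ t * fold (idc_op b) vs (delta id) w" for w
    by (simp add: fun_eq_iff word_action_diff word_action_mult word_action_scal word_action_wmon word_action_scale_fun fold_idc_op_scale)
  have "fold (idc_op b) vs (delta id) = delta (word_perm vs)"
    by (rule fold_idc_op_reduced[OF set_normal_words[OF vs(1)] length_normal_word[OF vs(1)]]) simp
  with * have d: "delta ?v w = b ^ t * delta (word_perm vs) w" for w
    using word_action_e_perm[OF p, of b] unfolding e by simp
  show ?thesis
  proof (cases "word_perm vs = ?v")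
    case True
    then have "b ^ t = 1" using d[of ?v] by (simp add: delta_def)
    moreover have "vs = us" using True vs(1) us word_perm_inj_on_normal by (auto dest: inj_onD)
    ultimately show ?thesis using IdC_ideal_closed(5)[OF t] unfolding e by (simp add: scal_one)
  next
    case False
    then show ?thesis using d[of ?v] by (auto simp: delta_def)
  qed
qed

lemma free_word_spanned:
  fixes b :: "'r::comm_ring_1"
  assumes "set us \<subseteq> {1..<m}"
  shows "\<exists>v c. v permutes {1..m} \<and> wmon us - scal c * e_perm m v \<in> IdC_ideal m b"
proof -
  obtain vs where vs: "vs \<in> normal_words m" "word_reduces m b us vs"
    using word_reduces_to_normal[of m m us b] assms by auto
  then obtain t where t: "wmon us - scal (b ^ t) * wmon vs \<in> IdC_ideal m b"
    unfolding word_reduces_def by blast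
  have "(wmon us - scal (b ^ t) * wmon vs) + scal (b ^ t) * (wmon vs - e_perm m (word_perm vs)) \<in> IdC_ideal m b"
    by (intro IdC_ideal_closed(2,3) t FreeAlg_scal normal_word_is_e_perm vs)
  then show ?thesis using word_perm_permutes[OF set_normal_words[OF vs(1)]]
    by (intro exI[of _ "word_perm vs"] exI[of _ "b ^ t"]) (simp add: algebra_simps)
qed

text \<open>
  Together with the linear independence, the \<open>e\<^sub>w\<close> are a basis of the id-Coxeter algebra.
\<close>

theorem IdC_spanned:
  fixes f :: "word \<Rightarrow>\<^sub>0 'r::comm_ring_1"
  assumes "f \<in> carrier (FreeAlg m)"
  shows "\<exists>a. (\<forall>w. \<not> w permutes {1..m} \<longrightarrow> a w = 0) \<and>
    f - (\<Sum>w | w permutes {1..m}. scal (a w) * e_perm m w) \<in> IdC_ideal m b"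
proof -
  let ?S = "\<lambda>a :: (nat \<Rightarrow> nat) \<Rightarrow> 'r. (\<Sum>w | w permutes {1..m}. scal (a w) * e_perm m w)"
  let ?P = "\<lambda>f. \<exists>a. (\<forall>w. \<not> w permutes {1..m} \<longrightarrow> a w = 0) \<and> f - ?S a \<in> IdC_ideal m b"
  have fin: "finite {w. w permutes {1..m}}" by (simp add: finite_permutations)
  have single: "?P (Poly_Mapping.single u c)" if u: "set (letters u) \<subseteq> {1..<m}" for u c
  proof -
    obtain v d where v: "v permutes {1..m}" "wmon (letters u) - scal d * e_perm m v \<in> IdC_ideal m b"
      using free_word_spanned[OF u] by blast
    have "?S (\<lambda>w. if w = v then c * d else 0) = (\<Sum>w | w permutes {1..m}. if w = v then scal (c * d) * e_perm m v else 0)"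
      by (intro sum.cong) (auto simp: scal_def)
    also have "\<dots> = scal c * (scal d * e_perm m v)"
      using v(1) fin by (simp flip: scal_mult add: mult.assoc)
    finally have "Poly_Mapping.single u c - ?S (\<lambda>w. if w = v then c * d else 0) =
        scal c * (wmon (letters u) - scal d * e_perm m v)"
      by (simp add: single_eq_scal_wmon right_diff_distrib)
    then show ?thesis using IdC_ideal_closed(3)[OF v(2) FreeAlg_scal, of c] v(1)
      by (intro exI[of _ "\<lambda>w. if w = v then c * d else 0"]) auto
  qed
  have add: "?P (f + g)" if "?P f" "?P g" for f g
  proof -
    from that obtain a a' where a: "\<forall>w. \<not> w permutes {1..m} \<longrightarrow> a w = 0" "f - ?S a \<in> IdC_ideal m b"
      and a': "\<forall>w. \<not> w permutes {1..m} \<longrightarrow> a' w = 0" "g - ?S a' \<in> IdC_ideal m b" by blast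
    have eq: "f + g - ?S (\<lambda>w. a w + a' w) = (f - ?S a) + (g - ?S a')"
      by (simp add: scal_add distrib_right sum.distrib)
    have "f + g - ?S (\<lambda>w. a w + a' w) \<in> IdC_ideal m b"
      unfolding eq by (rule IdC_ideal_closed(2)[OF a(2) a'(2)])
    moreover have "\<forall>w. \<not> w permutes {1..m} \<longrightarrow> a w + a' w = 0" using a(1) a'(1) by simp
    ultimately show ?thesis by (intro exI[of _ "\<lambda>w. a w + a' w"] conjI)
  qed
  have zero: "?P 0"
    by (intro exI[of _ "\<lambda>w. 0"]) (simp add: scal_def IdC_ideal_closed(1))
  have *: "?P (\<Sum>u\<in>A. Poly_Mapping.single u (Poly_Mapping.lookup f u))" if "A \<subseteq> Poly_Mapping.keys f" for A
    using finite_subset[OF that finite_keys] that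
  proof (induction A rule: finite_induct)
    case empty
    then show ?case using zero by simp
  next
    case (insert u A)
    then have "?P (Poly_Mapping.single u (Poly_Mapping.lookup f u))"
      using assms by (intro single) (auto simp: in_FreeAlg_iff)
    then show ?case using add insert by simp
  qed
  have "(\<Sum>u\<in>Poly_Mapping.keys f. Poly_Mapping.single u (Poly_Mapping.lookup f u)) = f"
  proof (rule poly_mapping_eqI)
    fix k
    show "Poly_Mapping.lookup (\<Sum>u\<in>Poly_Mapping.keys f. Poly_Mapping.single u (Poly_Mapping.lookup f u)) k =
        Poly_Mapping.lookup f k"
      unfolding lookup_sum lookup_single when_def sum.delta[OF finite_keys] by (simp add: in_keys_iff)
  qed
  with *[OF order_refl] show ?thesis by simp
qed

text \<open>
  The description by the defining expansion picks out a unique function: existence because the \<open>e\<^sub>w\<close>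
  span, uniqueness because they are independent.
\<close>

theorem Grothendieck_eq_groth:
  "Grothendieck m = (\<lambda>w. if w permutes {1..m} then groth m Beta Xvar w else 0)"
proof -
  let ?f = "prod_list (map (\<lambda>i. A_elem m i (Xvar i)) [1..<m])"
  have fc: "?f \<in> carrier (FreeAlg m)"
    by (intro FreeAlg_prod_list) (auto intro!: FreeAlg_A_elem)
  obtain a :: "(nat \<Rightarrow> nat) \<Rightarrow> xpoly" where a: "\<forall>w. \<not> w permutes {1..m} \<longrightarrow> a w = 0"
    "?f - (\<Sum>w | w permutes {1..m}. scal (a w) * e_perm m w) \<in> IdC_ideal m Beta"
    using IdC_spanned[OF fc, of Beta] by blast
  \<comment> \<open>Acting on the indicator of the identity reads off all coefficients at once.\<close>
  have uniq: "g = groth m Beta Xvar" if g: "\<forall>w. \<not> w permutes {1..m} \<longrightarrow> g w = 0"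
    "?f - (\<Sum>w | w permutes {1..m}. scal (g w) * e_perm m w) \<in> IdC_ideal m Beta" for g
  proof -
    have "word_action Beta (?f - (\<Sum>w | w permutes {1..m}. scal (g w) * e_perm m w)) (delta id) = (\<lambda>w. 0)"
      by (rule word_action_IdC_ideal[OF g(2)])
    then have "word_action Beta ?f (delta id) w = g w" for w
      using word_action_e_perm_sum[of m g Beta] g(1) by (auto simp: fun_eq_iff word_action_diff)
    then show ?thesis unfolding word_action_A_product by (simp add: fun_eq_iff)
  qed
  have "Grothendieck m = a"
    unfolding Grothendieck_def IdC_class_eq_iff
    by (rule the_equality) (use a uniq in \<open>blast+\<close>)
  then show ?thesis using uniq[OF a] a(1) by (auto simp: fun_eq_iff)
qed

section \<open>Change of the coefficient ring\<close>

lemma fold_comp_hom: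
  assumes "\<And>i s. i \<in> set xs \<Longrightarrow> h (f i s) = g i (h s)"
  shows "h (fold f xs s) = fold g xs (h s)"
  using assms by (induction xs arbitrary: s) auto

context comm_ring_hom
begin

lemma hom_idc_op: "(\<lambda>w. hom (idc_op b i \<phi> w)) = idc_op (hom b) i (\<lambda>w. hom (\<phi> w))"
  by (auto simp: idc_op_def fun_eq_iff hom_add hom_mult)

lemma hom_h_op: "(\<lambda>w. hom (h_op b i x \<phi> w)) = h_op (hom b) i (hom x) (\<lambda>w. hom (\<phi> w))"
  unfolding h_op_def hom_idc_op[symmetric] by (simp add: hom_add hom_mult)

lemma hom_A_op: "(\<lambda>w. hom (A_op m b i x \<phi> w)) = A_op m (hom b) i (hom x) (\<lambda>w. hom (\<phi> w))"
  unfolding A_op_def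
  by (rule fold_comp_hom[where h = "\<lambda>\<phi> w. hom (\<phi> w)"]) (rule hom_h_op)

lemma hom_groth: "hom (groth m b x w) = groth m (hom b) (\<lambda>i. hom (x i)) w"
proof -
  have d: "(\<lambda>w. hom (delta id w)) = delta id" by (auto simp: delta_def fun_eq_iff)
  have "(\<lambda>w. hom (groth m b x w)) = groth m (hom b) (\<lambda>i. hom (x i))"
    unfolding groth_def d[symmetric]
    by (rule fold_comp_hom[where h = "\<lambda>\<phi> w. hom (\<phi> w)"]) (rule hom_A_op)
  then show ?thesis by (rule fun_cong)
qed

end

text \<open>
  Replacing \<open>\<beta>\<close> by \<open>\<beta> - 1\<close> and all variables by 1 is a ring homomorphism, so it can be carried out
  before the operators are applied.
\<close>

definition specialize :: "xpoly \<Rightarrow> int poly" where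
  "specialize P = eval_x (\<lambda>_. 1) (shift_beta P)"

lemma specialize_altdef: "specialize P = (\<Sum>u \<in> Poly_Mapping.keys P. pcompose (Poly_Mapping.lookup P u) [:-1, 1:])"
proof -
  have l: "Poly_Mapping.lookup (shift_beta P) u = pcompose (Poly_Mapping.lookup P u) [:-1, 1:]" for u
    unfolding shift_beta_def by (simp add: map.rep_eq when_def)
  have "specialize P = (\<Sum>u \<in> Poly_Mapping.keys (shift_beta P). Poly_Mapping.lookup (shift_beta P) u)"
    unfolding specialize_def eval_x_def by simp
  also have "\<dots> = (\<Sum>u \<in> Poly_Mapping.keys P. Poly_Mapping.lookup (shift_beta P) u)"
    by (rule sum.mono_neutral_left) (auto simp: in_keys_iff l)
  finally show ?thesis unfolding l .
qed

lemma specialize_add: "specialize (P + Q) = specialize P + specialize Q"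
  unfolding specialize_altdef
  by (rule setsum_keys_plus_distrib[where f = "\<lambda>u c. pcompose c [:-1, 1:]"]) (auto simp: pcompose_add)

lemma specialize_single: "specialize (Poly_Mapping.single u c) = pcompose c [:-1, 1:]"
  by (simp add: specialize_altdef)

lemma specialize_zero: "specialize 0 = 0"
  by (simp add: specialize_altdef)

lemma specialize_mult: "specialize (P * Q) = specialize P * specialize Q"
proof (induction P rule: poly_mapping_add_induct)
  case zero
  then show ?case by (simp add: specialize_zero)
next
  case (single k c)
  show ?case
    by (induction Q rule: poly_mapping_add_induct)
      (simp_all add: specialize_zero mult_single specialize_single pcompose_mult distrib_left specialize_add)
next
  case (add f g)
  then show ?case by (simp add: distrib_right specialize_add)
qed

lemma specialize_one: "specialize 1 = 1"
  using specialize_single[of 0 1] by (simp add: pcompose_1)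

interpretation specialize: comm_ring_hom specialize
  by unfold_locales (simp_all add: specialize_zero specialize_one specialize_add specialize_mult)

lemma G_poly_eq_groth:
  assumes "varpi n k p permutes {1..m}"
  shows "G_poly m n k p = groth m [:-1, 1:] (\<lambda>_. 1) (varpi n k p)"
proof -
  have "G_poly m n k p = specialize (groth m Beta Xvar (varpi n k p))"
    unfolding G_poly_def Grothendieck_eq_groth specialize_def using assms by simp
  also have "\<dots> = groth m (specialize Beta) (\<lambda>i. specialize (Xvar i)) (varpi n k p)" by (rule specialize.hom_groth)
  finally show ?thesis by (simp add: Beta_def Xvar_def specialize_single pcompose_pCons pcompose_1)
qed

section \<open>Divided differences\<close>

lemma h_op_eq: "h_op b i x \<phi> = (\<lambda>w. \<phi> w + x * idc_op b i \<phi> w)"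
  by (simp add: h_op_def fun_eq_iff)

lemma h_op_far_commute:
  assumes "\<bar>int i - int j\<bar> \<ge> 2"
  shows "h_op b i x (h_op b j y \<phi>) = h_op b j y (h_op b i x \<phi>)"
  using idc_op_commute[OF assms, of b \<phi>]
  by (simp add: h_op_eq idc_op_add idc_op_scale fun_eq_iff) (simp add: algebra_simps)

lemma h_op_same_commute: "h_op b i x (h_op b i y \<phi>) = h_op b i y (h_op b i x \<phi>)"
  by (simp add: h_op_eq idc_op_add idc_op_scale fun_eq_iff) (simp add: algebra_simps)

lemma A_op_step: "i < m \<Longrightarrow> A_op m b i x \<phi> = h_op b i x (A_op m b (Suc i) x \<phi>)"
  unfolding A_op_def by (simp add: upt_conv_Cons)

lemma A_op_triv: "m \<le> i \<Longrightarrow> A_op m b i x \<phi> = \<phi>"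
  unfolding A_op_def by simp

lemma fold_commute_past:
  assumes "\<And>j \<phi>. j \<in> set xs \<Longrightarrow> h (f j \<phi>) = f j (h \<phi>)"
  shows "h (fold f xs \<phi>) = fold f xs (h \<phi>)"
  using assms by (induction xs arbitrary: \<phi>) auto

lemma h_op_A_op_commute:
  "i + 2 \<le> j \<Longrightarrow> h_op b i x (A_op m b j y \<phi>) = A_op m b j y (h_op b i x \<phi>)"
  unfolding A_op_def by (rule fold_commute_past) (auto intro!: h_op_far_commute)

text \<open>
  The identity
  \<open>(1 + x e\<^sub>i)(1 + y e\<^sub>j)(1 + y e\<^sub>i) = (1 + y e\<^sub>j)(1 + (x + y) e\<^sub>i + x y (e\<^sub>i e\<^sub>j + b e\<^sub>i - e\<^sub>j e\<^sub>i))\<close>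
  for \<open>j = i + 1\<close>. The second factor on the right is symmetric in \<open>x\<close> and \<open>y\<close>, and the first one is the
  factor that an inductive symmetry statement provides. In contrast to the usual Yang-Baxter equation
  it has no denominators \<open>1 + b y\<close>.
\<close>

lemma yang_baxter_h_op:
  fixes b :: "'r::comm_ring_1"
  assumes j: "j = Suc i"
  shows "h_op b i y (h_op b j y (h_op b i x \<psi>)) =
    (let \<zeta> = h_op b j y \<psi> in (\<lambda>w. \<zeta> w + (x + y) * idc_op b i \<zeta> w + x * y *
       (idc_op b j (idc_op b i \<zeta>) w + b * idc_op b i \<zeta> w - idc_op b i (idc_op b j \<zeta>) w)))"
  unfolding Let_def h_op_eq idc_op_add idc_op_scale idc_op_square j idc_op_braid_Suc fun_eq_iff
  by (simp add: algebra_simps)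

text \<open>
  By downward induction on \<open>i\<close>: pulling the letter \<open>i\<close> out of \<open>A\<^sub>i(x)\<close> leaves the symmetric product for
  \<open>i + 1\<close>, times the symmetric factor of the preceding identity.
\<close>

lemma A_op_exchange:
  assumes "i < m"
  shows "h_op b i y (A_op m b (Suc i) y (A_op m b i x \<phi>)) = h_op b i x (A_op m b (Suc i) x (A_op m b i y \<phi>))"
proof -
  have "i \<le> m - 1" using assms by simp
  then show ?thesis
  proof (induction i rule: inc_induct)
    case base
    then show ?case using assms by (simp add: A_op_step A_op_triv h_op_same_commute)
  next
    case (step i)
    \<comment> \<open>The letter \<open>i\<close> of \<open>A\<^sub>i(x)\<close> commutes with all of \<open>A\<^sub>i\<^sub>+\<^sub>1(y)\<close> except the letter \<open>i + 1\<close>.\<close>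
    have 1: "h_op b i y (A_op m b (Suc i) y (A_op m b i x \<phi>)) =
        h_op b i y (h_op b (Suc i) y (h_op b i x (A_op m b (Suc (Suc i)) y (A_op m b (Suc i) x \<phi>))))" for x y
      using step by (simp add: A_op_step h_op_A_op_commute)
    show ?case
      unfolding 1 yang_baxter_h_op[OF refl] step.IH Let_def by (simp add: algebra_simps)
  qed
qed

text \<open>
  The trivial factor \<open>A\<^sub>m = 1\<close> lets the variable \<open>x\<^sub>m\<close> take part in exchanges.
\<close>

lemma groth_extend: "groth m b x = fold (\<lambda>i. A_op m b i (x i)) [1..<Suc m] (delta id)"
  unfolding groth_def by (cases "1 \<le> m") (simp_all add: A_op_triv)

lemma groth_exchange:
  assumes "1 \<le> i" "i < m"
  shows "h_op b i (x (Suc i)) (groth m b x) = h_op b i (x i) (groth m b (x \<circ> adj i))"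
proof -
  let ?f = "\<lambda>x i. A_op m b i (x i)"
  have split: "[1..<Suc m] = [1..<i] @ [i, Suc i] @ [Suc (Suc i)..<Suc m]"
    using assms upt_add_eq_append[of 1 i "Suc m - i"] upt_conv_Cons[of i "Suc m"] upt_conv_Cons[of "Suc i" "Suc m"]
    by (simp del: upt_Suc)
  have g: "h_op b i z (groth m b x) = fold (?f x) [Suc (Suc i)..<Suc m]
      (h_op b i z (A_op m b (Suc i) (x (Suc i)) (A_op m b i (x i) (fold (?f x) [1..<i] (delta id)))))" for x z
    unfolding groth_extend split fold_append comp_def
    by (subst fold_commute_past[where h = "h_op b i z"])
       (auto simp: h_op_A_op_commute simp del: upt_Suc)
  have l: "fold (?f (x \<circ> adj i)) [1..<i] = fold (?f x) [1..<i]" by (rule ext, rule fold_cong) auto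
  have r: "fold (?f (x \<circ> adj i)) [Suc (Suc i)..<Suc m] = fold (?f x) [Suc (Suc i)..<Suc m]"
    by (rule ext, rule fold_cong) (auto simp del: upt_Suc)
  show ?thesis unfolding g l r by (simp add: A_op_exchange[OF assms(2), of b "x (Suc i)"] del: upt_Suc)
qed

text \<open>
  Compare the coefficients of \<open>e\<^sub>w\<close> and of \<open>e\<^sub>w\<^sub>s\<close> on both sides of the exchange symmetry: multiplication
  by \<open>h\<^sub>i\<close> leaves the latter unchanged, so that coefficient is symmetric, and the former gives the
  recursion.
\<close>

theorem groth_divided_difference:
  fixes b :: "'r::comm_ring_1"
  assumes w: "w permutes {1..m}" and d: "w (Suc i) < w i"
  shows "(x i - x (Suc i)) * groth m b x (w \<circ> adj i) =
    (1 + b * x (Suc i)) * groth m b x w - (1 + b * x i) * groth m b (x \<circ> adj i) w"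
proof -
  let ?u = "w \<circ> adj i" and ?x = "x \<circ> adj i"
  note r = descent_range[OF w d]
  note ex = groth_exchange[OF r, of b x]
  have nd: "\<not> ?u (Suc i) < ?u i" using adj_descent_flip[OF permutes_inj_nat[OF w]] d by blast
  have u: "groth m b x ?u = groth m b ?x ?u"
    using fun_cong[OF ex, of ?u] nd by (simp add: h_op_def idc_op_def)
  have "groth m b x w + x (Suc i) * (b * groth m b x w + groth m b x ?u) =
      groth m b ?x w + x i * (b * groth m b ?x w + groth m b ?x ?u)"
    using fun_cong[OF ex, of w] d unfolding h_op_def idc_op_def by simp
  then show ?thesis unfolding u[symmetric] by (simp add: algebra_simps)
qed

section \<open>Permutations with a given code\<close>

text \<open>
  Only the entries of \<open>a\<close> at positive positions matter; position 0 is fixed by all permutations.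
\<close>

definition has_code :: "nat \<Rightarrow> (nat \<Rightarrow> nat) \<Rightarrow> (nat \<Rightarrow> nat) \<Rightarrow> bool" where
  "has_code m a w \<longleftrightarrow> w permutes {1..m} \<and> (\<forall>i\<ge>1. lehmer_code w i = a i)"

lemma has_codeD:
  assumes "has_code m a w"
  shows "w permutes {1..m}" "1 \<le> i \<Longrightarrow> lehmer_code w i = a i" "1 \<le> i \<Longrightarrow> a i \<le> m - i"
    "1 \<le> i \<Longrightarrow> w (Suc i) < w i \<longleftrightarrow> a (Suc i) < a i"
  using assms lehmer_code_le[of w m i] lehmer_code_less_iff_descent[OF permutes_inj_nat[of w m], of i]
  by (auto simp: has_code_def)

lemma has_code_cong: "has_code m a w \<Longrightarrow> (\<And>i. 1 \<le> i \<Longrightarrow> a i = a' i) \<Longrightarrow> has_code m a' w"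
  by (auto simp: has_code_def)

lemma has_code_raise:
  assumes c: "has_code m a w" and i: "1 \<le> i" "i < m" and le: "a i \<le> a (Suc i)"
  shows "has_code m (a(i := Suc (a (Suc i)), Suc i := a i)) (w \<circ> adj i)"
    and "(w \<circ> adj i) (Suc i) < (w \<circ> adj i) i"
proof -
  let ?u = "w \<circ> adj i"
  note p = has_codeD(1)[OF c]
  have u: "?u permutes {1..m}" by (rule permutes_adj[OF p i])
  show d: "?u (Suc i) < ?u i"
    using adj_descent_flip[OF permutes_inj_nat[OF p]] has_codeD(4)[OF c i(1)] le by (metis not_less)
  note l = lehmer_code_adj[OF permutes_inj_nat[OF u] d, unfolded comp_adj_adj]
  have ai: "lehmer_code w i = a i" "lehmer_code w (Suc i) = a (Suc i)" using has_codeD(2)[OF c] i by auto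
  have "lehmer_code ?u t = (a(i := Suc (a (Suc i)), Suc i := a i)) t" if "1 \<le> t" for t
    using l(1) l(2) l(3)[of t] ai has_codeD(2)[OF c that] by (cases "t = i"; cases "t = Suc i") (auto simp: comp_def)
  then show "has_code m (a(i := Suc (a (Suc i)), Suc i := a i)) ?u" using u by (simp add: has_code_def)
qed

lemma has_code_lower:
  assumes c: "has_code m a w" and i: "1 \<le> i" and gt: "a (Suc i) < a i"
  shows "has_code m (a(i := a (Suc i), Suc i := a i - 1)) (w \<circ> adj i)"
    and "w (Suc i) < w i"
proof -
  let ?u = "w \<circ> adj i"
  note p = has_codeD(1)[OF c]
  show d: "w (Suc i) < w i" using has_codeD(4)[OF c i] gt by simp
  have u: "?u permutes {1..m}" by (rule permutes_adj[OF p descent_range[OF p d]])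
  note l = lehmer_code_adj[OF permutes_inj_nat[OF p] d]
  have ai: "lehmer_code w i = a i" "lehmer_code w (Suc i) = a (Suc i)" using has_codeD(2)[OF c] i by auto
  have "lehmer_code ?u t = (a(i := a (Suc i), Suc i := a i - 1)) t" if "1 \<le> t" for t
    using l(1) l(2) l(3)[of t] ai has_codeD(2)[OF c that] by (cases "t = i"; cases "t = Suc i") (auto simp: comp_def)
  then show "has_code m (a(i := a (Suc i), Suc i := a i - 1)) ?u" using u by (simp add: has_code_def)
qed

lemma last_descent:
  fixes a :: "nat \<Rightarrow> nat"
  assumes "1 \<le> j" "a j \<noteq> 0" "\<And>i. N < i \<Longrightarrow> a i = 0"
  shows "\<exists>i\<ge>1. i \<le> N \<and> a (Suc i) < a i"
proof (rule ccontr)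
  assume n: "\<not> ?thesis"
  have jN: "j \<le> N" using assms by (meson not_le)
  have "a j \<le> a (j + t)" for t
  proof (induction t)
    case (Suc t)
    have "a (j + t) \<le> a (Suc (j + t))"
    proof (cases "j + t \<le> N")
      case True
      then show ?thesis using n assms(1) by (meson not_le trans_le_add1)
    next
      case False
      then show ?thesis using assms(3)[of "j + t"] by simp
    qed
    then show ?case using Suc by simp
  qed simp
  from this[of "Suc N"] show False using assms(2) assms(3)[of "j + Suc N"] by simp
qed

text \<open>
  Undo a descent of the code, which lowers its sum, and redo it on permutations.
\<close>

lemma has_code_exists:
  "(\<And>i. N < i \<Longrightarrow> a i = 0) \<Longrightarrow> \<exists>m w. has_code m a w"
proof (induction "\<Sum>i=1..N. a i" arbitrary: N a rule: less_induct)
  case less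
  show ?case
  proof (cases "\<exists>j\<ge>1. a j \<noteq> 0")
    case False
    then have "has_code 0 a id" by (simp add: has_code_def lehmer_code_id permutes_id)
    then show ?thesis by blast
  next
    case True
    then obtain i where i: "1 \<le> i" "i \<le> N" "a (Suc i) < a i" using last_descent[of _ a N] less.prems by metis
    let ?a = "a(i := a (Suc i), Suc i := a i - 1)"
    have S: "{1..Suc N} = insert i (insert (Suc i) ({1..Suc N} - {i, Suc i}))" using i by auto
    have s: "(\<Sum>t=1..Suc N. c t) = c i + (c (Suc i) + (\<Sum>t\<in>{1..Suc N} - {i, Suc i}. c t))" for c :: "nat \<Rightarrow> nat"
      by (subst S) simp
    have "(\<Sum>t=1..Suc N. a t) = (\<Sum>t=1..N. a t)" using less.prems[of "Suc N"] by simp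
    moreover have "(\<Sum>t\<in>{1..Suc N} - {i, Suc i}. ?a t) = (\<Sum>t\<in>{1..Suc N} - {i, Suc i}. a t)"
      by (intro sum.cong) auto
    ultimately have "(\<Sum>t=1..Suc N. ?a t) < (\<Sum>t=1..N. a t)" using s[of ?a] s[of a] i by simp
    moreover have "?a t = 0" if "Suc N < t" for t using that i less.prems by auto
    ultimately obtain m w where c: "has_code m ?a w" using less.hyps[of ?a "Suc N"] by metis
    then have "has_code (max m (Suc i)) ?a w"
      unfolding has_code_def using permutes_subset[of w "{1..m}" "{1..max m (Suc i)}"] by auto
    from has_code_raise(1)[OF this i(1)] i(3)
    have "has_code (max m (Suc i)) (?a(i := Suc (?a (Suc i)), Suc i := ?a i)) (w \<circ> adj i)" by simp
    then have "has_code (max m (Suc i)) a (w \<circ> adj i)"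
      by (rule has_code_cong) (use i in auto)
    then show ?thesis by blast
  qed
qed

text \<open>
  Permutations with equal codes have the same descents; undo one of them on both sides.
\<close>

lemma has_code_unique: "has_code m a w \<Longrightarrow> has_code m a w' \<Longrightarrow> w = w'"
proof (induction "inversions m w" arbitrary: a w w' rule: less_induct)
  case less
  note p = has_codeD(1)[OF less.prems(1)] and p' = has_codeD(1)[OF less.prems(2)]
  have desc: "w (Suc i) < w i \<longleftrightarrow> w' (Suc i) < w' i" for i
  proof (cases "1 \<le> i")
    case True
    then show ?thesis using has_codeD(4)[OF less.prems(1)] has_codeD(4)[OF less.prems(2)] by simp
  next
    case False
    then show ?thesis using descent_range(1)[OF p] descent_range(1)[OF p'] by blast
  qed
  show ?case
  proof (cases "\<exists>i. w (Suc i) < w i")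
    case False
    then show ?thesis using no_descent_imp_id[OF p] no_descent_imp_id[OF p'] desc by metis
  next
    case True
    then obtain i where i: "w (Suc i) < w i" by blast
    note r = descent_range[OF p i]
    have gt: "a (Suc i) < a i" using has_codeD(4)[OF less.prems(1) r(1)] i by simp
    have "w \<circ> adj i = w' \<circ> adj i"
      by (rule less.hyps[OF _ has_code_lower(1)[OF less.prems(1) r(1) gt] has_code_lower(1)[OF less.prems(2) r(1) gt]])
         (simp add: inversions_adj[OF p i])
    then show ?thesis by (metis comp_adj_adj)
  qed
qed

text \<open>
  The code of \<open>\<varpi>\<close> truncated to its first \<open>R\<close> rows; \<open>R = n\<close> gives the whole code.
\<close>

definition rows_code :: "nat \<Rightarrow> nat \<Rightarrow> nat \<Rightarrow> nat \<Rightarrow> nat \<Rightarrow> nat" where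
  "rows_code n k p R t = (if k < t \<and> t \<le> k + R then (n + 1 - (t - k)) * p else 0)"

lemma has_code_varpi:
  assumes "varpi n k p permutes {1..m}"
  shows "has_code m (rows_code n k p n) (varpi n k p)"
proof -
  obtain M w where w: "has_code M (rows_code n k p n) w"
    using has_code_exists[of "k + n" "rows_code n k p n"] by (auto simp: rows_code_def)
  have mono: "has_code (max l l') a v" if "has_code l a v" for l l' a v
    using that permutes_subset[of v "{1..l}" "{1..max l l'}"] unfolding has_code_def by auto
  have "varpi n k p = w"
    unfolding varpi_def
  proof (rule the_equality)
    show "(\<exists>m. w permutes {1..m}) \<and>
      (\<forall>i\<ge>1. lehmer_code w i = (if k < i \<and> i \<le> k + n then (n + 1 - (i - k)) * p else 0))"
      using w unfolding has_code_def rows_code_def by blast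
  next
    fix v assume v: "(\<exists>m. v permutes {1..m}) \<and>
      (\<forall>i\<ge>1. lehmer_code v i = (if k < i \<and> i \<le> k + n then (n + 1 - (i - k)) * p else 0))"
    then obtain M' where "has_code M' (rows_code n k p n) v" unfolding has_code_def rows_code_def by blast
    then show "v = w" using mono[of M' _ v M] mono[OF w, of M'] has_code_unique by (metis max.commute)
  qed
  then show ?thesis using w assms by (simp add: has_code_def)
qed

lemma groth_divided_difference_code:
  fixes b :: "'r::comm_ring_1"
  assumes c: "has_code m a w" and i: "1 \<le> i" "i < m" and le: "a i \<le> a (Suc i)"
  shows "(x i - x (Suc i)) * groth m b x w =
    (1 + b * x (Suc i)) * groth m b x (w \<circ> adj i) - (1 + b * x i) * groth m b (x \<circ> adj i) (w \<circ> adj i)"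
  using groth_divided_difference[OF has_codeD(1)[OF has_code_raise(1)[OF assms]] has_code_raise(2)[OF assms], of x b]
  unfolding comp_adj_adj .

section \<open>The longest permutation\<close>

text \<open>
  A product of \<open>l\<close> letters has no coefficient at permutations with more than \<open>l\<close> inversions.
\<close>

lemma A_op_vanish:
  assumes "\<And>w. w permutes {1..m} \<Longrightarrow> L < inversions m w \<Longrightarrow> \<phi> w = 0"
  shows "w permutes {1..m} \<Longrightarrow> L + (m - i) < inversions m w \<Longrightarrow> A_op m b i x \<phi> w = 0"
proof (induction "m - i" arbitrary: i w)
  case 0
  then show ?case using assms by (simp add: A_op_triv)
next
  case (Suc d)
  then have i: "i < m" "d = m - Suc i" by auto
  have 1: "A_op m b (Suc i) x \<phi> w = 0" using Suc.hyps(1)[OF i(2), of w] Suc.prems i by simp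
  show ?case
  proof (cases "w (Suc i) < w i")
    case True
    note r = descent_range[OF Suc.prems(1) True]
    have "A_op m b (Suc i) x \<phi> (w \<circ> adj i) = 0"
      using Suc.hyps(1)[OF i(2), of "w \<circ> adj i"] permutes_adj[OF Suc.prems(1) r] Suc.prems i
        inversions_adj[OF Suc.prems(1) True] by simp
    then show ?thesis using 1 i by (simp add: A_op_step h_op_def idc_op_def)
  next
    case False
    then show ?thesis using 1 i by (simp add: A_op_step h_op_def idc_op_def)
  qed
qed

text \<open>
  When the number of inversions equals the number of available letters, every letter has to be used;
  \<open>A\<^sub>i\<close> then moves the entry \<open>m - i\<close> of the code down to zero.
\<close>

lemma A_op_top:
  assumes van: "\<And>w. w permutes {1..m} \<Longrightarrow> L < inversions m w \<Longrightarrow> \<phi> w = 0"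
  shows "1 \<le> i \<Longrightarrow> i \<le> m \<Longrightarrow> has_code m a w \<Longrightarrow> a i = m - i \<Longrightarrow> (\<And>t. i < t \<Longrightarrow> a t = 0) \<Longrightarrow>
    inversions m w = L + (m - i) \<Longrightarrow>
    \<exists>w'. has_code m (a(i := 0)) w' \<and> inversions m w' = L \<and> A_op m b i x \<phi> w = x ^ (m - i) * \<phi> w'"
proof (induction "m - i" arbitrary: i a w)
  case 0
  then have "i = m" by simp
  moreover have "has_code m (a(m := 0)) w" using 0 \<open>i = m\<close> by (intro has_code_cong[OF \<open>has_code m a w\<close>]) simp
  ultimately show ?case using 0 by (intro exI[of _ w]) (simp add: A_op_triv fun_upd_def)
next
  case (Suc d)
  then have i: "i < m" "d = m - Suc i" by auto
  have gt: "a (Suc i) < a i" using Suc.prems i by simp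
  note p = has_codeD(1)[OF Suc.prems(3)]
  note low = has_code_lower[OF Suc.prems(3,1) gt]
  let ?a = "a(i := a (Suc i), Suc i := a i - 1)" and ?u = "w \<circ> adj i"
  have inv: "inversions m w = Suc (inversions m ?u)" by (rule inversions_adj[OF p low(2)])
  have "\<exists>w'. has_code m (?a(Suc i := 0)) w' \<and> inversions m w' = L \<and>
      A_op m b (Suc i) x \<phi> ?u = x ^ (m - Suc i) * \<phi> w'"
    by (rule Suc.hyps(1)[OF i(2) _ _ low(1)]) (use i Suc.prems inv in auto)
  then obtain w' where w': "has_code m (?a(Suc i := 0)) w'" "inversions m w' = L"
    "A_op m b (Suc i) x \<phi> ?u = x ^ (m - Suc i) * \<phi> w'" by blast
  have "has_code m (a(i := 0)) w'"
    by (rule has_code_cong[OF w'(1)]) (use Suc.prems in auto)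
  moreover have "A_op m b (Suc i) x \<phi> w = 0"
    by (rule A_op_vanish[OF van p]) (use Suc.prems i in auto)
  then have "A_op m b i x \<phi> w = x * (x ^ (m - Suc i) * \<phi> w')"
    using i low(2) w'(3) by (simp add: A_op_step h_op_def idc_op_def comp_def)
  then have "A_op m b i x \<phi> w = x ^ (m - i) * \<phi> w'"
    using i by (simp add: mult.assoc[symmetric] Suc_diff_Suc flip: power_Suc)
  ultimately show ?case using w'(2) by blast
qed

lemma fold_upt_Suc: "1 \<le> i \<Longrightarrow> fold f [1..<Suc i] s = f i (fold f [1..<i] s)"
  by simp

lemma groth_partial_vanish:
  assumes "w permutes {1..m}" "(\<Sum>j=1..i. m - j) < inversions m w"
  shows "fold (\<lambda>i. A_op m b i (x i)) [1..<Suc i] (delta id) w = 0"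
  using assms
proof (induction i arbitrary: w)
  case 0
  then have "w \<noteq> id" using inversions_id[of m] by auto
  then show ?case by (simp add: delta_def[of id w, unfolded id_def] id_def)
next
  case (Suc i)
  have "fold (\<lambda>i. A_op m b i (x i)) [1..<Suc (Suc i)] (delta id) =
      A_op m b (Suc i) (x (Suc i)) (fold (\<lambda>i. A_op m b i (x i)) [1..<Suc i] (delta id))"
    by (rule fold_upt_Suc) simp
  moreover have "A_op m b (Suc i) (x (Suc i)) (fold (\<lambda>i. A_op m b i (x i)) [1..<Suc i] (delta id)) w = 0"
    by (rule A_op_vanish[OF Suc.IH Suc.prems(1)]) (use Suc.prems(2) in \<open>simp_all del: upt_Suc\<close>)
  ultimately show ?case by (simp add: id_def del: upt_Suc)
qed

lemma groth_partial_top: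
  assumes "i \<le> m" "has_code m (\<lambda>t. if t \<le> i then m - t else 0) w" "inversions m w = (\<Sum>j=1..i. m - j)"
  shows "fold (\<lambda>i. A_op m b i (x i)) [1..<Suc i] (delta id) w = (\<Prod>j=1..i. x j ^ (m - j))"
  using assms
proof (induction i arbitrary: w)
  case 0
  have "has_code m (\<lambda>t. if t \<le> 0 then m - t else 0) id"
    by (auto simp: has_code_def permutes_id lehmer_code_id)
  then have "w = id" using has_code_unique 0 by blast
  then show ?case by (simp add: delta_def)
next
  case (Suc i)
  let ?F = "fold (\<lambda>i. A_op m b i (x i)) [1..<Suc i] (delta id)"
  let ?c = "\<lambda>t. if t \<le> Suc i then m - t else 0"
  have "\<exists>w'. has_code m (?c(Suc i := 0)) w' \<and> inversions m w' = (\<Sum>j=1..i. m - j) \<and>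
      A_op m b (Suc i) (x (Suc i)) ?F w = x (Suc i) ^ (m - Suc i) * ?F w'"
    by (rule A_op_top[OF groth_partial_vanish _ _ Suc.prems(2)]) (use Suc.prems in auto)
  then obtain w' where w': "has_code m (?c(Suc i := 0)) w'" "inversions m w' = (\<Sum>j=1..i. m - j)"
    "A_op m b (Suc i) (x (Suc i)) ?F w = x (Suc i) ^ (m - Suc i) * ?F w'" by blast
  have "has_code m (\<lambda>t. if t \<le> i then m - t else 0) w'"
    by (rule has_code_cong[OF w'(1)]) auto
  then have "?F w' = (\<Prod>j=1..i. x j ^ (m - j))" using Suc.IH w'(2) Suc.prems(1)
    by (simp add: id_def del: upt_Suc)
  moreover have "fold (\<lambda>i. A_op m b i (x i)) [1..<Suc (Suc i)] (delta id) = A_op m b (Suc i) (x (Suc i)) ?F"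
    by (rule fold_upt_Suc) simp
  ultimately show ?case using w'(3) by (simp add: mult.commute id_def del: upt_Suc)
qed

lemma groth_longest:
  assumes "has_code m (\<lambda>t. m - t) w"
  shows "groth m b x w = (\<Prod>j=1..m. x j ^ (m - j))"
proof -
  have "inversions m w = (\<Sum>j=1..m. m - j)"
    unfolding inversions_def using has_codeD(2)[OF assms] by (intro sum.cong) auto
  moreover have "has_code m (\<lambda>t. if t \<le> m then m - t else 0) w"
    by (rule has_code_cong[OF assms]) auto
  ultimately show ?thesis unfolding groth_extend by (intro groth_partial_top) auto
qed

section \<open>Dominant permutations\<close>

lemma prod_split_adjacent:
  assumes "1 \<le> i" "i < m"
  shows "(\<Prod>t=1..m. f t) = f i * f (Suc i) * (\<Prod>t\<in>{1..m} - {i, Suc i}. f t :: 'a::comm_monoid_mult)"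
proof -
  have S: "{1..m} = insert i (insert (Suc i) ({1..m} - {i, Suc i}))" using assms by auto
  show ?thesis by (subst S) (simp add: mult.assoc)
qed

text \<open>
  The staircase is the longest permutation; a
  smaller code arises from one with an additional box in a row \<open>i\<close> whose length equals that of row
  \<open>i + 1\<close>, and the divided difference of \<open>x\<^sub>i\<close> times a monomial symmetric in \<open>x\<^sub>i\<close>, \<open>x\<^sub>i\<^sub>+\<^sub>1\<close> is that monomial.
  Distinctness of the variables allows cancelling \<open>x\<^sub>i - x\<^sub>i\<^sub>+\<^sub>1\<close>.
\<close>

lemma groth_dominant_inj:
  fixes b :: "'r::idom"
  assumes "has_code m a w" "\<And>i. 1 \<le> i \<Longrightarrow> a (Suc i) \<le> a i" "inj_on x {1..m}"
  shows "groth m b x w = (\<Prod>j=1..m. x j ^ a j)"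
  using assms
proof (induction "\<Sum>i=1..m. m - i - a i" arbitrary: a w x rule: less_induct)
  case less
  note c = less.prems(1)
  have le: "a i \<le> m - i" if "1 \<le> i" for i by (rule has_codeD(3)[OF c that])
  show ?case
  proof (cases "\<exists>i\<ge>1. i < m \<and> a i = a (Suc i)")
    case False
    have "a i = m - i" if "1 \<le> i" for i
    proof (cases "i \<le> m")
      case True
      then show ?thesis
      proof (induction i rule: inc_induct)
        case base
        then show ?case using le[of m] \<open>1 \<le> i\<close> True by simp
      next
        case (step j)
        then have "a (Suc j) < a j" using less.prems(2)[of j] False that by (metis le_neq_implies_less le_trans)
        then show ?case using step le[of j] that by simp
      qed
    next
      case nm: False
      then show ?thesis using le[OF that] by simp
    qed
    then have "has_code m (\<lambda>t. m - t) w" and "(\<Prod>j=1..m. x j ^ a j) = (\<Prod>j=1..m. x j ^ (m - j))"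
      by (auto intro: has_code_cong[OF c])
    then show ?thesis using groth_longest by metis
  next
    case True
    \<comment> \<open>The first row that equals the next one can be lengthened: the code stays weakly decreasing, and
      the new row still fits below the staircase because its successor did.\<close>
    define i where "i = (LEAST i. 1 \<le> i \<and> i < m \<and> a i = a (Suc i))"
    have i: "1 \<le> i" "i < m" "a i = a (Suc i)" using LeastI_ex[OF True] unfolding i_def by auto
    have lt: "a (Suc j) < a j" if "1 \<le> j" "j < i" for j
      using not_less_Least[of j "\<lambda>i. 1 \<le> i \<and> i < m \<and> a i = a (Suc i)"] that i less.prems(2)[of j]
      unfolding i_def[symmetric] by (metis le_neq_implies_less less_trans)
    let ?u = "w \<circ> adj i" and ?a = "a(i := Suc (a i))"
    have u: "has_code m ?a ?u"
      by (rule has_code_cong[OF has_code_raise(1)[OF c i(1,2)]]) (use i in auto)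
    have dom: "?a (Suc j) \<le> ?a j" if "1 \<le> j" for j
      using less.prems(2)[OF that] lt[of j] that i by (cases "Suc j = i") (auto simp: Suc_le_eq)
    have "(\<Sum>j=1..m. m - j - ?a j) < (\<Sum>j=1..m. m - j - a j)"
    proof (rule sum_strict_mono_ex1)
      show "\<exists>j\<in>{1..m}. m - j - ?a j < m - j - a j"
        by (rule bexI[of _ i]) (use i le[of "Suc i"] in auto)
    qed auto
    note sum_less = this
    have G: "groth m b x ?u = (\<Prod>j=1..m. x j ^ ?a j)" if "inj_on x {1..m}" for x :: "nat \<Rightarrow> 'r"
      by (rule less.hyps[OF sum_less u _ that]) (rule dom)
    let ?R = "\<Prod>t\<in>{1..m} - {i, Suc i}. x t ^ a t"
    have R: "(\<Prod>t\<in>{1..m} - {i, Suc i}. y t ^ ?a t) = (\<Prod>t\<in>{1..m} - {i, Suc i}. y t ^ a t)"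
      "(\<Prod>t\<in>{1..m} - {i, Suc i}. (x \<circ> adj i) t ^ a t) = ?R" for y :: "nat \<Rightarrow> 'r"
      by (auto intro!: prod.cong)
    have G1: "groth m b x ?u = x i ^ Suc (a i) * x (Suc i) ^ a i * ?R"
      unfolding G[OF less.prems(3)] prod_split_adjacent[OF i(1,2)] R using i by simp
    have "adj i ` {1..m} = {1..m}" by (rule permutes_image[OF permutes_swap_id]) (use i in auto)
    then have "inj_on (x \<circ> adj i) {1..m}" using less.prems(3) by (intro comp_inj_on) auto
    from G[OF this] have G2: "groth m b (x \<circ> adj i) ?u = x (Suc i) ^ Suc (a i) * x i ^ a i * ?R"
      unfolding prod_split_adjacent[OF i(1,2)] R using i by simp
    have G0: "(\<Prod>j=1..m. x j ^ a j) = x i ^ a i * x (Suc i) ^ a i * ?R"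
      unfolding prod_split_adjacent[OF i(1,2)] using i by simp
    have "(x i - x (Suc i)) * groth m b x w = (x i - x (Suc i)) * (\<Prod>j=1..m. x j ^ a j)"
      unfolding groth_divided_difference_code[OF c i(1,2) eq_refl[OF i(3)]] G1 G2 G0 by (simp add: algebra_simps)
    moreover have "x i \<noteq> x (Suc i)" using inj_onD[OF less.prems(3), of i "Suc i"] i by auto
    ultimately show ?thesis by simp
  qed
qed

lemma comm_ring_hom_poly_eval: "comm_ring_hom (\<lambda>q :: 'a::comm_ring_1 poly. poly q z)"
  by unfold_locales simp_all

lemma groth_dominant:
  fixes b :: "'r::{idom,ring_char_0}"
  assumes c: "has_code m a w" and dom: "\<And>i. 1 \<le> i \<Longrightarrow> a (Suc i) \<le> a i"
  shows "groth m b x w = (\<Prod>j=1..m. x j ^ a j)"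
proof -
  interpret ev: comm_ring_hom "\<lambda>q :: 'r poly. poly q 0" by (rule comm_ring_hom_poly_eval)
  \<comment> \<open>The variables are perturbed to \<open>x\<^sub>i + i t\<close>, which are distinct, and \<open>t\<close> is set to 0 at the end.\<close>
  have "inj_on (\<lambda>i. [:x i, of_nat i:]) {1..m}" by (auto intro: inj_onI)
  from groth_dominant_inj[OF c dom this, of "[:b:]"]
  have "poly (groth m [:b:] (\<lambda>i. [:x i, of_nat i:]) w) 0 = (\<Prod>j=1..m. x j ^ a j)"
    by (simp add: poly_prod)
  then show ?thesis by (simp add: ev.hom_groth)
qed

lemma groth_polynomial_in_one_variable:
  fixes b :: "'r::comm_ring_1"
  shows "\<exists>F. \<forall>z. poly F z = groth m b (x(i := z)) w"
proof (intro exI allI)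
  fix z
  interpret ev: comm_ring_hom "\<lambda>q :: 'r poly. poly q z" by (rule comm_ring_hom_poly_eval)
  have "(\<lambda>j. poly (((\<lambda>j. [:x j:])(i := [:0, 1:])) j) z) = x(i := z)" by (auto simp: fun_eq_iff)
  then show "poly (groth m [:b:] ((\<lambda>j. [:x j:])(i := [:0, 1:])) w) z = groth m b (x(i := z)) w"
    by (simp only: ev.hom_groth) simp
qed

lemma poly_eq_if_agree_off_point:
  fixes P Q :: "'r::{idom,ring_char_0} poly"
  assumes "\<And>z. z \<noteq> c \<Longrightarrow> poly P z = poly Q z"
  shows "P = Q"
proof (rule ccontr)
  assume "P \<noteq> Q"
  then have "finite {z. poly (P - Q) z = 0}" by (intro poly_roots_finite) simp
  moreover have "UNIV - {c} \<subseteq> {z. poly (P - Q) z = 0}" using assms by auto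
  ultimately have "finite (UNIV - {c} :: 'r set)" by (rule finite_subset[rotated])
  then show False using infinite_UNIV_char_0[where 'a = 'r] by simp
qed

section \<open>The case \<open>k = 1\<close>: lattice paths and Narayana numbers\<close>

text \<open>
  The lattice paths \<open>0 = c\<^sub>0 \<le> c\<^sub>1 \<le> \<dots> \<le> c\<^sub>r = e\<close> with \<open>c\<^sub>i \<le> i p\<close>, each weighted by \<open>B\<close> to the number of
  strict increases.
\<close>

fun path_coeff :: "'r::comm_ring_1 \<Rightarrow> nat \<Rightarrow> nat \<Rightarrow> nat \<Rightarrow> 'r" where
  "path_coeff B p 0 e = (if e = 0 then 1 else 0)"
| "path_coeff B p (Suc r) e = (if e \<le> Suc r * p then path_coeff B p r e + B * (\<Sum>c<e. path_coeff B p r c) else 0)"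

definition row_poly :: "'r::comm_ring_1 \<Rightarrow> nat \<Rightarrow> nat \<Rightarrow> 'r poly" where
  "row_poly B p r = (\<Sum>c\<le>r * p. monom (path_coeff B p r c) c)"

lemma poly_row_poly: "poly (row_poly B p r) z = (\<Sum>c\<le>r * p. path_coeff B p r c * z ^ c)"
  by (simp add: row_poly_def poly_sum poly_monom)

lemma path_coeff_beyond: "r * p < e \<Longrightarrow> path_coeff B p r e = 0"
  by (cases r) auto

lemma sum_path_coeff_extend: "r * p \<le> N \<Longrightarrow> (\<Sum>c\<le>N. path_coeff B p r c * f c) = (\<Sum>c\<le>r * p. path_coeff B p r c * f c)"
  by (rule sum.mono_neutral_right) (auto simp: path_coeff_beyond)

text \<open>
  On a monomial of degree \<open>c \<le> N\<close> the operator is a geometric sum,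
  \<open>(B z\<^bsup>N+1\<^esup> - (1 + (B - 1) z) z\<^bsup>c\<^esup>) / (z - 1) = z\<^bsup>c\<^esup> + B (z\<^bsup>c+1\<^esup> + \<dots> + z\<^bsup>N\<^esup>)\<close>: a path stays in column
  \<open>c\<close> or moves strictly to the right at the cost of a factor \<open>B\<close>.
\<close>

lemma row_poly_telescope:
  fixes B z :: "'r::comm_ring_1"
  shows "(z - 1) * (\<Sum>e\<le>N. (\<kappa> e + B * (\<Sum>c<e. \<kappa> c)) * z ^ e) =
    B * z ^ Suc N * (\<Sum>c\<le>N. \<kappa> c) - (1 + (B - 1) * z) * (\<Sum>c\<le>N. \<kappa> c * z ^ c)"
proof (induction N)
  case 0
  then show ?case by (simp add: algebra_simps)
next
  case (Suc N)
  have "(\<Sum>c<Suc N. \<kappa> c) = (\<Sum>c\<le>N. \<kappa> c)" by (simp add: lessThan_Suc_atMost)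
  then show ?case using Suc by (simp add: algebra_simps)
qed

lemma row_poly_Suc:
  "(z - 1) * poly (row_poly B p (Suc r)) z =
    B * z ^ Suc (Suc r * p) * poly (row_poly B p r) 1 - (1 + (B - 1) * z) * poly (row_poly B p r) z"
proof -
  have "poly (row_poly B p (Suc r)) z = (\<Sum>e\<le>Suc r * p. (path_coeff B p r e + B * (\<Sum>c<e. path_coeff B p r c)) * z ^ e)"
    unfolding poly_row_poly by (intro sum.cong) auto
  moreover have "(\<Sum>c\<le>Suc r * p. path_coeff B p r c) = poly (row_poly B p r) 1"
    unfolding poly_row_poly using sum_path_coeff_extend[of r p "Suc r * p" B "\<lambda>_. 1"] by simp
  moreover have "(\<Sum>c\<le>Suc r * p. path_coeff B p r c * z ^ c) = poly (row_poly B p r) z"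
    unfolding poly_row_poly by (rule sum_path_coeff_extend) simp
  ultimately show ?thesis using row_poly_telescope[of z "path_coeff B p r" B "Suc r * p"] by simp
qed

text \<open>
  The code between the dominant code \<open>((n + 1 - t) p + 1)\<^sub>t\<close>, which is the case \<open>i = n + 1\<close>, and the code of
  \<open>\<varpi>\<close> for \<open>k = 1\<close>, which is the case \<open>i = 1\<close>: the rows from \<open>i\<close> on have been moved one place to the right.
\<close>

definition one_step_code :: "nat \<Rightarrow> nat \<Rightarrow> nat \<Rightarrow> nat \<Rightarrow> nat" where
  "one_step_code n p i t = (if t < i then Suc ((n + 1 - t) * p) else if t = i then 0
     else if t \<le> n + 1 then (n + 2 - t) * p else 0)"

text \<open>
  Moving row \<open>i\<close> involves only \<open>x\<^sub>i\<close> and \<open>x\<^sub>i\<^sub>+\<^sub>1\<close>, so the later variables may be set to 1 beforehand. What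
  remains of the moved rows is a polynomial in the single variable \<open>x\<^sub>i\<close>, and the divided difference at
  \<open>x\<^sub>i\<^sub>+\<^sub>1 = 1\<close> becomes the recursion of \<open>row_poly\<close>.
\<close>

lemma groth_one_step_code:
  fixes b :: "'r::{idom,ring_char_0}"
  assumes "1 \<le> i" "i \<le> n + 1" "has_code m (one_step_code n p i) w" "1 \<le> p" "\<And>j. i < j \<Longrightarrow> x j = 1"
  shows "groth m b x w =
    (\<Prod>j=1..<i. x j ^ Suc ((n + 1 - j) * p)) * poly (row_poly (1 + b) p (n + 1 - i)) (x i)"
  using assms(2,1,3-)
proof (induction i arbitrary: w x rule: inc_induct)
  case base
  note c = base.prems(2)
  have nm: "n \<le> m"
    using has_codeD(3)[OF c, of n] by (cases "n = 0") (auto simp: one_step_code_def)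
  have "one_step_code n p (n + 1) (Suc i) \<le> one_step_code n p (n + 1) i" if "1 \<le> i" for i
    by (auto simp: one_step_code_def intro!: mult_right_mono diff_le_mono2)
  then have "groth m b x w = (\<Prod>j=1..m. x j ^ one_step_code n p (n + 1) j)"
    by (rule groth_dominant[OF c])
  also have "\<dots> = (\<Prod>j=1..<n + 1. x j ^ one_step_code n p (n + 1) j)"
    by (rule prod.mono_neutral_right) (use nm in \<open>auto simp: one_step_code_def\<close>)
  also have "\<dots> = (\<Prod>j=1..<n + 1. x j ^ Suc ((n + 1 - j) * p))"
    by (rule prod.cong) (auto simp: one_step_code_def)
  finally show ?case by (simp add: poly_row_poly)
next
  case (step i)
  note c = step.prems(2)
  have i: "1 \<le> i" "i < n + 1" using step by auto
  have "0 < (n + 1 - i) * p" using i step.prems(3) by simp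
  also have "\<dots> \<le> m - Suc i" using has_codeD(3)[OF c, of "Suc i"] i by (simp add: one_step_code_def)
  finally have im: "i < m" by simp
  have le: "one_step_code n p i i \<le> one_step_code n p i (Suc i)" by (simp add: one_step_code_def)
  let ?u = "w \<circ> adj i"
  have u: "has_code m (one_step_code n p (Suc i)) ?u"
    by (rule has_code_cong[OF has_code_raise(1)[OF c i(1) im le]])
       (use i in \<open>auto simp: one_step_code_def Suc_diff_le\<close>)
  let ?q = "row_poly (1 + b) p (n + 1 - Suc i)" and ?q' = "row_poly (1 + b) p (n + 1 - i)"
  define A where "A = Suc ((n + 1 - i) * p)"
  define P :: "(nat \<Rightarrow> 'r) \<Rightarrow> 'r" where "P = (\<lambda>x. \<Prod>j=1..<i. x j ^ Suc ((n + 1 - j) * p))"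
  have P_cong: "P y = P z" if "\<And>j. j < i \<Longrightarrow> y j = z j" for y z
    unfolding P_def by (rule prod.cong) (auto simp: that)
  have IH: "groth m b y ?u = P y * y i ^ A * poly ?q (y (Suc i))"
    if "\<And>j. Suc i < j \<Longrightarrow> y j = 1" for y
    using step.IH[OF _ u step.prems(3) that] i unfolding P_def A_def
    by (simp only: prod.atLeastLessThan_Suc le_SucI)
  have off: "groth m b x w = P x * poly ?q' (x i)" if x1: "\<And>j. i < j \<Longrightarrow> x j = 1" and xi: "x i \<noteq> 1" for x
  proof -
    let ?y = "x \<circ> adj i"
    have P: "P ?y = P x" by (rule P_cong) auto
    have G1: "groth m b x ?u = P x * x i ^ A * poly ?q 1"
      using IH[of x] x1 by simp
    have "groth m b ?y ?u = P ?y * ?y i ^ A * poly ?q (?y (Suc i))"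
      by (rule IH) (use x1 in simp)
    then have G2: "groth m b ?y ?u = P x * poly ?q (x i)"
      unfolding P using x1[of "Suc i"] by simp
    have R: "n + 1 - i = Suc (n + 1 - Suc i)" using i by simp
    have "(x i - 1) * groth m b x w = P x * ((x i - 1) * poly ?q' (x i))"
      using groth_divided_difference_code[OF c i(1) im le, of x b] x1[of "Suc i"]
      unfolding G1 G2 R row_poly_Suc A_def[unfolded R, symmetric] by (simp add: algebra_simps)
    then have "(x i - 1) * groth m b x w = (x i - 1) * (P x * poly ?q' (x i))" by (simp add: algebra_simps)
    then show ?thesis using xi by simp
  qed
  \<comment> \<open>For \<open>x\<^sub>i = 1\<close> the factor \<open>x\<^sub>i - 1\<close> cannot be cancelled, but both sides are polynomials in \<open>x\<^sub>i\<close>.\<close>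
  obtain F where F: "\<And>z. poly F z = groth m b (x(i := z)) w"
    using groth_polynomial_in_one_variable[of m b x i w] by blast
  have "F = smult (P x) ?q'"
  proof (rule poly_eq_if_agree_off_point[of 1])
    fix z :: 'r assume "z \<noteq> 1"
    then have "groth m b (x(i := z)) w = P (x(i := z)) * poly ?q' z"
      using off[of "x(i := z)"] step.prems(4) by simp
    moreover have "P (x(i := z)) = P x" by (rule P_cong) auto
    ultimately show "poly F z = poly (smult (P x) ?q') z" unfolding F by simp
  qed
  then have "groth m b (x(i := x i)) w = P x * poly ?q' (x i)" unfolding F[symmetric] by simp
  then show ?case by (simp add: P_def)
qed

lemma groth_varpi_1:
  fixes b :: "'r::{idom,ring_char_0}"
  assumes "varpi n 1 p permutes {1..m}" "1 \<le> p"
  shows "groth m b (\<lambda>_. 1) (varpi n 1 p) = poly (row_poly (1 + b) p n) 1"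
proof -
  have "has_code m (one_step_code n p 1) (varpi n 1 p)"
    by (rule has_code_cong[OF has_code_varpi[OF assms(1)]]) (auto simp: rows_code_def one_step_code_def)
  from groth_one_step_code[OF _ _ this assms(2), of "\<lambda>_. 1" b] show ?thesis by simp
qed

text \<open>
  The weights of the same paths read from their end: \<open>r\<close> steps remain and the current column is \<open>D\<close> away
  from the final bound \<open>n p\<close>. In this direction the bound only requires \<open>D\<close> to stay at least \<open>r p\<close>,
  and the counts have a closed form.
\<close>

fun tail_weight :: "'r::comm_ring_1 \<Rightarrow> nat \<Rightarrow> nat \<Rightarrow> nat \<Rightarrow> 'r" where
  "tail_weight B p 0 D = 1"
| "tail_weight B p (Suc r) D = tail_weight B p r D + B * (\<Sum>D' = r * p..<D. tail_weight B p r D')"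

text \<open>
  Cut all paths after step \<open>i\<close> or after step \<open>i + 1\<close>: the total weight is the same.
\<close>

lemma path_coeff_tail_weight_step:
  assumes "Suc i \<le> n"
  shows "(\<Sum>e\<le>Suc i * p. path_coeff B p (Suc i) e * tail_weight B p (n - Suc i) (n * p - e)) =
    (\<Sum>c\<le>i * p. path_coeff B p i c * tail_weight B p (n - i) (n * p - c))"
proof -
  let ?N = "Suc i * p" and ?v = "tail_weight B p (n - Suc i)"
  have N: "?N \<le> n * p" using assms by (intro mult_right_mono) auto
  have r: "(n - Suc i) * p = n * p - ?N" by (simp add: diff_mult_distrib)
  have "(\<Sum>e\<le>?N. path_coeff B p (Suc i) e * ?v (n * p - e)) =
      (\<Sum>e\<le>?N. path_coeff B p i e * ?v (n * p - e) + (\<Sum>c<e. B * path_coeff B p i c * ?v (n * p - e)))"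
    by (rule sum.cong[OF refl]) (simp add: distrib_right sum_distrib_left sum_distrib_right del: mult_Suc)
  also have "\<dots> = (\<Sum>e\<le>?N. path_coeff B p i e * ?v (n * p - e)) + (\<Sum>e\<le>?N. \<Sum>c<e. B * path_coeff B p i c * ?v (n * p - e))"
    by (rule sum.distrib)
  also have "(\<Sum>e\<le>?N. \<Sum>c<e. B * path_coeff B p i c * ?v (n * p - e)) =
      (\<Sum>c\<le>?N. \<Sum>e = Suc c..?N. B * path_coeff B p i c * ?v (n * p - e))"
    unfolding sum.Sigma[OF finite_atMost ballI[OF finite_lessThan]] sum.Sigma[OF finite_atMost ballI[OF finite_atLeastAtMost]]
    by (rule sum.reindex_bij_witness[of _ "\<lambda>(c, e). (e, c)" "\<lambda>(e, c). (c, e)"]) auto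
  also have "\<dots> = (\<Sum>c\<le>?N. path_coeff B p i c * (B * (\<Sum>D' = (n - Suc i) * p..<n * p - c. ?v D')))"
  proof (rule sum.cong[OF refl])
    fix c assume "c \<in> {..?N}"
    \<comment> \<open>The substitution \<open>D' = n p - e\<close> turns the columns still reachable into distances.\<close>
    have "(\<Sum>e = Suc c..?N. ?v (n * p - e)) = (\<Sum>D' = (n - Suc i) * p..<n * p - c. ?v D')"
      unfolding r
      by (rule sum.reindex_bij_witness[of _ "\<lambda>D. n * p - D" "\<lambda>e. n * p - e"]) (use N in auto)
    then show "(\<Sum>e = Suc c..?N. B * path_coeff B p i c * ?v (n * p - e)) =
        path_coeff B p i c * (B * (\<Sum>D' = (n - Suc i) * p..<n * p - c. ?v D'))"
      by (simp add: mult_ac flip: sum_distrib_left)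
  qed
  also have "(\<Sum>e\<le>?N. path_coeff B p i e * ?v (n * p - e)) + \<dots> =
      (\<Sum>c\<le>?N. path_coeff B p i c * tail_weight B p (Suc (n - Suc i)) (n * p - c))"
    by (simp add: distrib_left sum.distrib)
  also have "Suc (n - Suc i) = n - i" using assms by simp
  also have "(\<Sum>c\<le>?N. path_coeff B p i c * tail_weight B p (n - i) (n * p - c)) =
      (\<Sum>c\<le>i * p. path_coeff B p i c * tail_weight B p (n - i) (n * p - c))"
    by (rule sum_path_coeff_extend) simp
  finally show ?thesis .
qed

lemma row_poly_at_1: "poly (row_poly B p n) 1 = tail_weight B p n (n * p)"
proof -
  have "(\<Sum>c\<le>i * p. path_coeff B p i c * tail_weight B p (n - i) (n * p - c)) = tail_weight B p n (n * p)"
    if "i \<le> n" for i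
    using that by (induction i) (simp_all add: path_coeff_tail_weight_step del: path_coeff.simps(2) mult_Suc)
  from this[of n] show ?thesis by (simp add: poly_row_poly)
qed

definition tail_sum :: "'r::comm_ring_1 \<Rightarrow> nat \<Rightarrow> nat \<Rightarrow> nat \<Rightarrow> 'r" where
  "tail_sum B p r D = (\<Sum>D' = r * p..<D. tail_weight B p r D')"

text \<open>
  The coefficient of \<open>\<beta>\<^bsup>l\<^esup>\<close> in \<open>tail_sum\<close> for \<open>r p \<le> D\<close>; it vanishes on the boundary \<open>D = r p\<close>, like the
  ballot numbers.
\<close>

definition narayana_weight :: "nat \<Rightarrow> nat \<Rightarrow> nat \<Rightarrow> nat \<Rightarrow> rat" where
  "narayana_weight p r D l =
     (of_nat D - of_nat (r * p)) * of_nat (r choose l) * of_nat ((D + p - 1) choose l) / of_nat (Suc l)"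

text \<open>
  The recursion of the closed form after all binomial coefficients are expressed by two of them.
\<close>

lemma narayana_rational_identity:
  fixes D p r L c d :: rat
  assumes L: "L \<noteq> 0" "L + 1 \<noteq> 0" and A: "A = (D + p - L) * c / L" and C: "C = (r - L + 1) * d / L"
  shows "(D + 1 - (r + 1) * p) * (C + d) * (A + c) / (L + 1) - (D - (r + 1) * p) * (C + d) * A / (L + 1) =
    (D + 1 - r * p) * C * (A + c) / (L + 1) - (D - r * p) * C * A / (L + 1) + (D - r * p) * d * c / L"
proof -
  have A': "L * A = (D + p - L) * c" and C': "L * C = (r - L + 1) * d" using L A C by simp_all
  define M where "M = (D + 1 - (r + 1) * p) * (C + d) * (A + c) - (D - (r + 1) * p) * (C + d) * A
     - (D + 1 - r * p) * C * (A + c) + (D - r * p) * C * A"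
  have "L * M = d * (L * (D + 1 - (r + 1) * p) * c + L * A) - (L * C) * p * c"
    unfolding M_def by (simp add: algebra_simps)
  also have "\<dots> = (L + 1) * ((D - r * p) * d * c)" unfolding A' C' by (simp add: algebra_simps)
  finally have "M / (L + 1) = (D - r * p) * d * c / L" using L by (simp add: field_simps)
  then show ?thesis unfolding M_def add_divide_distrib diff_divide_distrib by simp
qed

lemma narayana_weight_rec:
  assumes "1 \<le> p"
  shows "narayana_weight p (Suc r) (Suc D) l - narayana_weight p (Suc r) D l =
    narayana_weight p r (Suc D) l - narayana_weight p r D l +
    (if l = 0 then 0 else narayana_weight p r D (l - 1))"
proof (cases l)
  case 0
  then show ?thesis by (simp add: narayana_weight_def)
next
  case (Suc k)
  define y where "y = D + p - 1"
  define c d :: rat where "c = of_nat (y choose k)" and "d = of_nat (r choose k)"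
  define A C :: rat where "A = of_nat (y choose l)" and "C = of_nat (r choose l)"
  \<comment> \<open>Everything is expressed by the binomial coefficients \<open>c\<close>, \<open>d\<close> with lower index \<open>k\<close>.\<close>
  have bin: "of_nat (Suc k) * of_nat (N choose Suc k) = (of_nat N - of_nat k) * (of_nat (N choose k) :: rat)" for N
  proof (cases "k \<le> N")
    case True
    have "Suc k * (N choose Suc k) = (N - k) * (N choose k)"
      by (metis binomial_absorb_comp binomial_absorption)
    then have "of_nat (Suc k * (N choose Suc k)) = (of_nat ((N - k) * (N choose k)) :: rat)" by (rule arg_cong)
    then show ?thesis using True by (simp only: of_nat_mult of_nat_diff)
  next
    case False
    then show ?thesis by (simp add: binomial_eq_0)
  qed
  define L :: rat where "L = of_nat l"
  have L: "L \<noteq> 0" "L + 1 \<noteq> 0" "of_nat k = L - 1" "of_nat (Suc l) = L + 1"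
    unfolding L_def Suc by (simp_all del: of_nat_Suc add: of_nat_eq_0_iff flip: of_nat_Suc)
  have y: "of_nat y = of_nat D + of_nat p - (1 :: rat)" unfolding y_def using assms by (simp add: of_nat_diff)
  have A: "A = (of_nat D + of_nat p - L) * c / L" and C: "C = (of_nat r - L + 1) * d / L"
    using bin[of y] bin[of r] L unfolding A_def C_def c_def d_def Suc[symmetric] y L_def[symmetric]
    by (simp_all add: field_simps)
  define D' p' r' :: rat where "D' = of_nat D" and "p' = of_nat p" and "r' = of_nat r"
  have "Suc D + p - 1 = Suc y" using assms by (simp add: y_def)
  moreover have "Suc r choose l = (r choose l) + (r choose k)" "Suc y choose l = (y choose l) + (y choose k)"
    unfolding Suc by simp_all
  ultimately have
    "narayana_weight p (Suc r) (Suc D) l = (D' + 1 - (r' + 1) * p') * (C + d) * (A + c) / (L + 1)"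
    "narayana_weight p (Suc r) D l = (D' - (r' + 1) * p') * (C + d) * A / (L + 1)"
    "narayana_weight p r (Suc D) l = (D' + 1 - r' * p') * C * (A + c) / (L + 1)"
    "narayana_weight p r D l = (D' - r' * p') * C * A / (L + 1)"
    unfolding narayana_weight_def y_def[symmetric] A_def C_def c_def d_def D'_def p'_def r'_def L(4)
    by (simp_all add: algebra_simps)
  moreover have "(if l = 0 then 0 else narayana_weight p r D (l - 1)) = (D' - r' * p') * d * c / L"
    unfolding narayana_weight_def y_def[symmetric] c_def d_def D'_def p'_def r'_def L_def Suc by simp
  moreover have "A = (D' + p' - L) * c / L" "C = (r' - L + 1) * d / L"
    unfolding D'_def p'_def r'_def by (rule A, rule C)
  ultimately show ?thesis using narayana_rational_identity[OF L(1,2), of A D' p' c C r' d] by simp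
qed

text \<open>
  The closed form satisfies the same recursion in \<open>D\<close> and both sides vanish at \<open>D = r p\<close>.
\<close>

lemma coeff_tail_sum:
  assumes p: "1 \<le> p" and D: "r * p \<le> D"
  shows "of_int (coeff (tail_sum [:0, 1:] p r D) l) = narayana_weight p r D l"
  using D
proof (induction r arbitrary: D l)
  case 0
  have "tail_sum [:0, 1 :: int:] p 0 D = of_nat D" by (simp add: tail_sum_def)
  then show ?case by (cases l) (simp_all add: narayana_weight_def of_nat_poly)
next
  case (Suc r)
  let ?T = "\<lambda>r D. tail_sum [:0, 1 :: int:] p r D"
  have T: "?T r (Suc D) = ?T r D + tail_weight [:0, 1:] p r D" if "r * p \<le> D" for r D
    using that by (simp add: tail_sum_def)
  from Suc.prems show ?case
  proof (induction D arbitrary: l rule: dec_induct)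
    case base
    then show ?case by (simp add: tail_sum_def narayana_weight_def)
  next
    case (step D)
    have D: "r * p \<le> D" using step by simp
    have "?T (Suc r) (Suc D) - ?T (Suc r) D = tail_weight [:0, 1:] p (Suc r) D" using T step by simp
    also have "\<dots> = ?T r (Suc D) - ?T r D + [:0, 1:] * ?T r D" using T[OF D] by (simp add: tail_sum_def)
    finally have "coeff (?T (Suc r) (Suc D)) l =
        coeff (?T (Suc r) D) l + coeff (?T r (Suc D)) l - coeff (?T r D) l + (if l = 0 then 0 else coeff (?T r D) (l - 1))"
      by (cases l) (simp_all add: diff_eq_eq)
    then have "of_int (coeff (?T (Suc r) (Suc D)) l) =
        narayana_weight p (Suc r) D l + narayana_weight p r (Suc D) l - narayana_weight p r D l +
        (if l = 0 then 0 else narayana_weight p r D (l - 1))"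
      using step.IH Suc.IH[of "Suc D" l] Suc.IH[of D] D by (cases l) simp_all
    then show ?case using narayana_weight_rec[OF p, of r D l] by simp
  qed
qed

theorem G_poly_1:
  assumes v: "varpi n 1 p permutes {1..m}" and p: "1 \<le> p"
  shows "map_poly rat_of_int (G_poly m n 1 p) =
    (\<Sum>j = 1..n + 1. monom (1 / of_nat (n + 1) * of_nat ((n + 1) choose j) * of_nat (((n + 1) * p) choose (j - 1))) (j - 1))"
proof (rule poly_eqI)
  fix l
  have "G_poly m n 1 p = tail_weight [:0, 1:] p n (n * p)"
    unfolding G_poly_eq_groth[OF v] groth_varpi_1[OF v p] row_poly_at_1 by (simp add: one_pCons)
  also have "\<dots> = tail_sum [:0, 1:] p n (Suc (n * p))" by (simp add: tail_sum_def)
  finally have "coeff (map_poly rat_of_int (G_poly m n 1 p)) l = narayana_weight p n (Suc (n * p)) l"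
    using coeff_tail_sum[OF p, of n "Suc (n * p)" l] by (simp add: coeff_map_poly)
  also have "\<dots> = of_nat (n choose l) * of_nat (((n + 1) * p) choose l) / of_nat (Suc l)"
    by (simp add: narayana_weight_def add.commute)
  also have "of_nat (n choose l) / of_nat (Suc l) = (of_nat ((n + 1) choose Suc l) / of_nat (n + 1) :: rat)"
  proof -
    have "Suc l * (Suc n choose Suc l) = Suc n * (n choose l)" by (rule Suc_times_binomial)
    then have "rat_of_nat (Suc l) * of_nat (Suc n choose Suc l) = of_nat (Suc n) * of_nat (n choose l)"
      by (metis of_nat_mult)
    then show ?thesis by (simp add: divide_simps mult_ac del: binomial_Suc_Suc)
  qed
  then have "of_nat (n choose l) * of_nat (((n + 1) * p) choose l) / of_nat (Suc l) =
      (1 / of_nat (n + 1) * of_nat ((n + 1) choose Suc l) * of_nat (((n + 1) * p) choose l) :: rat)"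
    by (simp add: divide_simps mult_ac del: binomial_Suc_Suc)
  also have "\<dots> = coeff (\<Sum>j = 1..n + 1. monom (1 / of_nat (n + 1) * of_nat ((n + 1) choose j) * of_nat (((n + 1) * p) choose (j - 1))) (j - 1)) l"
  proof -
    let ?f = "\<lambda>j. 1 / of_nat (n + 1) * of_nat ((n + 1) choose j) * of_nat (((n + 1) * p) choose (j - 1)) :: rat"
    have "coeff (\<Sum>j = 1..n + 1. monom (?f j) (j - 1)) l = (\<Sum>j = 1..n + 1. if j = Suc l then ?f (Suc l) else 0)"
      unfolding coeff_sum by (intro sum.cong) auto
    also have "\<dots> = (if l \<le> n then ?f (Suc l) else 0)" by simp
    finally show ?thesis by (simp add: binomial_eq_0 del: binomial_Suc_Suc)
  qed
  finally show "coeff (map_poly rat_of_int (G_poly m n 1 p)) l =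
    coeff (\<Sum>j = 1..n + 1. monom (1 / of_nat (n + 1) * of_nat ((n + 1) choose j) * of_nat (((n + 1) * p) choose (j - 1))) (j - 1)) l" .
qed

section \<open>Flagged Jacobi-Trudi determinants\<close>

text \<open>
  The complete homogeneous polynomial of degree \<open>d\<close> in \<open>x\<^sub>1, \<dots>, x\<^sub>f\<close>, split according to whether the last
  variable occurs.
\<close>

fun hsym :: "(nat \<Rightarrow> 'r::comm_ring_1) \<Rightarrow> nat \<Rightarrow> nat \<Rightarrow> 'r" where
  "hsym x f 0 = 1"
| "hsym x 0 (Suc d) = 0"
| "hsym x (Suc f) (Suc d) = hsym x f (Suc d) + x (Suc f) * hsym x (Suc f) d"

lemma hsym_cong: "(\<And>j. 1 \<le> j \<Longrightarrow> j \<le> f \<Longrightarrow> x j = y j) \<Longrightarrow> hsym x f d = hsym y f d"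
  by (induction x f d rule: hsym.induct) auto

lemma hsym_adj_top: "hsym (x \<circ> adj (Suc f)) (Suc (Suc f)) d = hsym x (Suc (Suc f)) d"
proof (induction d rule: induct_nat_012)
  case (ge2 d)
  let ?y = "x \<circ> adj (Suc f)"
  \<comment> \<open>Removing the last two variables gives a recursion in the degree that is visibly symmetric in them.\<close>
  have rec: "hsym x (Suc (Suc f)) (Suc (Suc d)) = hsym x f (Suc (Suc d)) +
    (x (Suc f) + x (Suc (Suc f))) * hsym x (Suc (Suc f)) (Suc d)
     - x (Suc f) * x (Suc (Suc f)) * hsym x (Suc (Suc f)) d" for x :: "nat \<Rightarrow> 'a"
    by (simp add: algebra_simps)
  have "hsym ?y f (Suc (Suc d)) = hsym x f (Suc (Suc d))" by (rule hsym_cong) auto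
  then show ?case unfolding rec[of ?y] rec[of x] using ge2 by (simp add: comp_def add.commute mult.commute del: hsym.simps)
next
  case 1
  have "hsym (x \<circ> adj (Suc f)) f (Suc 0) = hsym x f (Suc 0)" by (rule hsym_cong) auto
  then show ?case by (simp add: comp_def)
qed simp

lemma hsym_adj:
  assumes "1 \<le> f" "F \<noteq> f"
  shows "hsym (x \<circ> adj f) F d = hsym x F d"
proof (cases "F < f")
  case True
  then show ?thesis by (intro hsym_cong) auto
next
  case False
  then have "Suc f \<le> F" using assms by simp
  then show ?thesis
  proof (induction F arbitrary: d rule: dec_induct)
    case base
    show ?case using hsym_adj_top[of x "f - 1" d] assms by (simp add: comp_def)
  next
    case (step F)
    show ?case
    proof (induction d)
      case (Suc d)
      then show ?case using step.IH[of "Suc d"] step(1) by simp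
    qed simp
  qed
qed

text \<open>
  Split off the variable in which the two polynomials differ and use induction on the degree. This is
  the rule by which a row of the determinant changes: one degree less, one variable more.
\<close>

lemma hsym_divided_difference:
  assumes "1 \<le> f"
  shows "hsym x f (Suc d) - hsym (x \<circ> adj f) f (Suc d) = (x f - x (Suc f)) * hsym x (Suc f) d"
proof -
  obtain g where f: "f = Suc g" using assms by (cases f) auto
  have low: "hsym (x \<circ> adj f) g e = hsym x g e" for e by (rule hsym_cong) (use f in auto)
  show ?thesis
  proof (induction d)
    case 0
    show ?case unfolding f using low[of "Suc 0"] by (simp add: f comp_def)
  next
    case (Suc d)
    have "hsym x f (Suc (Suc d)) - hsym (x \<circ> adj f) f (Suc (Suc d)) =
        x f * hsym x f (Suc d) - x (Suc f) * hsym (x \<circ> adj f) f (Suc d)"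
      using low[of "Suc (Suc d)"] by (simp add: f)
    also have "\<dots> = (x f - x (Suc f)) * hsym x f (Suc d) + x (Suc f) * (hsym x f (Suc d) - hsym (x \<circ> adj f) f (Suc d))"
      by (simp add: algebra_simps)
    also have "\<dots> = (x f - x (Suc f)) * hsym x (Suc f) (Suc d)" unfolding Suc by (simp add: algebra_simps)
    finally show ?case .
  qed
qed

lemma hsym_drop_first:
  "hsym x (Suc f) (Suc d) - x 1 * hsym x (Suc f) d = hsym (\<lambda>j. x (Suc j)) f (Suc d)"
proof (induction f arbitrary: d)
  case 0
  then show ?case by simp
next
  case (Suc f)
  show ?case
  proof (induction d)
    case 0
    have "hsym x (Suc f) (Suc 0) = x 1 + hsym (\<lambda>j. x (Suc j)) f (Suc 0)" using Suc.IH[of 0] by (simp add: algebra_simps)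
    then show ?case by simp
  next
    case (Suc d)
    have "hsym x (Suc (Suc f)) (Suc (Suc d)) - x 1 * hsym x (Suc (Suc f)) (Suc d) =
      (hsym x (Suc f) (Suc (Suc d)) - x 1 * hsym x (Suc f) (Suc d)) +
      x (Suc (Suc f)) * (hsym x (Suc (Suc f)) (Suc d) - x 1 * hsym x (Suc (Suc f)) d)"
      by (simp add: algebra_simps)
    then show ?case unfolding Suc Suc.IH \<open>\<And>d. hsym x (Suc f) (Suc d) - x 1 * hsym x (Suc f) d = hsym (\<lambda>j. x (Suc j)) f (Suc d)\<close> by simp
  qed
qed

lemma hsym_one: "hsym (\<lambda>_. 1 :: 'r::comm_ring_1) (Suc f) d = of_nat ((f + d) choose f)"
proof (induction f arbitrary: d)
  case 0
  show ?case by (induction d) simp_all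
next
  case (Suc f)
  show ?case
  proof (induction d)
    case (Suc d)
    then show ?case using \<open>\<And>d. hsym (\<lambda>_. 1) (Suc f) d = of_nat (f + d choose f)\<close>[of "Suc d"] by simp
  qed simp
qed

context comm_ring_hom
begin
lemma hom_hsym: "hom (hsym x f d) = hsym (\<lambda>i. hom (x i)) f d"
  by (induction x f d rule: hsym.induct) (auto simp: hom_add hom_mult)
end

text \<open>
  Rows and columns are counted from 1, and the degree is \<open>a - i + j\<close>. Negative degrees need the case
  distinction because subtraction on the natural numbers truncates.
\<close>

definition jt_entry :: "(nat \<Rightarrow> 'r::comm_ring_1) \<Rightarrow> nat \<Rightarrow> nat \<Rightarrow> nat \<Rightarrow> nat \<Rightarrow> 'r" where
  "jt_entry x a f i j = (if i \<le> a + j then hsym x f (a + j - i) else 0)"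

definition jt_mat :: "nat \<Rightarrow> (nat \<Rightarrow> 'r::comm_ring_1) \<Rightarrow> (nat \<Rightarrow> nat) \<Rightarrow> (nat \<Rightarrow> nat) \<Rightarrow> 'r mat" where
  "jt_mat N x a f = mat N N (\<lambda>(i, j). jt_entry x (a (Suc i)) (f (Suc i)) (Suc i) (Suc j))"

lemma jt_mat_carrier [simp]: "jt_mat N x a f \<in> carrier_mat N N"
  by (simp add: jt_mat_def)

lemma dim_jt_mat [simp]: "dim_row (jt_mat N x a f) = N" "dim_col (jt_mat N x a f) = N"
  by (simp_all add: jt_mat_def)

text \<open>
  The determinant is linear in each row.
\<close>

lemma det_row_difference:
  fixes A B C :: "'r::comm_ring_1 mat"
  assumes carr: "A \<in> carrier_mat N N" "B \<in> carrier_mat N N" "C \<in> carrier_mat N N" and r: "r < N"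
    and off: "\<And>i j. i < N \<Longrightarrow> j < N \<Longrightarrow> i \<noteq> r \<Longrightarrow> A $$ (i, j) = C $$ (i, j) \<and> B $$ (i, j) = C $$ (i, j)"
    and row: "\<And>j. j < N \<Longrightarrow> A $$ (r, j) - B $$ (r, j) = c * C $$ (r, j)"
  shows "det A - det B = c * det C"
proof -
  have cof: "cofactor A r j = cofactor C r j" "cofactor B r j = cofactor C r j" if "j < N" for j
  proof -
    have "mat_delete A r j = mat_delete C r j" "mat_delete B r j = mat_delete C r j"
      using carr that r off by (auto intro!: eq_matI simp: mat_delete_def)
    then show "cofactor A r j = cofactor C r j" "cofactor B r j = cofactor C r j" by (simp_all add: cofactor_def)
  qed
  have "det A - det B = (\<Sum>j<N. (A $$ (r, j) - B $$ (r, j)) * cofactor C r j)"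
    unfolding laplace_expansion_row[OF carr(1) r] laplace_expansion_row[OF carr(2) r]
    by (simp add: cof left_diff_distrib sum_subtractf)
  also have "\<dots> = c * det C"
    unfolding laplace_expansion_row[OF carr(3) r] sum_distrib_left
    by (rule sum.cong) (auto simp: row mult.assoc)
  finally show ?thesis .
qed

text \<open>
  Column operations strip the variable \<open>x\<^sub>1\<close> off all columns but the first; expanding along the first
  row leaves the same determinant for \<open>x\<^sub>2, \<dots>, x\<^sub>N\<close>.
\<close>

lemma det_jt_mat_dominant:
  "det (jt_mat N x a (\<lambda>i. i)) = (\<Prod>i=1..N. x i ^ a i)"
proof (induction N arbitrary: x a)
  case 0
  show ?case by (simp add: jt_mat_def)
next
  case (Suc N)
  let ?A = "jt_mat (Suc N) x a (\<lambda>i. i)"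
  \<comment> \<open>Multiplication by \<open>?U\<close> subtracts \<open>x\<^sub>1\<close> times each column from the next one. This removes the
    variable \<open>x\<^sub>1\<close> from all columns but the first, and clears the first row there.\<close>
  let ?U = "mat (Suc N) (Suc N) (\<lambda>(i, j). if i = j then 1 else if Suc i = j then - x 1 else 0)"
  define B where "B = mat (Suc N) (Suc N) (\<lambda>(i, j). if j = 0 then ?A $$ (i, 0) else ?A $$ (i, j) - x 1 * ?A $$ (i, j - 1))"
  have U: "?U \<in> carrier_mat (Suc N) (Suc N)" and B: "B \<in> carrier_mat (Suc N) (Suc N)" by (simp_all add: B_def)
  then have dimB: "dim_row B = Suc N" "dim_col B = Suc N" by simp_all
  have "?A * ?U = B"
  proof (rule eq_matI)
    fix i j assume "i < dim_row B" "j < dim_col B"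
    then have ij: "i < Suc N" "j < Suc N" by (simp_all add: dimB)
    have "(?A * ?U) $$ (i, j) = (\<Sum>l = 0..<Suc N. ?A $$ (i, l) * ?U $$ (l, j))"
      using ij by (simp add: scalar_prod_def del: sum.op_ivl_Suc)
    also have "\<dots> = (\<Sum>l = 0..<Suc N. (if l = j then ?A $$ (i, j) else 0) - (if Suc l = j then x 1 * ?A $$ (i, j - 1) else 0))"
      by (rule sum.cong) (use ij in auto)
    also have "\<dots> = ?A $$ (i, j) - (if j = 0 then 0 else x 1 * ?A $$ (i, j - 1))"
    proof (cases j)
      case 0
      then show ?thesis by (simp add: sum_subtractf)
    next
      case (Suc j')
      then show ?thesis using ij by (simp add: sum_subtractf)
    qed
    also have "\<dots> = B $$ (i, j)" using ij by (simp add: B_def)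
    finally show "(?A * ?U) $$ (i, j) = B $$ (i, j)" .
  qed (simp_all add: dimB)
  moreover have "det ?U = 1"
  proof -
    have "upper_triangular ?U" by (auto simp: upper_triangular_def)
    from det_upper_triangular[OF this U] have "det ?U = prod_list (diag_mat ?U)" .
    moreover have "diag_mat ?U = map (\<lambda>_. 1) [0..<Suc N]"
      unfolding diag_mat_def by (rule map_cong) (auto simp del: upt_Suc)
    ultimately show ?thesis by (simp add: map_replicate_const del: upt_Suc)
  qed
  ultimately have AB: "det ?A = det B" using det_mult[OF jt_mat_carrier U, of x a "\<lambda>i. i"] by simp
  have A: "?A $$ (i, j) = jt_entry x (a (Suc i)) (Suc i) (Suc i) (Suc j)" if "i < Suc N" "j < Suc N" for i j
    using that by (simp add: jt_mat_def)
  have shift: "B $$ (i, Suc j) = (if i = 0 then 0 else jt_entry (\<lambda>j. x (Suc j)) (a (Suc i)) i i (Suc j))"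
    if "i < Suc N" "j < N" for i j
  proof -
    have "B $$ (i, Suc j) = jt_entry x (a (Suc i)) (Suc i) (Suc i) (Suc (Suc j)) - x 1 * jt_entry x (a (Suc i)) (Suc i) (Suc i) (Suc j)"
      using that by (simp add: A B_def)
    also have "\<dots> = jt_entry (\<lambda>j. x (Suc j)) (a (Suc i)) i i (Suc j)"
    proof -
      consider "i \<le> a (Suc i) + j" | "i = Suc (a (Suc i) + j)" | "Suc (a (Suc i) + j) < i" by linarith
      then show ?thesis
      proof cases
        case 1
        then have "a (Suc i) + Suc (Suc j) - Suc i = Suc (a (Suc i) + j - i)" "a (Suc i) + Suc j - Suc i = a (Suc i) + j - i"
          "a (Suc i) + Suc j - i = Suc (a (Suc i) + j - i)" by simp_all
        then show ?thesis unfolding jt_entry_def using 1 hsym_drop_first[of x i "a (Suc i) + j - i"] by simp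
      qed (simp_all add: jt_entry_def)
    qed
    finally show ?thesis by (simp add: jt_entry_def)
  qed
  have "det B = (\<Sum>j<Suc N. B $$ (0, j) * cofactor B 0 j)" by (rule laplace_expansion_row[OF B]) simp
  also have "\<dots> = B $$ (0, 0) * cofactor B 0 0"
    by (subst sum.lessThan_Suc_shift) (simp add: shift[of 0, simplified])
  also have "B $$ (0, 0) = x 1 ^ a 1"
  proof -
    have "hsym x (Suc 0) d = x 1 ^ d" for d by (induction d) simp_all
    then show ?thesis by (simp add: A B_def jt_entry_def)
  qed
  also have "cofactor B 0 0 = det (mat_delete B 0 0)" by (simp add: cofactor_def)
  also have "mat_delete B 0 0 = jt_mat N (\<lambda>j. x (Suc j)) (\<lambda>i. a (Suc i)) (\<lambda>i. i)"
  proof (rule eq_matI)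
    fix i j assume "i < dim_row (jt_mat N (\<lambda>j. x (Suc j)) (\<lambda>i. a (Suc i)) (\<lambda>i. i))"
      "j < dim_col (jt_mat N (\<lambda>j. x (Suc j)) (\<lambda>i. a (Suc i)) (\<lambda>i. i))"
    then have ij: "i < N" "j < N" by (simp_all add: jt_mat_def)
    then have "mat_delete B 0 0 $$ (i, j) = B $$ (Suc i, Suc j)" by (simp add: mat_delete_def dimB)
    then show "mat_delete B 0 0 $$ (i, j) = jt_mat N (\<lambda>j. x (Suc j)) (\<lambda>i. a (Suc i)) (\<lambda>i. i) $$ (i, j)"
      using shift[of "Suc i" j] ij by (simp add: jt_mat_def)
  qed (simp_all add: mat_delete_def dimB)
  finally have detB: "det B = x 1 ^ a 1 * det (jt_mat N (\<lambda>j. x (Suc j)) (\<lambda>i. a (Suc i)) (\<lambda>i. i))" .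
  have split_first: "x 1 ^ a 1 * (\<Prod>i=1..N. x (Suc i) ^ a (Suc i)) = (\<Prod>i=1..Suc N. x i ^ a i)"
    by (induction N) (simp_all add: mult.assoc[symmetric])
  then have "x 1 ^ a 1 * det (jt_mat N (\<lambda>j. x (Suc j)) (\<lambda>i. a (Suc i)) (\<lambda>i. i)) = (\<Prod>i=1..Suc N. x i ^ a i)"
    unfolding Suc.IH by (simp only: split_first)
  then show ?case using AB detB by simp
qed

text \<open>
  Rows whose flag differs from \<open>f\<^sub>r\<close> are symmetric in the two variables concerned, so the divided
  difference acts on row \<open>r\<close> alone.
\<close>

lemma det_jt_mat_divided_difference:
  assumes r: "1 \<le> r" "r \<le> N" and f: "1 \<le> f r" and a: "1 \<le> a r"
    and sym: "\<And>i. 1 \<le> i \<Longrightarrow> i \<le> N \<Longrightarrow> i \<noteq> r \<Longrightarrow> f i \<noteq> f r"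
  shows "det (jt_mat N x a f) - det (jt_mat N (x \<circ> adj (f r)) a f) =
    (x (f r) - x (Suc (f r))) * det (jt_mat N x (a(r := a r - 1)) (f(r := Suc (f r))))"
proof (rule det_row_difference[of _ N _ _ "r - 1"])
  let ?y = "x \<circ> adj (f r)"
  fix i j assume ij: "i < N" "j < N" "i \<noteq> r - 1"
  then have "Suc i \<noteq> r" by auto
  then show "jt_mat N x a f $$ (i, j) = jt_mat N x (a(r := a r - 1)) (f(r := Suc (f r))) $$ (i, j) \<and>
      jt_mat N ?y a f $$ (i, j) = jt_mat N x (a(r := a r - 1)) (f(r := Suc (f r))) $$ (i, j)"
    using ij sym[of "Suc i"] by (simp add: jt_mat_def jt_entry_def hsym_adj[OF f])
next
  let ?y = "x \<circ> adj (f r)"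
  fix j assume j: "j < N"
  have "jt_entry x (a r) (f r) r (Suc j) - jt_entry ?y (a r) (f r) r (Suc j) =
    (x (f r) - x (Suc (f r))) * jt_entry x (a r - 1) (Suc (f r)) r (Suc j)"
  proof (cases "r \<le> a r - 1 + Suc j")
    case True
    then have "a r + Suc j - r = Suc (a r - 1 + Suc j - r)" "r \<le> a r + Suc j" using a by simp_all
    then show ?thesis unfolding jt_entry_def using True hsym_divided_difference[OF f, of x "a r - 1 + Suc j - r"] by simp
  next
    case False
    then show ?thesis using a by (auto simp: jt_entry_def)
  qed
  then show "jt_mat N x a f $$ (r - 1, j) - jt_mat N ?y a f $$ (r - 1, j) =
    (x (f r) - x (Suc (f r))) * jt_mat N x (a(r := a r - 1)) (f(r := Suc (f r))) $$ (r - 1, j)"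
    using r j by (simp add: jt_mat_def)
qed (use r in auto)

section \<open>The top coefficient in \<open>\<beta>\<close>\<close>

text \<open>
  The parameter \<open>\<beta> - 1\<close> with variables that do not involve \<open>\<beta>\<close>.
\<close>

definition groth_shifted :: "nat \<Rightarrow> (nat \<Rightarrow> 'r::comm_ring_1) \<Rightarrow> (nat \<Rightarrow> nat) \<Rightarrow> 'r poly" where
  "groth_shifted m x w = groth m [:-1, 1:] (\<lambda>i. [:x i:]) w"

text \<open>
  Since \<open>1 + (\<beta> - 1) y\<close> is linear in \<open>\<beta>\<close> with coefficient \<open>y\<close> at \<open>\<beta>\<close>, a divided difference
  raises the degree by at most one, and its effect on top coefficients is
  \<open>g \<mapsto> (x\<^sub>i\<^sub>+\<^sub>1 g - x\<^sub>i s\<^sub>i g) / (x\<^sub>i - x\<^sub>i\<^sub>+\<^sub>1)\<close>.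
\<close>

lemma groth_shifted_step:
  fixes x :: "nat \<Rightarrow> 'r::idom"
  assumes c: "has_code m a w" and i: "1 \<le> i" "i < m" and le: "a i \<le> a (Suc i)"
    and inj: "inj_on x {1..m}"
    and deg: "degree (groth_shifted m x (w \<circ> adj i)) \<le> d" "degree (groth_shifted m (x \<circ> adj i) (w \<circ> adj i)) \<le> d"
  shows "degree (groth_shifted m x w) \<le> Suc d"
    and "(x i - x (Suc i)) * coeff (groth_shifted m x w) (Suc d) =
      x (Suc i) * coeff (groth_shifted m x (w \<circ> adj i)) d - x i * coeff (groth_shifted m (x \<circ> adj i) (w \<circ> adj i)) d"
proof -
  let ?u = "w \<circ> adj i"
  have lin: "1 + [:-1, 1:] * [:y:] = [:1 - y, y:]" for y :: 'r by (simp add: one_pCons)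
  have ne: "x i - x (Suc i) \<noteq> 0" using inj_onD[OF inj, of i "Suc i"] i by auto
  have "(\<lambda>j. [:x j:]) \<circ> adj i = (\<lambda>j. [:(x \<circ> adj i) j:])" by (simp add: fun_eq_iff)
  then have eq: "smult (x i - x (Suc i)) (groth_shifted m x w) =
      [:1 - x (Suc i), x (Suc i):] * groth_shifted m x ?u - [:1 - x i, x i:] * groth_shifted m (x \<circ> adj i) ?u"
    using groth_divided_difference_code[OF c i le, of "\<lambda>j. [:x j:]" "[:-1, 1:]"]
    unfolding groth_shifted_def lin by simp
  have deg1: "degree ([:p, q:] * g) \<le> Suc d" if "degree g \<le> d" for p q and g :: "'r poly"
    using degree_mult_le[of "[:p, q:]" g] degree_pCons_le[of p "[:q:]"] that by simp
  have "degree (smult (x i - x (Suc i)) (groth_shifted m x w)) \<le> Suc d"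
    unfolding eq by (intro degree_diff_le deg1 deg)
  then show "degree (groth_shifted m x w) \<le> Suc d" using ne by simp
  have co: "coeff ([:p, q:] * g) (Suc d) = q * coeff g d" if "degree g \<le> d" for p q and g :: "'r poly"
    using that by (simp add: coeff_eq_0)
  show "(x i - x (Suc i)) * coeff (groth_shifted m x w) (Suc d) =
      x (Suc i) * coeff (groth_shifted m x ?u) d - x i * coeff (groth_shifted m (x \<circ> adj i) ?u) d"
    using arg_cong[OF eq, of "\<lambda>q. coeff q (Suc d)"] by (simp only: coeff_smult coeff_diff co[OF deg(1)] co[OF deg(2)])
qed

lemma prod_const_poly: "(\<Prod>j\<in>A. [:f j:]) = [:\<Prod>j\<in>A. f j:]"
  by (induction A rule: infinite_finite_induct) (simp_all add: one_pCons mult.commute)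

text \<open>
  The stages of the transformation of the dominant code \<open>((n + 1 - t) p + k)\<^sub>t\<close> into the code of \<open>\<varpi>\<close>: the
  rows after \<open>r\<close> have been moved \<open>k\<close> places to the right, row \<open>r\<close> has been moved \<open>s\<close> places and has lost
  \<open>s\<close> boxes, and the rows before \<open>r\<close> are in their original places.
\<close>

definition stage_code :: "nat \<Rightarrow> nat \<Rightarrow> nat \<Rightarrow> nat \<Rightarrow> nat \<Rightarrow> nat \<Rightarrow> nat" where
  "stage_code n k p r s t =
     (if t < r then (n + 1 - t) * p + k else if t < r + s then 0
      else if t = r + s then (n + 1 - r) * p + (k - s)
      else if r + k < t \<and> t \<le> n + k then (n + 1 - (t - k)) * p else 0)"

text \<open>
  The exponents of the monomial that splits off from the top coefficient. On top coefficients each step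
  is \<open>x\<^sub>f x\<^sub>f\<^sub>+\<^sub>1 \<partial>\<^sub>f x\<^sub>f\<^bsup>-1\<^esup>\<close> with the ordinary divided difference \<open>\<partial>\<^sub>f\<close>, so it raises the exponent of \<open>x\<^sub>f\<^sub>+\<^sub>1\<close>
  by one and otherwise acts on the remaining factor by \<open>\<partial>\<^sub>f\<close>.
\<close>

definition stage_exp :: "nat \<Rightarrow> nat \<Rightarrow> nat \<Rightarrow> nat \<Rightarrow> nat \<Rightarrow> nat" where
  "stage_exp n k r s t = (if t < r then n + 1 - t else if t \<le> r + s then n + 1 - r
     else if t \<le> r + k then n - r else n + 1 + k - t)"

text \<open>
  The row lengths left over after splitting off the monomial. Row \<open>i\<close> gives up one box for itself
  and one for each later row, which turns \<open>(n + 1 - i) p\<close> into \<open>(n + 1 - i) (p - 1)\<close>.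
\<close>

definition stage_part :: "nat \<Rightarrow> nat \<Rightarrow> nat \<Rightarrow> nat \<Rightarrow> nat \<Rightarrow> nat \<Rightarrow> nat" where
  "stage_part n k p r s i = (n + 1 - i) * (p - 1) + (if i < r then k else if i = r then k - s else 0)"

definition stage_flag :: "nat \<Rightarrow> nat \<Rightarrow> nat \<Rightarrow> nat \<Rightarrow> nat" where
  "stage_flag k r s i = (if i < r then i else if i = r then r + s else k + i)"

text \<open>
  The determinant has an additional last row, of length 0. It is a unit vector whatever its flag is.
\<close>

definition stage_top :: "nat \<Rightarrow> nat \<Rightarrow> nat \<Rightarrow> nat \<Rightarrow> nat \<Rightarrow> nat \<Rightarrow> (nat \<Rightarrow> 'r::comm_ring_1) \<Rightarrow> 'r" where
  "stage_top m n k p r s x = (\<Prod>t=1..m. x t ^ stage_exp n k r s t) *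
     det (jt_mat (n + 1) x (stage_part n k p r s) (stage_flag k r s))"

lemma stage_top_step:
  fixes x :: "nat \<Rightarrow> 'r::comm_ring_1"
  assumes r: "1 \<le> r" "r \<le> n" and s: "s < k" and m: "r + s < m"
  shows "x (Suc (r + s)) * stage_top m n k p r s x - x (r + s) * stage_top m n k p r s (x \<circ> adj (r + s)) =
    (x (r + s) - x (Suc (r + s))) * stage_top m n k p r (Suc s) x"
proof -
  let ?f = "r + s"
  let ?y = "x \<circ> adj ?f"
  let ?D = "\<lambda>x. det (jt_mat (n + 1) x (stage_part n k p r s) (stage_flag k r s))"
  let ?D' = "det (jt_mat (n + 1) x (stage_part n k p r (Suc s)) (stage_flag k r (Suc s)))"
  have fl: "stage_flag k r s r = ?f" by (simp add: stage_flag_def)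
  have sym: "stage_flag k r s i \<noteq> stage_flag k r s r" if "1 \<le> i" "i \<noteq> r" for i
    using that s by (auto simp: stage_flag_def)
  have "(stage_part n k p r s)(r := stage_part n k p r s r - 1) = stage_part n k p r (Suc s)"
    "(stage_flag k r s)(r := Suc (stage_flag k r s r)) = stage_flag k r (Suc s)"
    using s by (auto simp: stage_part_def stage_flag_def fun_eq_iff)
  then have det: "?D x - ?D ?y = (x ?f - x (Suc ?f)) * ?D'"
    using det_jt_mat_divided_difference[of r "n + 1" "stage_flag k r s" "stage_part n k p r s" x, OF r(1)] r s sym
    unfolding fl by (simp add: stage_part_def)
  define R where "R = (\<Prod>t\<in>{1..m} - {?f, Suc ?f}. x t ^ stage_exp n k r s t)"
  have f: "1 \<le> ?f" using r by simp
  have e: "stage_exp n k r s ?f = Suc (n - r)" "stage_exp n k r s (Suc ?f) = n - r"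
    "stage_exp n k r (Suc s) ?f = Suc (n - r)" "stage_exp n k r (Suc s) (Suc ?f) = Suc (n - r)"
    "t \<noteq> Suc ?f \<Longrightarrow> stage_exp n k r (Suc s) t = stage_exp n k r s t" for t
    using r s by (auto simp: stage_exp_def)
  \<comment> \<open>The exponents of \<open>x\<^sub>f\<close> and \<open>x\<^sub>f\<^sub>+\<^sub>1\<close> differ by exactly one, so that multiplying by the other
    variable makes the monomial symmetric.\<close>
  have M: "(\<Prod>t=1..m. x t ^ stage_exp n k r s t) = x ?f ^ Suc (n - r) * x (Suc ?f) ^ (n - r) * R"
    unfolding prod_split_adjacent[OF f m] e R_def ..
  have R2: "(\<Prod>t\<in>{1..m} - {?f, Suc ?f}. ?y t ^ stage_exp n k r s t) = R"
    "(\<Prod>t\<in>{1..m} - {?f, Suc ?f}. x t ^ stage_exp n k r (Suc s) t) = R"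
    unfolding R_def by (auto intro!: prod.cong simp: e)
  have My: "(\<Prod>t=1..m. ?y t ^ stage_exp n k r s t) = x (Suc ?f) ^ Suc (n - r) * x ?f ^ (n - r) * R"
    unfolding prod_split_adjacent[OF f m] e R2 by simp
  have M': "(\<Prod>t=1..m. x t ^ stage_exp n k r (Suc s) t) = x ?f ^ Suc (n - r) * x (Suc ?f) ^ Suc (n - r) * R"
    unfolding prod_split_adjacent[OF f m] e R2 ..
  have "x (Suc ?f) * stage_top m n k p r s x - x ?f * stage_top m n k p r s ?y =
      x ?f ^ Suc (n - r) * x (Suc ?f) ^ Suc (n - r) * R * (?D x - ?D ?y)"
    unfolding stage_top_def M My by (simp add: algebra_simps)
  also have "\<dots> = (x ?f - x (Suc ?f)) * stage_top m n k p r (Suc s) x"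
    unfolding det stage_top_def M' by (simp add: algebra_simps)
  finally show ?thesis .
qed

text \<open>
  Finishing row \<open>r + 1\<close> is the same as having not yet started row \<open>r\<close>.
\<close>

lemma stage_boundary:
  assumes "1 \<le> r" "r < n" "1 \<le> p"
  shows "stage_code n k p r 0 t = stage_code n k p (Suc r) k t"
    and "stage_exp n k r 0 t = stage_exp n k (Suc r) k t"
    and "stage_part n k p r 0 i = stage_part n k p (Suc r) k i"
    and "stage_flag k r 0 i = stage_flag k (Suc r) k i"
  using assms by (auto simp: stage_code_def stage_exp_def stage_part_def stage_flag_def)

lemma stage_top_boundary:
  assumes "1 \<le> r" "r < n" "1 \<le> p"
  shows "stage_top m n k p r 0 x = stage_top m n k p (Suc r) k x"
proof -
  have "stage_exp n k r 0 = stage_exp n k (Suc r) k" "stage_part n k p r 0 = stage_part n k p (Suc r) k"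
    "stage_flag k r 0 = stage_flag k (Suc r) k"
    using stage_boundary[OF assms] by (auto simp: fun_eq_iff)
  then show ?thesis by (simp add: stage_top_def)
qed

lemma stage_top_start:
  assumes "1 \<le> n" "1 \<le> p" "n \<le> m"
  shows "stage_top m n k p n 0 x = (\<Prod>t=1..m. x t ^ stage_code n k p n 0 t)"
proof -
  have "jt_mat (n + 1) x (stage_part n k p n 0) (stage_flag k n 0) = jt_mat (n + 1) x (stage_part n k p n 0) (\<lambda>i. i)"
    by (rule eq_matI) (auto simp: jt_mat_def jt_entry_def stage_flag_def stage_part_def less_Suc_eq)
  then have "det (jt_mat (n + 1) x (stage_part n k p n 0) (stage_flag k n 0)) = (\<Prod>t=1..n+1. x t ^ stage_part n k p n 0 t)"
    by (simp add: det_jt_mat_dominant)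
  also have "\<dots> = (\<Prod>t=1..n. x t ^ stage_part n k p n 0 t)" by (simp add: stage_part_def)
  also have "\<dots> = (\<Prod>t=1..m. x t ^ (if t \<le> n then stage_part n k p n 0 t else 0))"
    by (rule prod.mono_neutral_cong_left) (use assms in auto)
  finally have D: "det (jt_mat (n + 1) x (stage_part n k p n 0) (stage_flag k n 0)) = \<dots>" .
  have "stage_exp n k n 0 t + (if t \<le> n then stage_part n k p n 0 t else 0) = stage_code n k p n 0 t" if "1 \<le> t" for t
  proof (cases "t \<le> n")
    case True
    have "(n + 1 - t) * p = (n + 1 - t) + (n + 1 - t) * (p - 1)" using assms(2) by (cases p) auto
    moreover have "stage_exp n k n 0 t = n + 1 - t" "stage_part n k p n 0 t = (n + 1 - t) * (p - 1) + k"
      "stage_code n k p n 0 t = (n + 1 - t) * p + k"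
      using True by (auto simp: stage_exp_def stage_part_def stage_code_def)
    ultimately show ?thesis using True by (simp only: if_True add.assoc)
  next
    case False
    then show ?thesis by (auto simp: stage_exp_def stage_part_def stage_code_def)
  qed
  then show ?thesis unfolding stage_top_def D prod.distrib[symmetric] power_add[symmetric]
    by (intro prod.cong) auto
qed

lemma stage_code_lower:
  assumes "1 \<le> r" "r \<le> n" "s < k" "1 \<le> p" and c: "has_code m (stage_code n k p r (Suc s)) w"
  shows "r + s < m" "has_code m (stage_code n k p r s) (w \<circ> adj (r + s))"
    "stage_code n k p r (Suc s) (r + s) \<le> stage_code n k p r (Suc s) (Suc (r + s))"
proof -
  have v: "stage_code n k p r (Suc s) (r + s) = 0"
    "stage_code n k p r (Suc s) (Suc (r + s)) = (n + 1 - r) * p + (k - Suc s)"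
    by (simp_all add: stage_code_def)
  have "0 < (n + 1 - r) * p" using assms by simp
  also have "\<dots> \<le> m - Suc (r + s)" using has_codeD(3)[OF c, of "Suc (r + s)"] v by simp
  finally show m: "r + s < m" by simp
  show le: "stage_code n k p r (Suc s) (r + s) \<le> stage_code n k p r (Suc s) (Suc (r + s))" unfolding v by simp
  show "has_code m (stage_code n k p r s) (w \<circ> adj (r + s))"
    by (rule has_code_cong[OF has_code_raise(1)[OF c _ m le]])
       (use assms in \<open>auto simp: stage_code_def\<close>)
qed

text \<open>
  Induction along the stages, from the last row to the first one and within a row along its steps. Each
  of the \<open>(n - r) k + s\<close> steps adds one to the degree bound.
\<close>

lemma groth_shifted_stage:
  fixes x :: "nat \<Rightarrow> 'r::idom"
  assumes p: "1 \<le> p" and r: "1 \<le> r" "r \<le> n"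
  shows "s \<le> k \<Longrightarrow> has_code m (stage_code n k p r s) w \<Longrightarrow> inj_on x {1..m} \<Longrightarrow>
    degree (groth_shifted m x w) \<le> (n - r) * k + s \<and>
    coeff (groth_shifted m x w) ((n - r) * k + s) = stage_top m n k p r s x"
  using r(2,1)
proof (induction r arbitrary: s w x rule: inc_induct)
  have row: "degree (groth_shifted m x w) \<le> (n - r) * k + s \<and>
      coeff (groth_shifted m x w) ((n - r) * k + s) = stage_top m n k p r s x"
    if start: "\<And>w (x :: nat \<Rightarrow> 'r). has_code m (stage_code n k p r 0) w \<Longrightarrow> inj_on x {1..m} \<Longrightarrow>
        degree (groth_shifted m x w) \<le> (n - r) * k + 0 \<and>
        coeff (groth_shifted m x w) ((n - r) * k + 0) = stage_top m n k p r 0 x"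
      and r: "1 \<le> r" "r \<le> n" and "s \<le> k" "has_code m (stage_code n k p r s) w" "inj_on x {1..m}"
    for r s w and x :: "nat \<Rightarrow> 'r"
    using that(4-)
  proof (induction s arbitrary: w x)
    case 0
    then show ?case using start by simp
  next
    case (Suc s)
    have sk: "s < k" using Suc.prems by simp
    note low = stage_code_lower[OF r sk p Suc.prems(2)]
    let ?f = "r + s" and ?d = "(n - r) * k + s"
    have f1: "1 \<le> ?f" using r by simp
    have "adj ?f ` {1..m} = {1..m}" by (rule permutes_image[OF permutes_swap_id]) (use low(1) f1 in auto)
    then have inj: "inj_on (x \<circ> adj ?f) {1..m}" using Suc.prems(3) by (intro comp_inj_on) auto
    have IH: "degree (groth_shifted m y (w \<circ> adj ?f)) \<le> ?d" "coeff (groth_shifted m y (w \<circ> adj ?f)) ?d = stage_top m n k p r s y"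
      if "inj_on y {1..m}" for y :: "nat \<Rightarrow> 'r"
      using Suc.IH[OF less_imp_le[OF sk] low(2) that] by blast+
    note step = groth_shifted_step[OF Suc.prems(2) f1 low(1,3) Suc.prems(3) IH(1)[OF Suc.prems(3)] IH(1)[OF inj]]
    have "(x ?f - x (Suc ?f)) * coeff (groth_shifted m x w) (Suc ?d) = (x ?f - x (Suc ?f)) * stage_top m n k p r (Suc s) x"
      unfolding step(2) IH(2)[OF Suc.prems(3)] IH(2)[OF inj] by (rule stage_top_step[OF r sk low(1)])
    moreover have "x ?f - x (Suc ?f) \<noteq> 0" using inj_onD[OF Suc.prems(3), of ?f "Suc ?f"] low(1) f1 by auto
    ultimately have "coeff (groth_shifted m x w) (Suc ?d) = stage_top m n k p r (Suc s) x" by simp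
    then show ?case using step(1) by simp
  qed
  {
    case base
    show ?case
    proof (rule row[OF _ _ _ base.prems(1,2,3)])
      fix w and x :: "nat \<Rightarrow> 'r" assume c: "has_code m (stage_code n k p n 0) w" and x: "inj_on x {1..m}"
      have "n \<le> m"
      proof -
        have "0 < p" using p by simp
        also have "p \<le> m - n" using has_codeD(3)[OF c, of n] base.prems by (simp add: stage_code_def)
        finally show ?thesis by simp
      qed
      have code: "stage_code n k p n 0 t = (if t \<le> n then (n + 1 - t) * p + k else 0)" for t
        by (simp add: stage_code_def)
      have "(n + 1 - Suc i) * p \<le> (n + 1 - i) * p" for i by (rule mult_le_mono1) simp
      then have "stage_code n k p n 0 (Suc i) \<le> stage_code n k p n 0 i" if "1 \<le> i" for i
        unfolding code by simp
      moreover have "inj_on (\<lambda>i. [:x i:]) {1..m}"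
      proof (rule inj_onI)
        fix i j assume "i \<in> {1..m}" "j \<in> {1..m}" "[:x i:] = [:x j:]"
        then show "i = j" using inj_onD[OF x, of i j] by simp
      qed
      ultimately have "groth_shifted m x w = (\<Prod>t=1..m. [:x t:] ^ stage_code n k p n 0 t)"
        unfolding groth_shifted_def by (rule groth_dominant_inj[OF c])
      also have "\<dots> = [:stage_top m n k p n 0 x:]"
        unfolding stage_top_start[OF base.prems(4) p \<open>n \<le> m\<close>] poly_const_pow prod_const_poly ..
      finally have "groth_shifted m x w = [:stage_top m n k p n 0 x:]" .
      then show "degree (groth_shifted m x w) \<le> (n - n) * k + 0 \<and>
        coeff (groth_shifted m x w) ((n - n) * k + 0) = stage_top m n k p n 0 x" by simp
    qed (use base in auto)
  next
    case (step r)
    show ?case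
    proof (rule row[OF _ _ _ step.prems(1,2,3)])
      fix w and x :: "nat \<Rightarrow> 'r" assume c: "has_code m (stage_code n k p r 0) w" and x: "inj_on x {1..m}"
      have c': "has_code m (stage_code n k p (Suc r) k) w"
        by (rule has_code_cong[OF c]) (use stage_boundary(1)[of r n p k] step p in simp)
      have "(n - Suc r) * k + k = (n - r) * k + 0" using step(2) by (metis Suc_diff_Suc add.commute add_0_right mult_Suc)
      then show "degree (groth_shifted m x w) \<le> (n - r) * k + 0 \<and>
        coeff (groth_shifted m x w) ((n - r) * k + 0) = stage_top m n k p r 0 x"
        using step.IH[OF _ c' x] stage_top_boundary[of r n p m k x] step p by simp
    qed (use step in auto)
  }
qed

lemma (in comm_ring_hom) comm_ring_hom_map_poly: "comm_ring_hom (map_poly hom)"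
proof
  fix p q :: "'a poly"
  show "map_poly hom (p + q) = map_poly hom p + map_poly hom q"
    by (rule poly_eqI) (simp add: coeff_map_poly hom_add)
  show "map_poly hom (p * q) = map_poly hom p * map_poly hom q"
    by (rule poly_eqI) (simp add: coeff_map_poly coeff_mult hom_mult hom_sum)
qed simp_all

text \<open>
  At the last stage all rows have flag \<open>k + i\<close>, the monomial becomes 1, and a complete homogeneous
  polynomial at ones is a binomial coefficient.
\<close>

lemma coeff_G_poly_top:
  assumes p: "1 \<le> p" and n: "1 \<le> n" and v: "varpi n k p permutes {1..m}"
  shows "degree (G_poly m n k p) \<le> n * k"
    and "coeff (G_poly m n k p) (n * k) = det (binom_matrix n k p)"
proof -
  let ?w = "varpi n k p"
  let ?ev = "\<lambda>q :: int poly. poly q 0"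
  \<comment> \<open>The distinct variables \<open>1 + i t\<close> become 1 at \<open>t = 0\<close>.\<close>
  let ?x = "\<lambda>i. [:1, int i:]"
  interpret ev: comm_ring_hom ?ev by (rule comm_ring_hom_poly_eval)
  interpret mev: comm_ring_hom "map_poly ?ev" by (rule ev.comm_ring_hom_map_poly)
  have c: "has_code m (stage_code n k p 1 k) ?w"
    by (rule has_code_cong[OF has_code_varpi[OF v]]) (auto simp: rows_code_def stage_code_def)
  have inj: "inj_on ?x {1..m}" by (auto intro: inj_onI)
  have "map_poly ?ev (groth_shifted m ?x ?w) = groth m (map_poly ?ev [:-1, 1:]) (\<lambda>i. map_poly ?ev [:?x i:]) ?w"
    unfolding groth_shifted_def by (rule mev.hom_groth)
  then have G: "G_poly m n k p = map_poly ?ev (groth_shifted m ?x ?w)"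
    unfolding G_poly_eq_groth[OF v] by (simp add: map_poly_pCons one_pCons)
  have nk: "(n - 1) * k + k = n * k" using n by (cases n) simp_all
  have top: "degree (groth_shifted m ?x ?w) \<le> n * k" "coeff (groth_shifted m ?x ?w) (n * k) = stage_top m n k p 1 k ?x"
    using groth_shifted_stage[OF p order_refl n order_refl c inj] unfolding nk by blast+
  show "degree (G_poly m n k p) \<le> n * k"
    unfolding G by (rule degree_le) (use top(1) in \<open>simp add: coeff_map_poly coeff_eq_0\<close>)
  have "coeff (G_poly m n k p) (n * k) = ?ev (stage_top m n k p 1 k ?x)"
    unfolding G using top(2) by (simp add: coeff_map_poly)
  also have "\<dots> = ?ev (det (jt_mat (n + 1) ?x (stage_part n k p 1 k) (stage_flag k 1 k)))"
    unfolding stage_top_def by (simp add: poly_prod)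
  also have "\<dots> = det (map_mat ?ev (jt_mat (n + 1) ?x (stage_part n k p 1 k) (stage_flag k 1 k)))"
    by (rule ev.hom_det[symmetric])
  also have "map_mat ?ev (jt_mat (n + 1) ?x (stage_part n k p 1 k) (stage_flag k 1 k)) = binom_matrix n k p"
  proof (rule eq_matI)
    fix i j assume "i < dim_row (binom_matrix n k p)" "j < dim_col (binom_matrix n k p)"
    then have ij: "i < n + 1" "j < n + 1" by (simp_all add: binom_matrix_def)
    let ?a = "(n - i) * (p - 1)"
    have part: "stage_part n k p 1 k (Suc i) = ?a" "stage_flag k 1 k (Suc i) = Suc (k + i)"
      by (auto simp: stage_part_def stage_flag_def)
    have "map_mat ?ev (jt_mat (n + 1) ?x (stage_part n k p 1 k) (stage_flag k 1 k)) $$ (i, j) =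
        (if Suc i \<le> ?a + Suc j then hsym (\<lambda>_. 1) (Suc (k + i)) (?a + Suc j - Suc i) else 0)"
      using ij unfolding jt_mat_def jt_entry_def by (simp add: part[simplified] ev.hom_hsym)
    also have "\<dots> = int ((?a + Suc j + k - 1) choose (k + Suc i - 1))"
    proof (cases "i \<le> ?a + j")
      case True
      then have "k + i + (?a + Suc j - Suc i) = ?a + Suc j + k - 1" by simp
      then show ?thesis using True unfolding hsym_one by (simp only: Suc_le_mono add_Suc_right if_True diff_Suc_1)
    qed (simp add: binomial_eq_0)
    also have "\<dots> = binom_matrix n k p $$ (i, j)" using ij by (simp add: binom_matrix_def Let_def)
    finally show "map_mat ?ev (jt_mat (n + 1) ?x (stage_part n k p 1 k) (stage_flag k 1 k)) $$ (i, j) = binom_matrix n k p $$ (i, j)" .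
  qed (simp_all add: binom_matrix_def)
  finally show "coeff (G_poly m n k p) (n * k) = det (binom_matrix n k p)" .
qed

section \<open>Positivity of the top coefficient\<close>

text \<open>
  It remains to see that the top coefficient is not zero. For variables equal to 1 and parameter
  \<open>\<beta> - 1\<close> the operators have nonnegative coefficients: at a descent \<open>h\<^sub>i\<close> gives \<open>\<beta> \<phi>(w) + \<phi>(w s\<^sub>i)\<close> and
  otherwise \<open>\<phi>(w)\<close>. It therefore suffices to exhibit one choice of summands that produces
  \<open>\<beta>\<^bsup>n k\<^esup>\<close>. In the order of application reversed, every factor \<open>A\<^sub>i\<close> sweeps over the code from position
  \<open>i\<close> to the right. Each row stands still, at the cost of a factor \<open>\<beta>\<close>, in the first \<open>k\<close> sweeps that reach
  it, and in the next sweep it is moved completely to the right and vanishes.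
\<close>

definition coeffwise_nonneg :: "((nat \<Rightarrow> nat) \<Rightarrow> int poly) \<Rightarrow> bool" where
  "coeffwise_nonneg \<phi> \<longleftrightarrow> (\<forall>w d. 0 \<le> coeff (\<phi> w) d)"

abbreviation h_one :: "nat \<Rightarrow> ((nat \<Rightarrow> nat) \<Rightarrow> int poly) \<Rightarrow> (nat \<Rightarrow> nat) \<Rightarrow> int poly" where
  "h_one i \<equiv> h_op [:-1, 1:] i 1"

abbreviation A_one :: "nat \<Rightarrow> nat \<Rightarrow> ((nat \<Rightarrow> nat) \<Rightarrow> int poly) \<Rightarrow> (nat \<Rightarrow> nat) \<Rightarrow> int poly" where
  "A_one m i \<equiv> A_op m [:-1, 1:] i 1"

lemma h_one_eq:
  "h_one i \<phi> w = (if w (Suc i) < w i then pCons 0 (\<phi> w) + \<phi> (w \<circ> adj i) else \<phi> w)"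
  by (simp add: h_op_def idc_op_def)

lemma coeffwise_nonneg_h_one: "coeffwise_nonneg \<phi> \<Longrightarrow> coeffwise_nonneg (h_one i \<phi>)"
  unfolding coeffwise_nonneg_def h_one_eq by (auto simp: coeff_pCons split: nat.splits)

lemma coeffwise_nonneg_A_one: "coeffwise_nonneg \<phi> \<Longrightarrow> coeffwise_nonneg (A_one m i \<phi>)"
proof (induction "m - i" arbitrary: i)
  case 0
  then show ?case by (simp add: A_op_triv)
next
  case (Suc d)
  then have "i < m" "coeffwise_nonneg (A_one m (Suc i) \<phi>)" by auto
  then show ?case using coeffwise_nonneg_h_one by (simp add: A_op_step)
qed

lemma h_one_pos:
  assumes nn: "coeffwise_nonneg \<phi>" and c: "has_code m a w" and i: "1 \<le> i"
  shows "a (Suc i) < a i \<Longrightarrow> 0 < coeff (\<phi> w) d \<Longrightarrow> 0 < coeff (h_one i \<phi> w) (Suc d)"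
    and "a (Suc i) < a i \<Longrightarrow> 0 < coeff (\<phi> (w \<circ> adj i)) d \<Longrightarrow> 0 < coeff (h_one i \<phi> w) d"
    and "\<not> a (Suc i) < a i \<Longrightarrow> h_one i \<phi> w = \<phi> w"
proof -
  have nn': "0 \<le> coeff (\<phi> v) e" for v e using nn by (simp add: coeffwise_nonneg_def)
  note d = has_codeD(4)[OF c i]
  show "0 < coeff (h_one i \<phi> w) (Suc d)" if "a (Suc i) < a i" "0 < coeff (\<phi> w) d"
    using that d nn'[of "w \<circ> adj i" "Suc d"] by (simp add: h_one_eq)
  show "0 < coeff (h_one i \<phi> w) d" if "a (Suc i) < a i" "0 < coeff (\<phi> (w \<circ> adj i)) d"
    using that d nn'[of w "d - 1"] by (cases d) (simp_all add: h_one_eq)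
  show "h_one i \<phi> w = \<phi> w" if "\<not> a (Suc i) < a i" using that d by (simp add: h_one_eq)
qed

lemma A_one_ascents:
  assumes nn: "coeffwise_nonneg \<phi>" and c: "has_code m a w" and i: "1 \<le> i"
    and asc: "\<And>l. i \<le> l \<Longrightarrow> l < j \<Longrightarrow> \<not> a (Suc l) < a l" and ij: "i \<le> j"
  shows "A_one m i \<phi> w = A_one m j \<phi> w"
  using ij i asc
proof (induction i rule: inc_induct)
  case (step i)
  show ?case
  proof (cases "i < m")
    case True
    then have "A_one m i \<phi> w = A_one m (Suc i) \<phi> w"
      using h_one_pos(3)[OF coeffwise_nonneg_A_one[OF nn] c, of i] step by (simp add: A_op_step)
    then show ?thesis using step by simp
  next
    case False
    then show ?thesis using step by (simp add: A_op_triv)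
  qed
qed simp

text \<open>
  The summand \<open>\<beta> \<phi>(w)\<close> is chosen at each of the descents from \<open>i\<close> to \<open>j\<close>.
\<close>

lemma A_one_keep:
  assumes nn: "coeffwise_nonneg \<phi>" and c: "has_code m a w" and i: "1 \<le> i"
    and desc: "\<And>l. i \<le> l \<Longrightarrow> l < j \<Longrightarrow> a (Suc l) < a l" and ij: "i \<le> j"
    and pos: "0 < coeff (A_one m j \<phi> w) d"
  shows "0 < coeff (A_one m i \<phi> w) (d + (j - i))"
  using ij i desc
proof (induction i rule: inc_induct)
  case base
  then show ?case using pos by simp
next
  case (step i)
  have d: "a (Suc i) < a i" using step by simp
  have "i < m" using has_codeD(3)[OF c, of i] step.prems(1) d by linarith
  moreover have "d + (j - i) = Suc (d + (j - Suc i))" using step by simp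
  ultimately show ?case
    using h_one_pos(1)[OF coeffwise_nonneg_A_one[OF nn, of m "Suc i"] c step.prems(1) d, of "d + (j - Suc i)"]
      step.IH step.prems by (simp add: A_op_step)
qed

text \<open>
  The summand \<open>\<phi>(w s\<^sub>i)\<close> is chosen until the last row of the code has disappeared.
\<close>

lemma A_one_move:
  assumes nn: "coeffwise_nonneg \<phi>"
  shows "1 \<le> i \<Longrightarrow> has_code m a w \<Longrightarrow> (\<And>t. i < t \<Longrightarrow> a t = 0) \<Longrightarrow> 
    (\<And>w'. has_code m (a(i := 0)) w' \<Longrightarrow> 0 < coeff (\<phi> w') d) \<Longrightarrow> 0 < coeff (A_one m i \<phi> w) d"
proof (induction "m - i" arbitrary: i a w)
  case 0
  have "a i = 0" using has_codeD(3)[OF 0(3), of i] 0 by simp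
  then have "a(i := 0) = a" by (simp add: fun_eq_iff)
  then have "0 < coeff (\<phi> w) d" using 0(3,5) by simp
  then show ?case using 0(1) by (simp add: A_op_triv)
next
  case (Suc s)
  then have im: "i < m" "s = m - Suc i" by auto
  show ?case
  proof (cases "a i = 0")
    case True
    then have "a(i := 0) = a" by (simp add: fun_eq_iff)
    then have "0 < coeff (\<phi> w) d" using Suc.prems(2,4) by simp
    moreover have "A_one m i \<phi> w = A_one m m \<phi> w"
      by (rule A_one_ascents[OF nn Suc.prems(2,1)]) (use im True Suc.prems(3) in \<open>force simp: le_less\<close>)+
    ultimately show ?thesis by (simp add: A_op_triv)
  next
    case False
    then have gt: "a (Suc i) < a i" using Suc.prems(3)[of "Suc i"] by simp
    note low = has_code_lower(1)[OF Suc.prems(2,1) gt]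
    let ?a = "a(i := a (Suc i), Suc i := a i - 1)"
    have "0 < coeff (\<phi> w') d" if "has_code m (?a(Suc i := 0)) w'" for w'
      by (rule Suc.prems(4), rule has_code_cong[OF that]) (use Suc.prems(3) in auto)
    moreover have "?a t = 0" if "Suc i < t" for t using that Suc.prems(3) by simp
    ultimately have "0 < coeff (A_one m (Suc i) \<phi> (w \<circ> adj i)) d"
      using Suc.hyps(1)[OF im(2) _ low] by simp
    from h_one_pos(2)[OF coeffwise_nonneg_A_one[OF nn] Suc.prems(2,1) gt this]
    show ?thesis using im by (simp add: A_op_step)
  qed
qed

lemma rows_code_descent:
  assumes "1 \<le> p" "R \<le> n" "k < l" "l \<le> k + R"
  shows "rows_code n k p R (Suc l) < rows_code n k p R l"
proof -
  have "(n + 1 - (Suc l - k)) * p < (n + 1 - (l - k)) * p" using assms by simp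
  then show ?thesis using assms by (auto simp: rows_code_def)
qed

definition sweeps :: "nat \<Rightarrow> nat \<Rightarrow> (nat \<Rightarrow> nat) \<Rightarrow> int poly" where
  "sweeps m i = fold (\<lambda>i. A_one m i) [1..<Suc i] (delta id)"

lemma sweeps_0: "sweeps m 0 = delta id"
  by (simp add: sweeps_def)

lemma sweeps_Suc: "sweeps m (Suc i) = A_one m (Suc i) (sweeps m i)"
  unfolding sweeps_def by (rule fold_upt_Suc) simp

lemma coeffwise_nonneg_sweeps: "coeffwise_nonneg (sweeps m i)"
proof (induction i)
  case 0
  show ?case by (auto simp: coeffwise_nonneg_def sweeps_0 delta_def coeff_1)
next
  case (Suc i)
  then show ?case unfolding sweeps_Suc by (rule coeffwise_nonneg_A_one)
qed

text \<open>
  The positions up to \<open>k\<close> carry no rows; from there on the rows in front of position \<open>l\<close> stand still.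
\<close>

lemma A_one_rows:
  assumes nn: "coeffwise_nonneg \<phi>" and p: "1 \<le> p" and R: "R \<le> n" and c: "has_code m (rows_code n k p R) w"
    and i: "1 \<le> i" and l: "max (k + 1) i \<le> l" "l \<le> k + R + 1"
    and pos: "0 < coeff (A_one m l \<phi> w) d"
  shows "0 < coeff (A_one m i \<phi> w) (d + (l - max (k + 1) i))"
proof -
  let ?l0 = "max (k + 1) i"
  have "A_one m i \<phi> w = A_one m ?l0 \<phi> w"
    by (rule A_one_ascents[OF nn c i]) (auto simp: rows_code_def)
  moreover have "0 < coeff (A_one m ?l0 \<phi> w) (d + (l - ?l0))"
    by (rule A_one_keep[OF nn c _ _ l(1) pos]) (use l in \<open>auto intro!: rows_code_descent[OF p R]\<close>)
  ultimately show ?thesis by simp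
qed

text \<open>
  In the first \<open>n\<close> factors, the factor \<open>A\<^sub>i\<^sub>+\<^sub>1\<close> makes row \<open>i + 1\<close> disappear, while \<open>min i k\<close> rows in front of it
  are reached and stand still.
\<close>

lemma sweeps_moving:
  assumes p: "1 \<le> p"
  shows "i \<le> n \<Longrightarrow> has_code m (rows_code n k p i) w \<Longrightarrow> 0 < coeff (sweeps m i w) (\<Sum>j<i. min j k)"
proof (induction i arbitrary: w)
  case 0
  have "has_code m (rows_code n k p 0) id"
    by (auto simp: has_code_def permutes_id lehmer_code_id rows_code_def)
  then have "w = id" using has_code_unique 0 by blast
  then show ?case by (simp add: sweeps_0 delta_def id_def)
next
  case (Suc i)
  let ?R = "rows_code n k p (Suc i)"
  note nn = coeffwise_nonneg_sweeps[of m i]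
  have "0 < coeff (A_one m (k + Suc i) (sweeps m i) w) (\<Sum>j<i. min j k)"
  proof (rule A_one_move[OF nn _ Suc.prems(2)])
    fix w' assume "has_code m (?R(k + Suc i := 0)) w'"
    then have "has_code m (rows_code n k p i) w'"
      by (rule has_code_cong) (auto simp: rows_code_def)
    then show "0 < coeff (sweeps m i w') (\<Sum>j<i. min j k)" using Suc by simp
  qed (auto simp: rows_code_def)
  then have "0 < coeff (A_one m (Suc i) (sweeps m i) w) ((\<Sum>j<i. min j k) + (k + Suc i - max (k + 1) (Suc i)))"
    by (intro A_one_rows[OF nn p Suc.prems]) auto
  also have "k + Suc i - max (k + 1) (Suc i) = min i k" by auto
  finally show ?case by (simp only: sweeps_Suc sum.lessThan_Suc)
qed

text \<open>
  The following \<open>k\<close> factors leave all \<open>n\<close> rows in place; the factor \<open>A\<^sub>n\<^sub>+\<^sub>t\<^sub>+\<^sub>1\<close> reaches \<open>min n (k - t)\<close> of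
  them.
\<close>

lemma sweeps_standing:
  assumes p: "1 \<le> p" and c: "has_code m (rows_code n k p n) w"
  shows "t \<le> k \<Longrightarrow> 0 < coeff (sweeps m (n + t) w) ((\<Sum>j<n. min j k) + (\<Sum>t'<t. min n (k - t')))"
proof (induction t)
  case 0
  then show ?case using sweeps_moving[OF p order_refl c] by simp
next
  case (Suc t)
  note nn = coeffwise_nonneg_sweeps[of m "n + t"]
  let ?l = "k + n + 1" and ?d = "(\<Sum>j<n. min j k) + (\<Sum>t'<t. min n (k - t'))"
  have "A_one m ?l (sweeps m (n + t)) w = A_one m (max m ?l) (sweeps m (n + t)) w"
    by (rule A_one_ascents[OF nn c]) (auto simp: rows_code_def)
  also have "\<dots> = sweeps m (n + t) w" by (simp add: A_op_triv)
  finally have pos: "0 < coeff (A_one m ?l (sweeps m (n + t)) w) ?d" using Suc by simp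
  have "0 < coeff (A_one m (Suc (n + t)) (sweeps m (n + t)) w) (?d + (?l - max (k + 1) (Suc (n + t))))"
    by (rule A_one_rows[OF nn p order_refl c _ _ _ pos]) (use Suc.prems in auto)
  also have "?l - max (k + 1) (Suc (n + t)) = min n (k - t)" using Suc.prems by auto
  finally show ?case by (simp only: add_Suc_right sweeps_Suc sum.lessThan_Suc add.assoc)
qed

lemma sweeps_idle:
  assumes c: "has_code m (rows_code n k p n) w"
  shows "k + n \<le> i \<Longrightarrow> sweeps m i w = sweeps m (k + n) w"
proof (induction i rule: dec_induct)
  case (step i)
  note nn = coeffwise_nonneg_sweeps[of m i]
  have "A_one m (Suc i) (sweeps m i) w = A_one m (max m (Suc i)) (sweeps m i) w"
    by (rule A_one_ascents[OF nn c]) (use step in \<open>auto simp: rows_code_def\<close>)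
  then show ?case using step.IH by (simp only: sweeps_Suc) (simp add: A_op_triv)
qed simp

text \<open>
  The pairs \<open>(j, t)\<close> in an \<open>n\<close> by \<open>k\<close> rectangle, counted on both sides of the diagonal.
\<close>

lemma sum_min_rectangle:
  fixes n k :: nat
  shows "(\<Sum>j<n. min j k) + (\<Sum>t<k. min n (k - t)) = n * k"
proof (induction k)
  case 0
  show ?case by simp
next
  case (Suc k)
  have "(\<Sum>j<n. min j (Suc k)) + min n (Suc k) = (\<Sum>j<n. min j k) + n"
    by (induction n) auto
  then show ?case using Suc by (simp add: sum.lessThan_Suc_shift del: sum.lessThan_Suc)
qed

lemma coeff_G_poly_pos:
  assumes p: "1 \<le> p" and n: "1 \<le> n" and v: "varpi n k p permutes {1..m}"
  shows "0 < coeff (G_poly m n k p) (n * k)"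
proof -
  let ?w = "varpi n k p"
  note c = has_code_varpi[OF v]
  have "p \<le> m - (k + n)" using has_codeD(3)[OF c, of "k + n"] n by (simp add: rows_code_def)
  then have "k + n \<le> m" using p by simp
  have "G_poly m n k p = sweeps m m ?w"
    unfolding G_poly_eq_groth[OF v] groth_extend sweeps_def ..
  also have "\<dots> = sweeps m (n + k) ?w" using sweeps_idle[OF c \<open>k + n \<le> m\<close>] by (simp only: add.commute)
  finally show ?thesis using sweeps_standing[OF p c order_refl] unfolding sum_min_rectangle by simp
qed

theorem theorem5p10:
  fixes n k p :: nat
  assumes "n \<ge> 1" and "k \<ge> 1" and "p \<ge> 1"
  shows "(\<forall>m. varpi n 1 p permutes {1..m} \<longrightarrow>
            map_poly rat_of_int (G_poly m n 1 p) =
              (\<Sum>j = 1..n + 1.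
                 monom (1 / of_nat (n + 1) * of_nat ((n + 1) choose j)
                          * of_nat (((n + 1) * p) choose (j - 1))) (j - 1)))
       \<and> (k \<ge> 2 \<longrightarrow> (\<forall>m. varpi n k p permutes {1..m} \<longrightarrow>
            degree (G_poly m n k p) = n * k \<and>
            coeff (G_poly m n k p) (n * k) = det (binom_matrix n k p)))"
proof (intro conjI allI impI)
  fix m assume "varpi n 1 p permutes {1..m}"
  then show "map_poly rat_of_int (G_poly m n 1 p) = (\<Sum>j = 1..n + 1.
      monom (1 / of_nat (n + 1) * of_nat ((n + 1) choose j) * of_nat (((n + 1) * p) choose (j - 1))) (j - 1))"
    using assms(3) by (rule G_poly_1)
next
  fix m assume v: "varpi n k p permutes {1..m}"
  show "degree (G_poly m n k p) = n * k"
  proof (rule antisym)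
    show "degree (G_poly m n k p) \<le> n * k" by (rule coeff_G_poly_top(1)[OF assms(3,1) v])
    show "n * k \<le> degree (G_poly m n k p)"
      using coeff_G_poly_pos[OF assms(3,1) v] by (intro le_degree) simp
  qed
  show "coeff (G_poly m n k p) (n * k) = det (binom_matrix n k p)"
    by (rule coeff_G_poly_top(2)[OF assms(3,1) v])
qed

end
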